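(* Let $(w_i)_{i\ge0}$ be a sequence of nonnegative numbers with $w_0>0$, let $\Phi(z):=\sum_{i\ge0}w_iz^i$ have radius of convergence $R_\Phi\in(0,\infty]$, and assume that $$\lim_{z\nearrow R_\Phi}\frac{z\Phi'(z)}{\Phi(z)}>1,\qquad \lim_{z\nearrow R_\Phi}\Phi'(z)=\infty .$$ Let $\mathcal{T}_n$ be the simply generated tree of size $n$ with generator $\Phi$. (This includes the case where $\mathcal{T}_n$ is a conditioned Galton--Watson tree whose offspring distribution $\xi$ satisfies $\mathbb{E}\xi=1$, $0<\operatorname{Var}\xi<\infty$, $\mathbb{E}e^{t\xi}<\infty$ for some $t>0$, and $\lim_{z\nearrow R_\Phi}\Phi'(z)=\infty$ for $\Phi(z)=\mathbb{E}z^\xi$.) Let $R(T)$ and $S(T)$ denote the number of root subtrees and of (general, non-fringe) subtrees of a rooted tree $T$, and let $\tau_m$, $m\ge 0$, be the exponential growth rates of $\mathbb{E}R(\mathcal{T}_n)^m$ defined in the context. Then for any $m\ge1$ there is a constant $\gamma'_m>0$ such that, as $n\to\infty$, $$\mathbb{E}\,S(\mathcal{T}_n)^m=\bigl(1+O(n^{-1})\bigr)\gamma'_m\tau_m^n .$$ More generally, for any $m,\ell\ge0$ there is a constant $\gamma'_{m,\ell}>0$ such that, as $n\to\infty$, $$\mathbb{E}\bigl[R(\mathcal{T}_n)^\ell S(\mathcal{T}_n)^m\bigr]=\bigl(1+O(n^{-1})\bigr)\gamma'_{m,\ell}\,\tau_{\ell+m}^n .$$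
   Context: All trees are rooted, ordered and finite; $|T|$ is the number of nodes of $T$, and $D_+(v)$ is the number of children of a node $v$. A (general, or "non-fringe") subtree of $T$ is a non-empty connected subset of the node set of $T$; a root subtree is a subtree containing the root of $T$. $S(T)$ and $R(T)$ are the numbers of subtrees and root subtrees of $T$. The weight of a tree is $w(T)=\prod_{v\in T}w_{D_+(v)}$. The simply generated tree $\mathcal{T}_n$ with generator $\Phi$ is the random ordered tree of size $n$ with $\mathbb{P}(\mathcal{T}_n=T)=w(T)/\sum_{T':|T'|=n}w(T')$ for $|T|=n$; only those $n$ for which $\sum_{T':|T'|=n}w(T')>0$ are considered. A conditioned Galton--Watson tree with offspring distribution $\xi$ (a Galton--Watson tree conditioned to have $n$ nodes) is the simply generated tree with $w_i=\mathbb{P}(\xi=i)$. The numbers $\tau_m$: for $m\ge0$ let $F_m(z):=\sum_T w(T)R(T)^mz^{|T|}$ (sum over all ordered trees), let $\rho_m$ be its radius of convergence, and $\tau_m:=\rho_0/\rho_m$ (so $\tau_0=1$). Under the stated hypotheses $0<\rho_m<\infty$, $1<\tau_1<\tau_2<\cdots$, and $\tau_m$ ($m\ge1$) is the number for which $\mathbb{E}R(\mathcal{T}_n)^m=(1+O(n^{-1}))\gamma_m\tau_m^n$ for some constant $\gamma_m>0$. *)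

theory Defs
  imports "HOL-Probability.Probability" "HOL-Library.Landau_Symbols"
begin

datatype plane_tree = Node "plane_tree list"

text \<open>
  A node is addressed by the list of child indices on the path from the root; the root is \<open>[]\<close>
  and the parent of \<open>v @ [i]\<close> is \<open>v\<close>.
\<close>

fun is_node :: "plane_tree \<Rightarrow> nat list \<Rightarrow> bool" where
  "is_node T [] = True"
| "is_node (Node ts) (i # v) = (i < length ts \<and> is_node (ts ! i) v)"

definition nodes :: "plane_tree \<Rightarrow> nat list set" where
  "nodes T = {v. is_node T v}"

definition num_nodes :: "plane_tree \<Rightarrow> nat" where
  "num_nodes T = card (nodes T)"

definition out_degree :: "plane_tree \<Rightarrow> nat list \<Rightarrow> nat" where
  "out_degree T v = card {i. v @ [i] \<in> nodes T}"

definition adjacent :: "nat list \<Rightarrow> nat list \<Rightarrow> bool" where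
  "adjacent u v \<longleftrightarrow> (\<exists>i. v = u @ [i] \<or> u = v @ [i])"

definition connected_nodes :: "nat list set \<Rightarrow> bool" where
  "connected_nodes A \<longleftrightarrow>
     (\<forall>u\<in>A. \<forall>v\<in>A. (u, v) \<in> {(x, y). x \<in> A \<and> y \<in> A \<and> adjacent x y}\<^sup>*)"

definition subtrees :: "plane_tree \<Rightarrow> nat list set set" where
  "subtrees T = {A. A \<subseteq> nodes T \<and> A \<noteq> {} \<and> connected_nodes A}"

definition num_subtrees :: "plane_tree \<Rightarrow> nat" where
  "num_subtrees T = card (subtrees T)"

definition num_root_subtrees :: "plane_tree \<Rightarrow> nat" where
  "num_root_subtrees T = card {A \<in> subtrees T. [] \<in> A}"

definition tree_weight :: "(nat \<Rightarrow> real) \<Rightarrow> plane_tree \<Rightarrow> real" where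
  "tree_weight w T = (\<Prod>v\<in>nodes T. w (out_degree T v))"

definition trees_of_size :: "nat \<Rightarrow> plane_tree set" where
  "trees_of_size n = {T. num_nodes T = n}"

definition partition_function :: "(nat \<Rightarrow> real) \<Rightarrow> nat \<Rightarrow> real" where
  "partition_function w n = (\<Sum>T\<in>trees_of_size n. tree_weight w T)"

text \<open>
  This is meaningful only when \<open>partition_function w n > 0\<close> (and \<open>w\<close> is nonnegative);
  see \<open>pmf_simply_generated_tree\<close> below.
\<close>

definition simply_generated_tree :: "(nat \<Rightarrow> real) \<Rightarrow> nat \<Rightarrow> plane_tree pmf" where
  "simply_generated_tree w n =
     embed_pmf (\<lambda>T. if T \<in> trees_of_size n then tree_weight w T / partition_function w n else 0)"

definition generator :: "(nat \<Rightarrow> real) \<Rightarrow> real \<Rightarrow> real" where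
  "generator w z = (\<Sum>i. w i * z ^ i)"

text \<open>
  The radius of convergence \<open>conv_radius w\<close> of the generator may be infinite, so the left limits
  are taken in the extended reals. The first limit may itself be infinite.
\<close>

definition admissible_weights :: "(nat \<Rightarrow> real) \<Rightarrow> bool" where
  "admissible_weights w \<longleftrightarrow>
     (\<forall>i. w i \<ge> 0) \<and> w 0 > 0 \<and> conv_radius w > 0 \<and>
     (\<exists>L::ereal. L > 1 \<and>
        (((\<lambda>z. ereal (z * deriv (generator w) z / generator w z)) \<circ> real_of_ereal) \<longlongrightarrow> L)
          (at_left (conv_radius w))) \<and>
     filterlim (deriv (generator w) \<circ> real_of_ereal) at_top (at_left (conv_radius w))"

text \<open>
  Offspring distributions of critical Galton--Watson trees. A Galton--Watson tree with offspring
  distribution \<open>\<xi>\<close> conditioned to have \<open>n\<close> nodes is \<open>simply_generated_tree (pmf \<xi>) n\<close>.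
\<close>

definition admissible_offspring :: "nat pmf \<Rightarrow> bool" where
  "admissible_offspring \<xi> \<longleftrightarrow>
     integrable \<xi> real \<and> measure_pmf.expectation \<xi> real = 1 \<and>
     integrable \<xi> (\<lambda>i. (real i)\<^sup>2) \<and> measure_pmf.variance \<xi> real > 0 \<and>
     (\<exists>t>0. integrable \<xi> (\<lambda>i. exp (t * real i))) \<and>
     filterlim (deriv (generator (pmf \<xi>)) \<circ> real_of_ereal) at_top
       (at_left (conv_radius (pmf \<xi>)))"

text \<open>
  \<open>rho w m\<close> is the radius of convergence of \<open>F\<^sub>m(z) = \<Sum>\<^sub>T w(T) R(T)\<^sup>m z\<^bsup>|T|\<^esup>\<close>,
  with the trees grouped by size. For admissible weights it is positive and finite.
\<close>

definition rho :: "(nat \<Rightarrow> real) \<Rightarrow> nat \<Rightarrow> ereal" where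
  "rho w m =
     conv_radius (\<lambda>n. \<Sum>T\<in>trees_of_size n. tree_weight w T * real (num_root_subtrees T) ^ m)"

definition tau :: "(nat \<Rightarrow> real) \<Rightarrow> nat \<Rightarrow> real" where
  "tau w m = real_of_ereal (rho w 0 / rho w m)"

text \<open>\<open>n \<rightarrow> \<infinity>\<close> through those sizes for which the simply generated tree exists.\<close>

definition admissible_sizes :: "(nat \<Rightarrow> real) \<Rightarrow> nat filter" where
  "admissible_sizes w = inf sequentially (principal {n. partition_function w n > 0})"

text \<open>\<open>E[X(T\<^sub>n)] = (1 + O(1/n)) c t\<^sup>n\<close>\<close>

definition expectation_asymptotics ::
    "(nat \<Rightarrow> real) \<Rightarrow> (plane_tree \<Rightarrow> real) \<Rightarrow> real \<Rightarrow> real \<Rightarrow> bool" where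
  "expectation_asymptotics w X c t \<longleftrightarrow>
     (\<exists>\<epsilon> \<in> O[admissible_sizes w](\<lambda>n. 1 / real n). \<forall>\<^sub>F n in admissible_sizes w.
        measure_pmf.expectation (simply_generated_tree w n) X = (1 + \<epsilon> n) * c * t ^ n)"

lemma nodes_Node: "nodes (Node ts) = insert [] (\<Union>i<length ts. (#) i ` nodes (ts ! i))"
proof (rule set_eqI)
  fix v show "v \<in> nodes (Node ts) \<longleftrightarrow> v \<in> insert [] (\<Union>i<length ts. (#) i ` nodes (ts ! i))"
    by (cases v) (auto simp: nodes_def)
qed

lemma finite_nodes: "finite (nodes T)"
proof (induction T)
  case (Node ts)
  then show ?case by (auto simp: nodes_Node)
qed

lemma num_nodes_Node: "num_nodes (Node ts) = Suc (\<Sum>i<length ts. num_nodes (ts ! i))"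
proof -
  have "card (\<Union>i<length ts. (#) i ` nodes (ts ! i)) = (\<Sum>i<length ts. card ((#) i ` nodes (ts ! i)))"
    by (rule card_UN_disjoint) (auto simp: finite_nodes)
  also have "\<dots> = (\<Sum>i<length ts. num_nodes (ts ! i))"
    by (intro sum.cong refl) (simp add: num_nodes_def card_image)
  finally have *: "card (\<Union>i<length ts. (#) i ` nodes (ts ! i)) = (\<Sum>i<length ts. num_nodes (ts ! i))" .
  have "num_nodes (Node ts) = Suc (card (\<Union>i<length ts. (#) i ` nodes (ts ! i)))"
    unfolding num_nodes_def nodes_Node by (rule card_insert_disjoint) (auto simp: finite_nodes)
  with * show ?thesis by simp
qed

lemma num_nodes_pos: "num_nodes T > 0"
  by (cases T) (simp add: num_nodes_Node)

lemma finite_trees_upto: "finite {T. num_nodes T \<le> n}"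
proof (induction n)
  case 0
  have "{T. num_nodes T \<le> 0} = {}" using num_nodes_pos by (auto simp: not_le)
  then show ?case by (metis finite.emptyI)
next
  case (Suc n)
  have "{T. num_nodes T \<le> Suc n} \<subseteq> Node ` {ts. set ts \<subseteq> {T. num_nodes T \<le> n} \<and> length ts \<le> n}"
  proof
    fix T assume "T \<in> {T. num_nodes T \<le> Suc n}"
    moreover obtain ts where T: "T = Node ts" by (cases T)
    ultimately have le: "(\<Sum>i<length ts. num_nodes (ts ! i)) \<le> n" by (simp add: num_nodes_Node)
    have "(\<Sum>i<length ts. 1) \<le> (\<Sum>i<length ts. num_nodes (ts ! i))"
      using num_nodes_pos by (intro sum_mono) (simp add: Suc_leI)
    with le have "length ts \<le> n" by simp
    moreover have "num_nodes (ts ! i) \<le> n" if "i < length ts" for i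
      using le member_le_sum[of i "{..<length ts}" "\<lambda>i. num_nodes (ts ! i)"] that by simp
    then have "set ts \<subseteq> {T. num_nodes T \<le> n}" by (auto simp: in_set_conv_nth)
    ultimately show "T \<in> Node ` {ts. set ts \<subseteq> {T. num_nodes T \<le> n} \<and> length ts \<le> n}"
      using T by blast
  qed
  moreover have "finite (Node ` {ts. set ts \<subseteq> {T. num_nodes T \<le> n} \<and> length ts \<le> n})"
    using Suc by (intro finite_imageI finite_lists_length_le)
  ultimately show ?case by (rule finite_subset)
qed

lemma finite_trees_of_size: "finite (trees_of_size n)"
  by (rule finite_subset[OF _ finite_trees_upto[of n]]) (auto simp: trees_of_size_def)

lemma pmf_simply_generated_tree:
  assumes "\<And>i. w i \<ge> 0" and "partition_function w n > 0"
  shows "pmf (simply_generated_tree w n) T =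
           (if T \<in> trees_of_size n then tree_weight w T / partition_function w n else 0)"
proof -
  let ?f = "\<lambda>T. if T \<in> trees_of_size n then tree_weight w T / partition_function w n else 0"
  have nonneg: "?f T \<ge> 0" for T
    using assms by (auto simp: tree_weight_def intro!: divide_nonneg_pos prod_nonneg)
  have "(\<integral>\<^sup>+T. ennreal (?f T) \<partial>count_space UNIV) = (\<Sum>T\<in>trees_of_size n. ennreal (?f T))"
    by (rule nn_integral_count_space'[OF finite_trees_of_size]) auto
  also have "\<dots> = ennreal (\<Sum>T\<in>trees_of_size n. ?f T)"
    using nonneg by (rule sum_ennreal)
  also have "(\<Sum>T\<in>trees_of_size n. ?f T) = partition_function w n / partition_function w n"
    by (simp add: partition_function_def flip: sum_divide_distrib)
  finally have "(\<integral>\<^sup>+T. ennreal (?f T) \<partial>count_space UNIV) = 1"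
    using assms by simp
  with nonneg show ?thesis
    unfolding simply_generated_tree_def by (rule pmf_embed_pmf)
qed

end

theory Submission
  imports Defs "HOL-Complex_Analysis.Complex_Analysis" "HOL-Real_Asymp.Real_Asymp"
begin

text \<open>
  Write \<open>F\<^sub>l\<^sub>,\<^sub>m(z) = \<Sum>\<^sub>T w(T) R(T)\<^sup>l S(T)\<^sup>m z\<^bsup>|T|\<^esup>\<close>. For a tree with branches \<open>T\<^sub>1, \<dots>, T\<^sub>k\<close> one has
  \<open>R(T) = \<Prod>\<^sub>i (1 + R(T\<^sub>i))\<close> and \<open>S(T) = R(T) + \<Sum>\<^sub>i S(T\<^sub>i)\<close>. Hence \<open>F\<^sub>m = F\<^sub>m\<^sub>,\<^sub>0\<close> satisfies
  \<open>F\<^sub>m = z \<Phi>(Y\<^sub>m)\<close>, where \<open>Y\<^sub>m = F\<^sub>m + G\<^sub>m\<close> and \<open>G\<^sub>m\<close> is a combination of the \<open>F\<^sub>j\<close> with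
  \<open>j < m\<close>, which have a larger radius of convergence. The system \<open>y = G\<^sub>m(x) + x \<Phi>(y)\<close>,
  \<open>1 = x \<Phi>'(y)\<close> has a solution inside the region of analyticity, so \<open>Y\<^sub>m\<close> has a square root
  singularity at \<open>\<rho>\<^sub>m\<close> (and at its rotations by the \<open>d\<close>-th roots of unity, \<open>d\<close> being the period of
  the weights), and the coefficients of \<open>F\<^sub>m\<close> are \<open>\<kappa> \<rho>\<^sub>m\<^bsup>-n\<^esup> n\<^bsup>-3/2\<^esup> (1 + O(1/n))\<close>. Instead of a
  contour deformation, the coefficient bound uses that \<open>Y\<^sub>m\<close> minus three singular terms has a bounded
  third derivative on the open disc.

  Expanding \<open>S\<^sup>m\<close> along the root gives, by induction on \<open>m\<close>, a linear equation for \<open>F\<^sub>l\<^sub>,\<^sub>m\<close> whose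
  solution is \<open>A + B F\<^sub>l\<^sub>+\<^sub>m\<close> with \<open>A\<close>, \<open>B\<close> of nonnegative coefficients and of radius larger than
  \<open>\<rho>\<^sub>l\<^sub>+\<^sub>m\<close>. Convolution with \<open>B\<close> preserves the shape of the asymptotics, and the constant stays
  positive because \<open>S \<ge> R\<close>.
\<close>

section \<open>Root subtrees and branches\<close>

text \<open>The radii decrease strictly because the critical point for \<open>m\<close> starts the
  search for the next one: \<open>lower_part (Suc m)\<close> dominates \<open>Y m\<close>
  coefficientwise, so at \<open>rad m\<close> it is at least \<open>crit m\<close>, the reduced
  characteristic equation still has positive sign there, and its root lies further out in
  \<open>y\<close>, hence at a smaller \<open>x = 1 / \<Phi>' y\<close>. At the critical point
  \<open>y\<close> is not a holomorphic function of \<open>z\<close>, but \<open>z\<close> is one of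
  \<open>y\<close>, and \<open>1 - (z / \<rho>)^d\<close> then has a double zero; inverting this
  gives the square root. Each singular term carries a factor \<open>z\<close>: it then has the
  symmetry \<open>f(\<omega> z) = \<omega> f(z)\<close> of a series supported on
  \<open>n mod d = 1 mod d\<close>, and all \<open>d\<close> boundary singularities are removed
  together. Three terms are the least number that suffices for this method: the rest is of type
  \<open>u^(7/2)\<close>, its third derivative is bounded, and its coefficients are of order
  \<open>n^-3\<close>, below the admissible error \<open>n^(-5/2)\<close>. The linear equation for
  mixed moments is solvable because its kernel \<open>x \<Phi>'(Y_a(x))\<close> is below 1 for
  \<open>x < rad a\<close>, and only indices \<open>a < l + m\<close> occur in it.\<close>

lemma out_degree_Node_Nil: "out_degree (Node ts) [] = length ts"
proof -
  have "{i. [] @ [i] \<in> nodes (Node ts)} = {..<length ts}" by (auto simp: nodes_def)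
  thus ?thesis by (simp add: out_degree_def)
qed

lemma out_degree_Node_Cons: "i < length ts \<Longrightarrow> out_degree (Node ts) (i # v) = out_degree (ts ! i) v"
  by (simp add: out_degree_def nodes_def)

lemma prod_nth_eq_prod_list: "(\<Prod>i<length ts. f (ts ! i)) = (\<Prod>t\<leftarrow>ts. f t :: 'a :: comm_monoid_mult)"
  by (simp add: prod.list_conv_set_nth lessThan_atLeast0)

lemma sum_nth_eq_sum_list: "(\<Sum>i<length ts. f (ts ! i)) = (\<Sum>t\<leftarrow>ts. f t :: 'a :: comm_monoid_add)"
  by (simp add: sum.list_conv_set_nth lessThan_atLeast0)

lemma tree_weight_Node: "tree_weight w (Node ts) = w (length ts) * (\<Prod>t\<leftarrow>ts. tree_weight w t)"
proof -
  have "(\<Prod>v\<in>(\<Union>i<length ts. (#) i ` nodes (ts ! i)). w (out_degree (Node ts) v))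
      = (\<Prod>i<length ts. \<Prod>v\<in>(#) i ` nodes (ts ! i). w (out_degree (Node ts) v))"
    by (rule prod.UNION_disjoint) (auto simp: finite_nodes)
  also have "\<dots> = (\<Prod>i<length ts. tree_weight w (ts ! i))"
    by (intro prod.cong refl) (simp add: tree_weight_def prod.reindex out_degree_Node_Cons)
  finally have *: "(\<Prod>v\<in>(\<Union>i<length ts. (#) i ` nodes (ts ! i)). w (out_degree (Node ts) v))
      = (\<Prod>t\<leftarrow>ts. tree_weight w t)" by (simp add: prod_nth_eq_prod_list)
  have "tree_weight w (Node ts) = w (out_degree (Node ts) []) *
      (\<Prod>v\<in>(\<Union>i<length ts. (#) i ` nodes (ts ! i)). w (out_degree (Node ts) v))"
    unfolding tree_weight_def nodes_Node by (rule prod.insert) (auto simp: finite_nodes)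
  with * show ?thesis by (simp add: out_degree_Node_Nil)
qed

text \<open>One step in \<open>A\<close> appends or removes the last letter, so a walk from the root
  reaches an address only after all its prefixes have been met in \<open>A\<close>. Conversely,
  dropping last letters one by one leads from any address back to the root inside
  \<open>A\<close>.\<close>

lemma connected_nodes_root_iff:
  assumes "[] \<in> A"
  shows "connected_nodes A \<longleftrightarrow> (\<forall>v i. v @ [i] \<in> A \<longrightarrow> v \<in> A)"
proof
  let ?R = "{(x, y). x \<in> A \<and> y \<in> A \<and> adjacent x y}"
  assume conn: "connected_nodes A"
  have prefixes: "\<forall>p q. x = p @ q \<longrightarrow> p \<in> A" if "([], x) \<in> ?R\<^sup>*" for x
    using that
  proof (induction rule: rtrancl_induct)
    case base
    then show ?case using assms by simp
  next
    case (step y z)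
    then consider i where "z = y @ [i]" | i where "y = z @ [i]" by (auto simp: adjacent_def)
    then show ?case
    proof cases
      case 1
      show ?thesis
      proof (intro allI impI)
        fix p q assume "z = p @ q"
        then show "p \<in> A" using step 1 by (cases q rule: rev_cases) auto
      qed
    next
      case 2
      then show ?thesis using step by auto
    qed
  qed
  show "\<forall>v i. v @ [i] \<in> A \<longrightarrow> v \<in> A"
    using conn assms prefixes unfolding connected_nodes_def by blast
next
  let ?R = "{(x, y). x \<in> A \<and> y \<in> A \<and> adjacent x y}"
  assume closed: "\<forall>v i. v @ [i] \<in> A \<longrightarrow> v \<in> A"
  have "v \<in> A \<Longrightarrow> ([], v) \<in> ?R\<^sup>*" for v
  proof (induction v rule: rev_induct)
    case (snoc i v)
    then have "v \<in> A" using closed by blast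
    with snoc have "([], v) \<in> ?R\<^sup>*" "(v, v @ [i]) \<in> ?R" by (auto simp: adjacent_def)
    then show ?case by (rule rtrancl_into_rtrancl)
  qed simp
  moreover have "sym (?R\<^sup>*)" by (intro sym_rtrancl) (auto simp: sym_def adjacent_def)
  ultimately show "connected_nodes A"
    unfolding connected_nodes_def by (meson rtrancl_trans symD)
qed

lemma finite_subtrees: "finite (subtrees T)"
  by (rule finite_subset[of _ "Pow (nodes T)"]) (auto simp: subtrees_def finite_nodes)

definition prefix_closed_sets :: "plane_tree \<Rightarrow> nat list set set" where
  "prefix_closed_sets T = {A. A \<subseteq> nodes T \<and> (\<forall>v i. v @ [i] \<in> A \<longrightarrow> v \<in> A)}"

lemma root_subtrees_altdef: "{A \<in> subtrees T. [] \<in> A} = {A \<in> prefix_closed_sets T. [] \<in> A}"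
  using connected_nodes_root_iff by (auto simp: subtrees_def prefix_closed_sets_def)

lemma prefix_closed_sets_eq: "prefix_closed_sets T = insert {} {A \<in> subtrees T. [] \<in> A}"
proof -
  have "[] \<in> A" if "v \<in> A" "\<forall>v i. v @ [i] \<in> A \<longrightarrow> v \<in> A" for v :: "nat list" and A
    using that by (induction v rule: rev_induct) auto
  then show ?thesis unfolding root_subtrees_altdef
    by (fastforce simp: prefix_closed_sets_def)
qed

lemma card_prefix_closed_sets: "card (prefix_closed_sets T) = Suc (num_root_subtrees T)"
  unfolding prefix_closed_sets_eq num_root_subtrees_def
  by (subst card_insert_disjoint) (auto simp: finite_subtrees)

text \<open>A root subtree is an independent choice, in each branch, of a root subtree or of
  nothing. \<open>h\<close> restricts a set to the branches and \<open>g\<close> glues the pieces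
  back under the root.\<close>

lemma num_root_subtrees_Node: "num_root_subtrees (Node ts) = (\<Prod>t\<leftarrow>ts. Suc (num_root_subtrees t))"
proof -
  let ?k = "length ts"
  let ?\<Pi> = "PiE {..<?k} (\<lambda>i. prefix_closed_sets (ts ! i))"
  define g where "g = (\<lambda>f. insert [] (\<Union>i<?k. (#) i ` (f i :: nat list set)))"
  define h where "h = (\<lambda>A. \<lambda>i\<in>{..<?k}. {v :: nat list. i # v \<in> A})"
  have bij: "bij_betw h {A \<in> prefix_closed_sets (Node ts). [] \<in> A} ?\<Pi>"
  proof (rule bij_betw_byWitness[where f' = g])
    show "\<forall>A\<in>{A \<in> prefix_closed_sets (Node ts). [] \<in> A}. g (h A) = A"
      unfolding prefix_closed_sets_def nodes_Node g_def h_def by fastforce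
    show "\<forall>f\<in>?\<Pi>. h (g f) = f"
    proof
      fix f assume f: "f \<in> ?\<Pi>"
      show "h (g f) = f"
      proof
        fix i show "h (g f) i = f i"
          using f by (cases "i < ?k") (auto simp: h_def g_def PiE_def extensional_def)
      qed
    qed
    show "h ` {A \<in> prefix_closed_sets (Node ts). [] \<in> A} \<subseteq> ?\<Pi>"
    proof (intro image_subsetI PiE_I)
      fix A i assume A: "A \<in> {A \<in> prefix_closed_sets (Node ts). [] \<in> A}" and i: "i \<in> {..<?k}"
      then have "v \<in> nodes (ts ! i)" if "i # v \<in> A" for v
        using that by (auto simp: prefix_closed_sets_def nodes_def)
      moreover from A have cl: "\<forall>v i. v @ [i] \<in> A \<longrightarrow> v \<in> A"
        by (simp add: prefix_closed_sets_def)
      then have "i # v \<in> A" if "i # v @ [j] \<in> A" for v j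
        using cl[rule_format, of "i # v" j] that by simp
      ultimately show "h A i \<in> prefix_closed_sets (ts ! i)"
        using i by (auto simp: h_def prefix_closed_sets_def)
    qed (simp add: h_def)
    show "g ` ?\<Pi> \<subseteq> {A \<in> prefix_closed_sets (Node ts). [] \<in> A}"
    proof safe
      fix f assume f: "f \<in> ?\<Pi>"
      show "[] \<in> g f" by (simp add: g_def)
      have fi: "f i \<subseteq> nodes (ts ! i) \<and> (\<forall>v j. v @ [j] \<in> f i \<longrightarrow> v \<in> f i)" if "i < ?k" for i
        using f that by (auto simp: PiE_def Pi_def prefix_closed_sets_def)
      have "v \<in> g f" if "v @ [j] \<in> g f" for v j
      proof (cases v)
        case (Cons i u)
        with that have "i < ?k" "u @ [j] \<in> f i" by (auto simp: g_def)
        with fi have "u \<in> f i" by blast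
        with \<open>i < ?k\<close> Cons show ?thesis by (auto simp: g_def)
      qed (simp add: g_def)
      moreover have "g f \<subseteq> nodes (Node ts)"
        using fi unfolding g_def nodes_Node by blast
      ultimately show "g f \<in> prefix_closed_sets (Node ts)"
        unfolding prefix_closed_sets_def by blast
    qed
  qed
  have "num_root_subtrees (Node ts) = card ?\<Pi>"
    unfolding num_root_subtrees_def root_subtrees_altdef by (rule bij_betw_same_card[OF bij])
  also have "\<dots> = (\<Prod>i<?k. Suc (num_root_subtrees (ts ! i)))"
    by (simp add: card_PiE card_prefix_closed_sets)
  finally show ?thesis
    using prod_nth_eq_prod_list[of "\<lambda>t. Suc (num_root_subtrees t)" ts] by simp
qed

section \<open>Subtrees that avoid the root\<close>

lemma rtrancl_image:
  assumes "(x, y) \<in> R\<^sup>*" "\<And>x y. (x, y) \<in> R \<Longrightarrow> (f x, f y) \<in> S"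
  shows "(f x, f y) \<in> S\<^sup>*"
  using assms(1) by (induction rule: rtrancl_induct) (auto intro: rtrancl_into_rtrancl assms(2))

lemma connected_nodes_Cons: "connected_nodes ((#) i ` B) \<longleftrightarrow> connected_nodes B"
proof -
  let ?R = "\<lambda>A. {(x, y). x \<in> A \<and> y \<in> A \<and> adjacent x y}"
  show ?thesis
  proof
    assume c: "connected_nodes ((#) i ` B)"
    show "connected_nodes B"
      unfolding connected_nodes_def
    proof (intro ballI)
      fix u v assume "u \<in> B" "v \<in> B"
      then have "(i # u, i # v) \<in> (?R ((#) i ` B))\<^sup>*"
        using c unfolding connected_nodes_def by blast
      then have "(tl (i # u), tl (i # v)) \<in> (?R B)\<^sup>*"
        by (rule rtrancl_image) (auto simp: adjacent_def)
      then show "(u, v) \<in> (?R B)\<^sup>*" by simp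
    qed
  next
    assume c: "connected_nodes B"
    have "(i # u, i # v) \<in> (?R ((#) i ` B))\<^sup>*" if "u \<in> B" "v \<in> B" for u v
    proof -
      have "(u, v) \<in> (?R B)\<^sup>*" using c that unfolding connected_nodes_def by blast
      then show ?thesis by (rule rtrancl_image) (auto simp: adjacent_def)
    qed
    then show "connected_nodes ((#) i ` B)"
      unfolding connected_nodes_def by blast
  qed
qed

text \<open>A connected set that avoids the root stays in one branch, since adjacent nonempty
  addresses share their first letter; it is then a shifted copy of a subtree of that branch.\<close>

lemma subtrees_Node:
  "subtrees (Node ts) = {A \<in> subtrees (Node ts). [] \<in> A} \<union>
     (\<Union>i<length ts. (`) ((#) i) ` subtrees (ts ! i))" (is "_ = ?A \<union> ?B")
proof (intro equalityI subsetI)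
  fix A assume A: "A \<in> subtrees (Node ts)"
  show "A \<in> ?A \<union> ?B"
  proof (cases "[] \<in> A")
    case False
    let ?R = "{(x, y). x \<in> A \<and> y \<in> A \<and> adjacent x y}"
    from A obtain u where u: "u \<in> A" by (auto simp: subtrees_def)
    with A False obtain i u' where i: "u = i # u'" "i < length ts"
      by (auto simp: subtrees_def nodes_Node)
    have hd: "hd x = i" if "(u, x) \<in> ?R\<^sup>*" for x
      using that
    proof (induction rule: rtrancl_induct)
      case (step y z)
      then have "y \<noteq> []" "z \<noteq> []" using False by auto
      with step show ?case by (auto simp: adjacent_def)
    qed (simp add: i)
    have conn: "connected_nodes A" using A by (simp add: subtrees_def)
    have *: "x = i # tl x" if "x \<in> A" for x
    proof -
      have "hd x = i" using hd conn u that by (auto simp: connected_nodes_def)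
      moreover have "x \<noteq> []" using that False by auto
      ultimately show ?thesis by (cases x) auto
    qed
    have "A = (#) i ` (tl ` A)" unfolding image_image using * by force
    moreover have "tl ` A \<in> subtrees (ts ! i)"
      unfolding subtrees_def
    proof safe
      fix x assume x: "x \<in> A"
      then have "x \<in> nodes (Node ts)" using A by (auto simp: subtrees_def)
      then have "i # tl x \<in> nodes (Node ts)" by (simp flip: *[OF x])
      then show "tl x \<in> nodes (ts ! i)" by (simp add: nodes_def)
    next
      show "connected_nodes (tl ` A)"
        using conn connected_nodes_Cons[of i "tl ` A"] \<open>A = (#) i ` (tl ` A)\<close> by simp
    qed (use u in auto)
    ultimately show ?thesis using i by blast
  qed (use A in auto)
next
  fix A assume "A \<in> ?A \<union> ?B"
  then show "A \<in> subtrees (Node ts)"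
    by (auto simp: subtrees_def connected_nodes_Cons nodes_Node)
qed

lemma num_subtrees_Node:
  "num_subtrees (Node ts) = num_root_subtrees (Node ts) + (\<Sum>t\<leftarrow>ts. num_subtrees t)"
proof -
  have inj: "inj_on ((`) ((#) i)) X" for i :: nat and X
    by (auto intro!: inj_onI simp: inj_image_eq_iff)
  have disj: "(`) ((#) i) ` subtrees (ts ! i) \<inter> (`) ((#) j) ` subtrees (ts ! j) = {}" if "i \<noteq> j" for i j
    using that by (auto simp: subtrees_def)
  have "card (\<Union>i<length ts. (`) ((#) i) ` subtrees (ts ! i)) = (\<Sum>i<length ts. num_subtrees (ts ! i))"
    by (subst card_UN_disjoint) (auto simp: finite_subtrees disj card_image inj num_subtrees_def)
  moreover have "card (subtrees (Node ts)) = card {A \<in> subtrees (Node ts). [] \<in> A}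
      + card (\<Union>i<length ts. (`) ((#) i) ` subtrees (ts ! i))"
    by (subst (1) subtrees_Node, rule card_Un_disjoint) (auto simp: finite_subtrees)
  ultimately show ?thesis
    by (simp add: num_subtrees_def num_root_subtrees_def flip: sum_nth_eq_sum_list)
qed

lemma num_root_subtrees_le_num_subtrees: "num_root_subtrees T \<le> num_subtrees T"
  by (cases T) (simp add: num_subtrees_Node)

lemma num_nodes_Node_list: "num_nodes (Node ts) = Suc (\<Sum>t\<leftarrow>ts. num_nodes t)"
  by (simp add: num_nodes_Node sum_nth_eq_sum_list)

section \<open>Power series with nonnegative coefficients\<close>

lemma nat_sum_swap_ennreal: "(\<Sum>n. \<Sum>k. f n k :: ennreal) = (\<Sum>k. \<Sum>n. f n k)"
proof -
  have "(\<Sum>k. \<Sum>n. f n k) = (\<Sum>k. \<integral>\<^sup>+ n. f n k \<partial>count_space UNIV)"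
    by (simp add: nn_integral_count_space_nat)
  also have "\<dots> = (\<integral>\<^sup>+ n. (\<Sum>k. f n k) \<partial>count_space UNIV)"
    by (rule nn_integral_suminf[symmetric]) simp
  finally show ?thesis by (simp add: nn_integral_count_space_nat)
qed

definition fps_nonneg :: "real fps \<Rightarrow> bool" where
  "fps_nonneg f \<longleftrightarrow> (\<forall>n. fps_nth f n \<ge> 0)"

text \<open>Convergence at the point itself instead of a bound on the radius: the series
  \<open>F m\<close> converge at their radius of convergence, and the values there determine the
  critical point.\<close>

definition fps_conv :: "real fps \<Rightarrow> real \<Rightarrow> bool" where
  "fps_conv f x \<longleftrightarrow> summable (\<lambda>n. fps_nth f n * x ^ n)"

lemma fps_nonneg_add [intro]: "fps_nonneg f \<Longrightarrow> fps_nonneg g \<Longrightarrow> fps_nonneg (f + g)"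
  by (auto simp: fps_nonneg_def)

lemma fps_nonneg_mult [intro]: "fps_nonneg f \<Longrightarrow> fps_nonneg g \<Longrightarrow> fps_nonneg (f * g)"
  by (auto simp: fps_nonneg_def fps_mult_nth intro!: sum_nonneg)

lemma fps_nonneg_0 [intro, simp]: "fps_nonneg 0" by (auto simp: fps_nonneg_def)
lemma fps_nonneg_1 [intro, simp]: "fps_nonneg 1" by (auto simp: fps_nonneg_def)
lemma fps_nonneg_X [intro, simp]: "fps_nonneg fps_X" by (auto simp: fps_nonneg_def fps_X_def)
lemma fps_nonneg_const [intro]: "c \<ge> 0 \<Longrightarrow> fps_nonneg (fps_const c)" by (auto simp: fps_nonneg_def)

lemma fps_nonneg_power [intro]: "fps_nonneg f \<Longrightarrow> fps_nonneg (f ^ k)"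
  by (induction k) auto

lemma fps_nonneg_sum [intro]: "(\<And>i. i \<in> A \<Longrightarrow> fps_nonneg (f i)) \<Longrightarrow> fps_nonneg (\<Sum>i\<in>A. f i)"
  by (induction A rule: infinite_finite_induct) auto

lemma fps_conv_add: "fps_conv f x \<Longrightarrow> fps_conv g x \<Longrightarrow> fps_conv (f + g) x"
  and eval_fps_conv_add: "fps_conv f x \<Longrightarrow> fps_conv g x \<Longrightarrow> eval_fps (f + g) x = eval_fps f x + eval_fps g x"
  by (auto simp: fps_conv_def eval_fps_def algebra_simps suminf_add summable_add)

lemma fps_conv_mult_aux:
  assumes "fps_nonneg f" "fps_nonneg g" "x \<ge> 0" "fps_conv f x" "fps_conv g x"
  shows "fps_conv (f * g) x \<and> eval_fps (f * g) x = eval_fps f x * eval_fps g x"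
proof -
  have *: "fps_nth (f * g) n * x ^ n = (\<Sum>i\<le>n. (fps_nth f i * x ^ i) * (fps_nth g (n - i) * x ^ (n - i)))" for n
    unfolding fps_mult_nth sum_distrib_right atLeast0AtMost
    by (intro sum.cong refl) (simp add: power_add[symmetric] mult_ac)
  have "summable (\<lambda>n. norm (fps_nth f n * x ^ n))" "summable (\<lambda>n. norm (fps_nth g n * x ^ n))"
    using assms by (auto simp: fps_conv_def fps_nonneg_def)
  from Cauchy_product_sums[OF this]
  show ?thesis unfolding fps_conv_def eval_fps_def * by (auto simp: sums_iff)
qed

lemmas fps_conv_mult = fps_conv_mult_aux[THEN conjunct1]
  and eval_fps_conv_mult = fps_conv_mult_aux[THEN conjunct2]

lemma fps_conv_finite: "(\<And>n. n > N \<Longrightarrow> fps_nth f n = 0) \<Longrightarrow> fps_conv f x"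
  unfolding fps_conv_def by (rule summable_finite[of "{..N}"]) auto

lemma fps_conv_const [simp, intro]: "fps_conv (fps_const c) x"
  by (rule fps_conv_finite[of 0]) auto

lemma fps_conv_0 [simp, intro]: "fps_conv 0 x"
  by (rule fps_conv_finite[of 0]) auto

lemma fps_conv_1 [simp, intro]: "fps_conv 1 x"
  by (rule fps_conv_finite[of 0]) auto

lemma fps_conv_X [simp, intro]: "fps_conv fps_X x"
  by (rule fps_conv_finite[of 1]) auto

lemma fps_conv_power_aux:
  assumes "fps_nonneg f" "x \<ge> 0" "fps_conv f x"
  shows "fps_conv (f ^ k) x \<and> eval_fps (f ^ k) x = eval_fps f x ^ k"
  by (induction k) (use assms in \<open>auto simp: fps_conv_mult eval_fps_conv_mult fps_nonneg_power\<close>)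

lemmas fps_conv_power = fps_conv_power_aux[THEN conjunct1]
  and eval_fps_conv_power = fps_conv_power_aux[THEN conjunct2]

lemma fps_conv_sum_aux:
  assumes "finite A" "\<And>i. i \<in> A \<Longrightarrow> fps_conv (f i) x"
  shows "fps_conv (\<Sum>i\<in>A. f i) x \<and> eval_fps (\<Sum>i\<in>A. f i) x = (\<Sum>i\<in>A. eval_fps (f i) x)"
  using assms by (induction A rule: finite_induct) (auto simp: fps_conv_add eval_fps_conv_add)

lemmas fps_conv_sum = fps_conv_sum_aux[THEN conjunct1]
  and eval_fps_conv_sum = fps_conv_sum_aux[THEN conjunct2]

lemma eval_fps_conv_nonneg: "fps_nonneg f \<Longrightarrow> x \<ge> 0 \<Longrightarrow> fps_conv f x \<Longrightarrow> eval_fps f x \<ge> 0"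
  unfolding eval_fps_def fps_conv_def fps_nonneg_def by (intro suminf_nonneg) auto

lemma fps_conv_mono:
  assumes "fps_nonneg f" "0 \<le> x" "x \<le> y" "fps_conv f y"
  shows "fps_conv f x" and "eval_fps f x \<le> eval_fps f y"
proof -
  have *: "fps_nth f n * x ^ n \<le> fps_nth f n * y ^ n" for n
    using assms by (auto simp: fps_nonneg_def intro!: mult_left_mono power_mono)
  show c: "fps_conv f x"
    unfolding fps_conv_def
    by (rule summable_comparison_test'[OF assms(4)[unfolded fps_conv_def], of 0])
       (use assms * in \<open>auto simp: fps_nonneg_def\<close>)
  show "eval_fps f x \<le> eval_fps f y"
    unfolding eval_fps_def using c assms(4) * by (intro suminf_le) (auto simp: fps_conv_def)
qed

lemma fps_conv_le:
  assumes "\<And>n. 0 \<le> fps_nth f n" "\<And>n. fps_nth f n \<le> fps_nth g n" "0 \<le> x" "fps_conv g x"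
  shows "fps_conv f x" and "eval_fps f x \<le> eval_fps g x"
proof -
  have *: "fps_nth f n * x ^ n \<le> fps_nth g n * x ^ n" for n
    using assms by (auto intro!: mult_right_mono)
  show c: "fps_conv f x"
    unfolding fps_conv_def
    by (rule summable_comparison_test'[OF assms(4)[unfolded fps_conv_def], of 0])
       (use assms * in \<open>auto simp: fps_nonneg_def\<close>)
  show "eval_fps f x \<le> eval_fps g x"
    unfolding eval_fps_def using c assms(4) * by (intro suminf_le) (auto simp: fps_conv_def)
qed

lemma fps_nonneg_compose [intro]:
  "fps_nonneg f \<Longrightarrow> fps_nonneg g \<Longrightarrow> fps_nonneg (f oo g)"
  using fps_nonneg_power[of g] by (auto simp: fps_nonneg_def fps_compose_nth intro!: sum_nonneg)

text \<open>Tonelli's theorem in the extended nonnegative reals. Convergence of \<open>f\<close> at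
  the value of \<open>g\<close> is not assumed, so the identity yields the value of the composition
  and also the criterion for its convergence.\<close>

lemma ennreal_eval_fps_compose:
  assumes f: "fps_nonneg f" and g: "fps_nonneg g" "fps_nth g 0 = 0" and x: "x \<ge> 0" "fps_conv g x"
  shows "(\<Sum>n. ennreal (fps_nth (f oo g) n * x ^ n)) = (\<Sum>k. ennreal (fps_nth f k * eval_fps g x ^ k))"
proof -
  have gk: "fps_nth (g ^ k) n \<ge> 0" for k n
    using g by (metis fps_nonneg_def fps_nonneg_power)
  have "ennreal (fps_nth (f oo g) n * x ^ n) = (\<Sum>k. ennreal (fps_nth f k * fps_nth (g ^ k) n * x ^ n))" for n
  proof -
    have "(\<Sum>k. ennreal (fps_nth f k * fps_nth (g ^ k) n * x ^ n))
        = (\<Sum>k\<le>n. ennreal (fps_nth f k * fps_nth (g ^ k) n * x ^ n))"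
      by (rule suminf_finite) (auto simp: startsby_zero_power_prefix[OF g(2)])
    also have "\<dots> = ennreal (\<Sum>k\<le>n. fps_nth f k * fps_nth (g ^ k) n * x ^ n)"
      using f gk x by (intro sum_ennreal) (auto simp: fps_nonneg_def)
    also have "(\<Sum>k\<le>n. fps_nth f k * fps_nth (g ^ k) n * x ^ n) = fps_nth (f oo g) n * x ^ n"
      by (simp add: fps_compose_nth sum_distrib_right atLeast0AtMost)
    finally show ?thesis ..
  qed
  then have "(\<Sum>n. ennreal (fps_nth (f oo g) n * x ^ n))
      = (\<Sum>n. \<Sum>k. ennreal (fps_nth f k * fps_nth (g ^ k) n * x ^ n))"
    by simp
  also have "\<dots> = (\<Sum>k. \<Sum>n. ennreal (fps_nth f k * fps_nth (g ^ k) n * x ^ n))"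
    by (rule nat_sum_swap_ennreal)
  finally have swap: "(\<Sum>n. ennreal (fps_nth (f oo g) n * x ^ n))
      = (\<Sum>k. \<Sum>n. ennreal (fps_nth f k * fps_nth (g ^ k) n * x ^ n))" .
  have "(\<Sum>n. ennreal (fps_nth f k * fps_nth (g ^ k) n * x ^ n)) = ennreal (fps_nth f k * eval_fps g x ^ k)" for k
  proof -
    have c: "fps_conv (g ^ k) x" using fps_conv_power g x by blast
    have "(\<lambda>n. fps_nth f k * (fps_nth (g ^ k) n * x ^ n)) sums (fps_nth f k * eval_fps (g ^ k) x)"
      unfolding eval_fps_def using c by (intro sums_mult summable_sums) (simp add: fps_conv_def)
    then have "(\<Sum>n. ennreal (fps_nth f k * (fps_nth (g ^ k) n * x ^ n))) = ennreal (fps_nth f k * eval_fps (g ^ k) x)"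
      using f gk x by (intro suminf_ennreal_eq) (auto simp: fps_nonneg_def)
    then show ?thesis using eval_fps_conv_power[of g x k] g x by (simp add: mult.assoc)
  qed
  with swap show ?thesis by simp
qed

lemma suminf_ennreal_eval_fps:
  assumes "fps_nonneg f" "x \<ge> 0" "fps_conv f x"
  shows "(\<Sum>n. ennreal (fps_nth f n * x ^ n)) = ennreal (eval_fps f x)"
  unfolding eval_fps_def
  by (rule suminf_ennreal2) (use assms in \<open>simp_all add: fps_nonneg_def fps_conv_def\<close>)

lemma fps_conv_iff_ennreal:
  assumes "fps_nonneg f" "x \<ge> 0"
  shows "fps_conv f x \<longleftrightarrow> (\<Sum>n. ennreal (fps_nth f n * x ^ n)) \<noteq> top"
proof
  show "fps_conv f x" if "(\<Sum>n. ennreal (fps_nth f n * x ^ n)) \<noteq> top"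
    unfolding fps_conv_def
    by (rule summable_suminf_not_top[OF _ that]) (use assms in \<open>simp add: fps_nonneg_def\<close>)
qed (simp add: suminf_ennreal_eval_fps assms)

lemma fps_conv_compose_iff:
  assumes f: "fps_nonneg f" and g: "fps_nonneg g" "fps_nth g 0 = 0" and x: "x \<ge> 0" "fps_conv g x"
  shows "fps_conv (f oo g) x \<longleftrightarrow> fps_conv f (eval_fps g x)"
proof -
  have n: "fps_nonneg (f oo g)" "eval_fps g x \<ge> 0" using assms eval_fps_conv_nonneg by blast+
  show ?thesis
    unfolding fps_conv_iff_ennreal[OF n(1) x(1)] fps_conv_iff_ennreal[OF f n(2)]
    by (simp add: ennreal_eval_fps_compose[OF assms])
qed

lemma eval_fps_conv_compose:
  assumes f: "fps_nonneg f" and g: "fps_nonneg g" "fps_nth g 0 = 0" and x: "x \<ge> 0" "fps_conv g x"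
    and c: "fps_conv f (eval_fps g x)"
  shows "eval_fps (f oo g) x = eval_fps f (eval_fps g x)"
proof -
  have n: "fps_nonneg (f oo g)" "eval_fps g x \<ge> 0" using assms eval_fps_conv_nonneg by blast+
  have c': "fps_conv (f oo g) x" using assms by (simp add: fps_conv_compose_iff)
  have "ennreal (eval_fps (f oo g) x) = ennreal (eval_fps f (eval_fps g x))"
    using ennreal_eval_fps_compose[OF f g x]
    by (simp only: suminf_ennreal_eval_fps[OF n(1) x(1) c'] suminf_ennreal_eval_fps[OF f n(2) c])
  then show ?thesis
    using eval_fps_conv_nonneg[OF n(1) x(1) c'] eval_fps_conv_nonneg[OF f n(2) c] by simp
qed

section \<open>Generating functions of the moments\<close>

definition gf :: "(plane_tree \<Rightarrow> real) \<Rightarrow> real fps" where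
  "gf g = Abs_fps (\<lambda>n. \<Sum>T\<in>trees_of_size n. g T)"

definition forests :: "nat \<Rightarrow> nat \<Rightarrow> plane_tree list set" where
  "forests k n = {ts. length ts = k \<and> (\<Sum>t\<leftarrow>ts. num_nodes t) = n}"

lemma trees_of_size_0: "trees_of_size 0 = {}"
  using num_nodes_pos by (auto simp: trees_of_size_def)

lemma gf_nth_0 [simp]: "fps_nth (gf g) 0 = 0"
  by (simp add: gf_def trees_of_size_0)

lemma finite_forests: "finite (forests k n)"
proof (rule finite_subset)
  show "forests k n \<subseteq> {ts. set ts \<subseteq> {T. num_nodes T \<le> n} \<and> length ts = k}"
    by (auto simp: forests_def intro: member_le_sum_list)
  show "finite {ts. set ts \<subseteq> {T. num_nodes T \<le> n} \<and> length ts = k}"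
    by (intro finite_lists_length_eq finite_trees_upto)
qed

lemma forests_0: "forests 0 n = (if n = 0 then {[]} else {})"
  by (auto simp: forests_def)

lemma sum_forests_Suc:
  "(\<Sum>ts\<in>forests (Suc k) n. f ts :: real) = (\<Sum>j\<le>n. \<Sum>t\<in>trees_of_size j. \<Sum>ts\<in>forests k (n - j). f (t # ts))"
proof -
  let ?X = "\<lambda>j. (\<lambda>(t, ts). t # ts) ` (trees_of_size j \<times> forests k (n - j))"
  have eq: "forests (Suc k) n = (\<Union>j\<le>n. ?X j)"
  proof (intro equalityI subsetI)
    fix ts assume "ts \<in> forests (Suc k) n"
    then obtain t us where "ts = t # us" "length us = k" "num_nodes t + (\<Sum>t\<leftarrow>us. num_nodes t) = n"
      by (cases ts) (auto simp: forests_def)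
    then have "ts \<in> ?X (num_nodes t)" "num_nodes t \<le> n"
      by (auto simp: forests_def trees_of_size_def image_iff)
    then show "ts \<in> (\<Union>j\<le>n. ?X j)" by blast
  qed (auto simp: forests_def trees_of_size_def)
  have "(\<Sum>ts\<in>forests (Suc k) n. f ts) = (\<Sum>j\<le>n. \<Sum>ts\<in>?X j. f ts)"
    unfolding eq by (rule sum.UNION_disjoint)
      (simp, simp add: finite_forests finite_trees_of_size, auto simp: trees_of_size_def)
  also have "\<dots> = (\<Sum>j\<le>n. \<Sum>t\<in>trees_of_size j. \<Sum>ts\<in>forests k (n - j). f (t # ts))"
  proof (intro sum.cong refl)
    fix j
    have "inj_on (\<lambda>(t, ts). t # ts) (trees_of_size j \<times> forests k (n - j))"
      by (auto intro!: inj_onI)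
    then show "(\<Sum>ts\<in>?X j. f ts) = (\<Sum>t\<in>trees_of_size j. \<Sum>ts\<in>forests k (n - j). f (t # ts))"
      by (simp add: sum.reindex sum.cartesian_product case_prod_unfold)
  qed
  finally show ?thesis .
qed

lemma sum_trees_of_size_Suc:
  "(\<Sum>T\<in>trees_of_size (Suc n). f T :: real) = (\<Sum>k\<le>n. \<Sum>ts\<in>forests k n. f (Node ts))"
proof -
  have len: "length ts \<le> (\<Sum>t\<leftarrow>ts. num_nodes t)" for ts
  proof (induction ts)
    case (Cons t ts)
    then show ?case using num_nodes_pos[of t] by simp
  qed simp
  have eq: "trees_of_size (Suc n) = (\<Union>k\<le>n. Node ` forests k n)"
  proof (intro equalityI subsetI)
    fix T assume "T \<in> trees_of_size (Suc n)"
    moreover obtain ts where "T = Node ts" by (cases T)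
    ultimately have "T = Node ts" "ts \<in> forests (length ts) n" "length ts \<le> n"
      using len[of ts] by (auto simp: trees_of_size_def num_nodes_Node_list forests_def)
    then show "T \<in> (\<Union>k\<le>n. Node ` forests k n)" by blast
  qed (auto simp: trees_of_size_def num_nodes_Node_list forests_def)
  show ?thesis
    unfolding eq
    by (subst sum.UNION_disjoint) (auto simp: finite_forests sum.reindex inj_on_def, auto simp: forests_def)
qed

text \<open>Formally the sum of \<open>g(t) exp(u S(t)) z^|t|\<close> over all trees, as a series in
  \<open>u\<close> over series in \<open>z\<close>. The exponential turns the additive parameter
  \<open>S\<close> of a forest into a product.\<close>

definition tree_egf :: "(plane_tree \<Rightarrow> real) \<Rightarrow> (plane_tree \<Rightarrow> real) \<Rightarrow> real fps fps" where
  "tree_egf g S = Abs_fps (\<lambda>b. fps_const (1 / fact b) * gf (\<lambda>t. g t * S t ^ b))"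

text \<open>Adding one more tree is a convolution in both variables; the factorials turn the one in
  \<open>u\<close> into the binomial theorem for a power of the sum of \<open>S\<close>.\<close>

lemma tree_egf_power:
  "fact i * fps_nth (fps_nth (tree_egf g S ^ k) i) n
     = (\<Sum>ts\<in>forests k n. (\<Prod>t\<leftarrow>ts. g t) * (\<Sum>t\<leftarrow>ts. S t) ^ i)"
proof (induction k arbitrary: i n)
  case 0
  then show ?case by (simp add: forests_0 fps_one_nth)
next
  case (Suc k)
  let ?P = "tree_egf g S"
  have "fact i * fps_nth (fps_nth (?P ^ Suc k) i) n
      = (\<Sum>b\<le>i. \<Sum>j\<le>n. fact i * (fps_nth (fps_nth ?P b) j * fps_nth (fps_nth (?P ^ k) (i - b)) (n - j)))"
    by (simp add: fps_mult_nth fps_sum_nth sum_distrib_left atLeast0AtMost)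
  also have "\<dots> = (\<Sum>b\<le>i. \<Sum>j\<le>n. \<Sum>t\<in>trees_of_size j. \<Sum>ts\<in>forests k (n - j).
      real (i choose b) * S t ^ b * (\<Sum>t\<leftarrow>ts. S t) ^ (i - b) * (g t * (\<Prod>t\<leftarrow>ts. g t)))"
  proof (intro sum.cong refl)
    fix b j assume "b \<in> {..i}"
    then have b: "b \<le> i" by simp
    have "fact i * (fps_nth (fps_nth ?P b) j * fps_nth (fps_nth (?P ^ k) (i - b)) (n - j))
        = (fact i / (fact b * fact (i - b))) * (fps_nth (gf (\<lambda>t. g t * S t ^ b)) j) *
          (fact (i - b) * fps_nth (fps_nth (?P ^ k) (i - b)) (n - j))"
      by (simp add: tree_egf_def)
    also have "fact i / (fact b * fact (i - b)) = real (i choose b)"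
      using b by (simp add: binomial_fact)
    finally show "fact i * (fps_nth (fps_nth ?P b) j * fps_nth (fps_nth (?P ^ k) (i - b)) (n - j))
        = (\<Sum>t\<in>trees_of_size j. \<Sum>ts\<in>forests k (n - j).
      real (i choose b) * S t ^ b * (\<Sum>t\<leftarrow>ts. S t) ^ (i - b) * (g t * (\<Prod>t\<leftarrow>ts. g t)))"
      unfolding Suc.IH gf_def fps_nth_Abs_fps sum_distrib_left[of "real (i choose b)"] sum_product
      by (simp add: mult_ac)
  qed
  also have "\<dots> = (\<Sum>j\<le>n. \<Sum>b\<le>i. \<Sum>t\<in>trees_of_size j. \<Sum>ts\<in>forests k (n - j).
      real (i choose b) * S t ^ b * (\<Sum>t\<leftarrow>ts. S t) ^ (i - b) * (g t * (\<Prod>t\<leftarrow>ts. g t)))"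
    by (rule sum.swap)
  also have "\<dots> = (\<Sum>j\<le>n. \<Sum>t\<in>trees_of_size j. \<Sum>ts\<in>forests k (n - j). \<Sum>b\<le>i.
      real (i choose b) * S t ^ b * (\<Sum>t\<leftarrow>ts. S t) ^ (i - b) * (g t * (\<Prod>t\<leftarrow>ts. g t)))"
    by (intro sum.cong refl, subst sum.swap, intro sum.cong refl, rule sum.swap)
  also have "\<dots> = (\<Sum>j\<le>n. \<Sum>t\<in>trees_of_size j. \<Sum>ts\<in>forests k (n - j).
      (\<Prod>t\<leftarrow>t # ts. g t) * (\<Sum>t\<leftarrow>t # ts. S t) ^ i)"
    by (intro sum.cong refl) (simp add: binomial_ring sum_distrib_left sum_distrib_right mult_ac)
  also have "\<dots> = (\<Sum>ts\<in>forests (Suc k) n. (\<Prod>t\<leftarrow>ts. g t) * (\<Sum>t\<leftarrow>ts. S t) ^ i)"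
    by (simp only: sum_forests_Suc)
  finally show ?case .
qed

text \<open>The coefficient of \<open>u\<^sup>i\<close> in \<open>\<Sum>\<^sub>k \<phi>\<^sub>k P(u)\<^sup>k\<close>; the inner series have no constant
  term, so only \<open>k \<le> n\<close> contribute to the \<open>n\<close>-th coefficient.\<close>

definition compose_coeff :: "(nat \<Rightarrow> real) \<Rightarrow> real fps fps \<Rightarrow> nat \<Rightarrow> real fps" where
  "compose_coeff \<phi> P i = Abs_fps (\<lambda>n. \<Sum>k\<le>n. \<phi> k * fps_nth (fps_nth (P ^ k) i) n)"

lemma fps_fps_power_nth_eq_0:
  fixes P :: "real fps fps"
  assumes "\<And>b. fps_nth (fps_nth P b) 0 = 0" "n < k"
  shows "fps_nth (fps_nth (P ^ k) i) n = 0"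
  using assms(2)
proof (induction k arbitrary: i n)
  case (Suc k)
  have "fps_nth (fps_nth P b) j * fps_nth (fps_nth (P ^ k) c) (n - j) = 0" if "j \<le> n" for b c j
    using Suc that assms(1)[of b] by (cases "j = 0") auto
  then show ?case
    unfolding power_Suc fps_mult_nth fps_sum_nth by (intro sum.neutral ballI) simp
qed simp

lemma compose_coeff_nth:
  assumes "\<And>b. fps_nth (fps_nth P b) 0 = 0" "n \<le> N"
  shows "fps_nth (compose_coeff \<phi> P i) n = (\<Sum>k\<le>N. \<phi> k * fps_nth (fps_nth (P ^ k) i) n)"
  unfolding compose_coeff_def fps_nth_Abs_fps
  by (rule sum.mono_neutral_left) (use assms fps_fps_power_nth_eq_0[OF assms(1)] in auto)

lemma compose_coeff_0: "compose_coeff \<phi> P 0 = Abs_fps \<phi> oo fps_nth P 0"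
proof -
  have "fps_nth (P ^ k) 0 = fps_nth P 0 ^ k" for k
    by (induction k) auto
  then show ?thesis by (simp add: compose_coeff_def fps_eq_iff fps_compose_nth atLeast0AtMost)
qed

text \<open>The chain rule for \<open>\<phi>(P(u))\<close> in the auxiliary variable. The top
  coefficient of \<open>P\<close> occurs only in the term \<open>b = i\<close>, multiplied by
  \<open>\<phi>'\<close> composed with the constant coefficient; the equation for the mixed moments
  is linear because of this.\<close>

lemma compose_coeff_Suc:
  assumes P: "\<And>b. fps_nth (fps_nth P b) 0 = 0"
  shows "fps_const (real (Suc i)) * compose_coeff \<phi> P (Suc i) =
    (\<Sum>b\<le>i. fps_const (real (Suc b)) * fps_nth P (Suc b) * compose_coeff (\<lambda>k. real (Suc k) * \<phi> (Suc k)) P (i - b))"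
proof (rule fps_ext)
  fix n
  let ?\<phi>' = "\<lambda>k. real (Suc k) * \<phi> (Suc k)"
  define A where "A = (\<lambda>b. fps_const (real (Suc b)) * fps_nth P (Suc b))"
  have deriv: "fps_const (real (Suc i)) * fps_nth (P ^ Suc k) (Suc i)
      = fps_const (real (Suc k)) * (\<Sum>b\<le>i. A b * fps_nth (P ^ k) (i - b))" for k
  proof -
    have "of_nat (Suc i) * fps_nth (P ^ Suc k) (Suc i) = fps_nth (fps_deriv (P ^ Suc k)) i"
      by (simp del: power_Suc of_nat_Suc)
    also have "\<dots> = fps_nth (of_nat (Suc k) * (fps_deriv P * P ^ k)) i"
      by (subst fps_deriv_power') (simp add: mult.assoc del: of_nat_Suc)
    also have "\<dots> = of_nat (Suc k) * fps_nth (fps_deriv P * P ^ k) i"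
      unfolding fps_of_nat[symmetric] by (rule fps_mult_left_const_nth)
    also have "fps_nth (fps_deriv P * P ^ k) i = (\<Sum>b\<le>i. A b * fps_nth (P ^ k) (i - b))"
      by (simp add: fps_mult_nth atLeast0AtMost A_def fps_of_nat del: of_nat_Suc)
    finally show ?thesis by (simp only: fps_of_nat)
  qed
  have "fps_nth (fps_const (real (Suc i)) * compose_coeff \<phi> P (Suc i)) n
      = (\<Sum>k\<le>Suc n. \<phi> k * fps_nth (fps_const (real (Suc i)) * fps_nth (P ^ k) (Suc i)) n)"
    by (simp only: fps_mult_left_const_nth compose_coeff_nth[OF P, of n "Suc n"] sum_distrib_left)
       (simp add: mult_ac)
  \<comment> \<open>Summation up to \<open>Suc n\<close> was chosen so that the shifted sum ends at
    \<open>n\<close>; the term \<open>k = 0\<close> vanishes because \<open>P ^ 0 = 1\<close> has no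
    coefficient at \<open>u^(i+1)\<close>.\<close>
  also have "\<dots> = (\<Sum>k\<le>n. \<phi> (Suc k) * fps_nth (fps_const (real (Suc i)) * fps_nth (P ^ Suc k) (Suc i)) n)"
    by (subst sum.atMost_Suc_shift) simp
  also have "\<dots> = (\<Sum>k\<le>n. \<Sum>b\<le>i. ?\<phi>' k * fps_nth (A b * fps_nth (P ^ k) (i - b)) n)"
    by (simp only: deriv fps_mult_left_const_nth fps_sum_nth sum_distrib_left) (simp add: mult_ac)
  also have "\<dots> = (\<Sum>b\<le>i. \<Sum>k\<le>n. ?\<phi>' k * fps_nth (A b * fps_nth (P ^ k) (i - b)) n)"
    by (rule sum.swap)
  also have "\<dots> = (\<Sum>b\<le>i. fps_nth (A b * compose_coeff ?\<phi>' P (i - b)) n)"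
  proof (intro sum.cong refl)
    fix b
    have "fps_nth (A b * compose_coeff ?\<phi>' P (i - b)) n
        = (\<Sum>j\<le>n. fps_nth (A b) j * (\<Sum>k\<le>n. ?\<phi>' k * fps_nth (fps_nth (P ^ k) (i - b)) (n - j)))"
      by (simp only: fps_mult_nth atLeast0AtMost compose_coeff_nth[OF P, of "n - _" n] diff_le_self)
    also have "\<dots> = (\<Sum>j\<le>n. \<Sum>k\<le>n. ?\<phi>' k * (fps_nth (A b) j * fps_nth (fps_nth (P ^ k) (i - b)) (n - j)))"
      by (simp add: sum_distrib_left mult_ac)
    also have "\<dots> = (\<Sum>k\<le>n. ?\<phi>' k * fps_nth (A b * fps_nth (P ^ k) (i - b)) n)"
      by (subst sum.swap) (simp add: fps_mult_nth atLeast0AtMost sum_distrib_left)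
    finally show "(\<Sum>k\<le>n. ?\<phi>' k * fps_nth (A b * fps_nth (P ^ k) (i - b)) n)
        = fps_nth (A b * compose_coeff ?\<phi>' P (i - b)) n" ..
  qed
  finally show "fps_nth (fps_const (real (Suc i)) * compose_coeff \<phi> P (Suc i)) n =
      fps_nth (\<Sum>b\<le>i. fps_const (real (Suc b)) * fps_nth P (Suc b) * compose_coeff ?\<phi>' P (i - b)) n"
    by (simp add: fps_sum_nth A_def)
qed

section \<open>Recursion for the joint moments of \<open>R\<close> and \<open>S\<close>\<close>

definition moment_gf :: "(nat \<Rightarrow> real) \<Rightarrow> nat \<Rightarrow> nat \<Rightarrow> real fps" where
  "moment_gf w l m = gf (\<lambda>T. tree_weight w T * real (num_root_subtrees T) ^ l * real (num_subtrees T) ^ m)"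

text \<open>The series of \<open>(1 + R)^a S^b\<close>, expanded binomially. The base
  \<open>1 + R\<close> arises because \<open>R^a\<close> of a tree is the product of
  \<open>(1 + R)^a\<close> over its branches.\<close>

definition moment_gf1 :: "(nat \<Rightarrow> real) \<Rightarrow> nat \<Rightarrow> nat \<Rightarrow> real fps" where
  "moment_gf1 w a b = (\<Sum>j\<le>a. fps_const (real (a choose j)) * moment_gf w j b)"

definition moment_egf :: "(nat \<Rightarrow> real) \<Rightarrow> nat \<Rightarrow> real fps fps" where
  "moment_egf w a = Abs_fps (\<lambda>b. fps_const (1 / fact b) * moment_gf1 w a b)"

lemma moment_gf1_altdef:
  "moment_gf1 w a b = gf (\<lambda>T. (tree_weight w T * (1 + real (num_root_subtrees T)) ^ a) * real (num_subtrees T) ^ b)"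
proof (rule fps_ext)
  fix n
  have *: "(1 + real (num_root_subtrees T)) ^ a = (\<Sum>j\<le>a. real (a choose j) * real (num_root_subtrees T) ^ j)" for T
    using binomial_ring[of "real (num_root_subtrees T)" 1 a] by (simp add: add.commute)
  have "fps_nth (moment_gf1 w a b) n = (\<Sum>j\<le>a. \<Sum>T\<in>trees_of_size n. real (a choose j) *
      (tree_weight w T * real (num_root_subtrees T) ^ j * real (num_subtrees T) ^ b))"
    by (simp add: moment_gf1_def moment_gf_def gf_def fps_sum_nth sum_distrib_left)
  also have "\<dots> = (\<Sum>T\<in>trees_of_size n. \<Sum>j\<le>a. real (a choose j) *
      (tree_weight w T * real (num_root_subtrees T) ^ j * real (num_subtrees T) ^ b))"
    by (rule sum.swap)
  finally show "fps_nth (moment_gf1 w a b) n = fps_nth (gf (\<lambda>T. (tree_weight w T *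
      (1 + real (num_root_subtrees T)) ^ a) * real (num_subtrees T) ^ b)) n"
    by (simp add: gf_def * sum_distrib_left sum_distrib_right mult_ac)
qed

lemma moment_egf_altdef: "moment_egf w a =
    tree_egf (\<lambda>T. tree_weight w T * (1 + real (num_root_subtrees T)) ^ a) (\<lambda>T. real (num_subtrees T))"
  by (simp add: moment_egf_def tree_egf_def moment_gf1_altdef)

lemma prod_list_mult: "(\<Prod>t\<leftarrow>ts. f t * g t :: real) = (\<Prod>t\<leftarrow>ts. f t) * (\<Prod>t\<leftarrow>ts. g t)"
  by (induction ts) auto

lemma prod_list_power_map: "(\<Prod>t\<leftarrow>ts. f t ^ a :: real) = (\<Prod>t\<leftarrow>ts. f t) ^ a"
  by (induction ts) (auto simp: power_mult_distrib)

lemma real_num_root_subtrees_Node: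
  "real (num_root_subtrees (Node ts)) = (\<Prod>t\<leftarrow>ts. 1 + real (num_root_subtrees t))"
  unfolding num_root_subtrees_Node by (induction ts) (auto simp: algebra_simps)

lemma real_num_subtrees_Node:
  "real (num_subtrees (Node ts)) = (\<Sum>t\<leftarrow>ts. real (num_subtrees t)) + real (num_root_subtrees (Node ts))"
proof -
  have "real (\<Sum>t\<leftarrow>ts. num_subtrees t) = (\<Sum>t\<leftarrow>ts. real (num_subtrees t))" by (induction ts) auto
  then show ?thesis unfolding num_subtrees_Node by simp
qed

text \<open>Binomial expansion of \<open>S^m\<close>, where \<open>S\<close> is \<open>R\<close>
  plus the sum of \<open>S\<close> over the branches. The term with the \<open>i\<close>-th power of
  that sum carries \<open>R^(l+m-i)\<close>, a product of \<open>(1 + R)^(l+m-i)\<close> over the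
  branches. The total exponent \<open>l + m\<close> is thus preserved, and the auxiliary variable
  extracts the power of the sum.\<close>

lemma moment_gf_rec:
  "moment_gf w l m = (\<Sum>i\<le>m. fps_const (real (m choose i) * fact i) *
     (fps_X * compose_coeff w (moment_egf w (l + m - i)) i))"
proof (rule fps_ext)
  fix n
  show "fps_nth (moment_gf w l m) n = fps_nth (\<Sum>i\<le>m. fps_const (real (m choose i) * fact i) *
     (fps_X * compose_coeff w (moment_egf w (l + m - i)) i)) n"
  proof (cases n)
    case 0
    then show ?thesis by (simp add: moment_gf_def fps_sum_nth)
  next
    case (Suc n')
    let ?R = "\<lambda>T. real (num_root_subtrees T)" and ?S = "\<lambda>T. real (num_subtrees T)"
    let ?f = "\<lambda>i ts. w (length ts) * (real (m choose i) * ((\<Prod>t\<leftarrow>ts. tree_weight w t * (1 + ?R t) ^ (l + m - i))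
              * (\<Sum>t\<leftarrow>ts. ?S t) ^ i))"
    have node: "tree_weight w (Node ts) * ?R (Node ts) ^ l * ?S (Node ts) ^ m = (\<Sum>i\<le>m. ?f i ts)" for ts
    proof -
      have *: "(\<Prod>t\<leftarrow>ts. tree_weight w t * (1 + ?R t) ^ (l + m - i))
          = (\<Prod>t\<leftarrow>ts. tree_weight w t) * ?R (Node ts) ^ l * ?R (Node ts) ^ (m - i)" if "i \<le> m" for i
        using that unfolding prod_list_mult prod_list_power_map real_num_root_subtrees_Node
        by (simp add: power_add[symmetric] mult.assoc)
      show ?thesis
        unfolding real_num_subtrees_Node tree_weight_Node
          binomial_ring[of "\<Sum>t\<leftarrow>ts. ?S t" "?R (Node ts)" m] sum_distrib_left
        by (intro sum.cong refl) (simp add: * mult_ac)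
    qed
    have "fps_nth (moment_gf w l m) n = (\<Sum>k\<le>n'. \<Sum>ts\<in>forests k n'. \<Sum>i\<le>m. ?f i ts)"
      by (simp add: Suc moment_gf_def gf_def sum_trees_of_size_Suc node)
    also have "\<dots> = (\<Sum>i\<le>m. \<Sum>k\<le>n'. \<Sum>ts\<in>forests k n'. ?f i ts)"
      by (subst sum.swap, intro sum.cong refl, subst sum.swap) simp
    also have "\<dots> = (\<Sum>i\<le>m. real (m choose i) * fact i *
        fps_nth (compose_coeff w (moment_egf w (l + m - i)) i) n')"
    proof (intro sum.cong refl)
      fix i
      have "(\<Sum>ts\<in>forests k n'. ?f i ts) = real (m choose i) * (w k * (fact i *
          fps_nth (fps_nth (moment_egf w (l + m - i) ^ k) i) n'))" for k
        unfolding moment_egf_altdef tree_egf_power sum_distrib_left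
        by (intro sum.cong refl) (simp add: forests_def mult_ac)
      then show "(\<Sum>k\<le>n'. \<Sum>ts\<in>forests k n'. ?f i ts) = real (m choose i) * fact i *
        fps_nth (compose_coeff w (moment_egf w (l + m - i)) i) n'"
        by (simp add: compose_coeff_def sum_distrib_left mult_ac)
    qed
    finally show ?thesis by (simp add: Suc fps_sum_nth)
  qed
qed

section \<open>The characteristic system\<close>

text \<open>Weierstrass M-test on the closed ball; the boundary circle has to be included because
  the dominant singularities lie on it.\<close>

lemma continuous_on_powser_cball:
  fixes a :: "nat \<Rightarrow> 'a :: {real_normed_field, banach}"
  assumes "summable (\<lambda>n. norm (a n) * r ^ n)"
  shows "continuous_on (cball 0 r) (\<lambda>z. \<Sum>n. a n * z ^ n)"
proof -
  have "uniform_limit (cball 0 r) (\<lambda>N z. \<Sum>n<N. a n * z ^ n) (\<lambda>z. \<Sum>n. a n * z ^ n) sequentially"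
    by (rule Weierstrass_m_test[OF _ assms])
      (auto simp: norm_mult norm_power intro!: mult_left_mono power_mono)
  then show ?thesis
    by (rule uniform_limit_theorem[rotated]) (auto intro!: always_eventually continuous_intros)
qed

lemma continuous_on_eval_fps_conv:
  assumes "fps_nonneg f" "fps_conv f r"
  shows "continuous_on {0..r} (eval_fps f)"
proof -
  have "continuous_on (cball 0 r) (eval_fps f)"
    unfolding eval_fps_def
    by (rule continuous_on_powser_cball) (use assms in \<open>auto simp: fps_nonneg_def fps_conv_def\<close>)
  then show ?thesis by (rule continuous_on_subset) auto
qed

lemma fps_power_nth_cong:
  fixes f g :: "'a :: comm_ring_1 fps"
  assumes "\<And>j. j \<le> n \<Longrightarrow> fps_nth f j = fps_nth g j"
  shows "fps_nth (f ^ k) n = fps_nth (g ^ k) n"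
  using assms
proof (induction k arbitrary: n)
  case (Suc k)
  then show ?case by (auto simp: fps_mult_nth intro!: sum.cong)
qed simp

lemma fps_conv_radiusI: "x \<ge> 0 \<Longrightarrow> ereal x < fps_conv_radius f \<Longrightarrow> fps_conv f x"
  by (auto simp: fps_conv_def intro!: summable_fps)

text \<open>Tangent inequality for the convex function \<open>t^k\<close>. The induction multiplies
  by \<open>y\<close> and leaves the surplus \<open>k x^(k-1) (y - x)^2\<close>, which makes the
  inequality strict for \<open>x > 0\<close>.\<close>

lemma power_ge_tangent:
  fixes x y :: real
  assumes "x \<ge> 0" "y \<ge> 0"
  shows "x ^ k + real k * x ^ (k - 1) * (y - x) \<le> y ^ k"
    and "k \<ge> 2 \<Longrightarrow> x \<noteq> y \<Longrightarrow> x ^ k + real k * x ^ (k - 1) * (y - x) < y ^ k"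
proof -
  have le: "x ^ k + real k * x ^ (k - 1) * (y - x) \<le> y ^ k" for k
  proof (induction k)
    case (Suc k)
    have "x ^ Suc k + real (Suc k) * x ^ (Suc k - 1) * (y - x) + real k * x ^ (k - 1) * (y - x)\<^sup>2
       = (x ^ k + real k * x ^ (k - 1) * (y - x)) * y"
      by (cases k) (auto simp: algebra_simps power2_eq_square)
    also have "\<dots> \<le> y ^ k * y" by (intro mult_right_mono Suc assms)
    also have "y ^ k * y = y ^ Suc k" by simp
    finally have "x ^ Suc k + real (Suc k) * x ^ (Suc k - 1) * (y - x) + real k * x ^ (k - 1) * (y - x)\<^sup>2 \<le> y ^ Suc k"
      by simp
    moreover have "real k * x ^ (k - 1) * (y - x)\<^sup>2 \<ge> 0" using assms by simp
    ultimately show ?case by linarith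
  qed simp
  show "x ^ k + real k * x ^ (k - 1) * (y - x) \<le> y ^ k" by (rule le)
  assume k: "k \<ge> 2" and "x \<noteq> y"
  then obtain k' where k': "k = Suc k'" "k' \<ge> 1" by (cases k) auto
  show "x ^ k + real k * x ^ (k - 1) * (y - x) < y ^ k"
  proof (cases "x = 0")
    case True
    then show ?thesis using k \<open>x \<noteq> y\<close> assms by (auto simp: zero_power)
  next
    case False
    have "x ^ Suc k' + real (Suc k') * x ^ (Suc k' - 1) * (y - x) + real k' * x ^ (k' - 1) * (y - x)\<^sup>2
       = (x ^ k' + real k' * x ^ (k' - 1) * (y - x)) * y"
      by (cases k') (auto simp: algebra_simps power2_eq_square)
    also have "\<dots> \<le> y ^ k' * y" by (intro mult_right_mono le assms)
    also have "y ^ k' * y = y ^ Suc k'" by simp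
    finally have "x ^ Suc k' + real (Suc k') * x ^ (Suc k' - 1) * (y - x) + real k' * x ^ (k' - 1) * (y - x)\<^sup>2 \<le> y ^ Suc k'"
      by simp
    moreover have "real k' * x ^ (k' - 1) * (y - x)\<^sup>2 > 0"
      using assms False \<open>x \<noteq> y\<close> k' by (intro mult_pos_pos) auto
    ultimately show ?thesis unfolding k' by linarith
  qed
qed

text \<open>The two limits of the admissibility condition, in a form that mentions only values of
  power series inside the disc: \<open>q < 1\<close> encodes that the possibly infinite limit of
  \<open>z \<Phi>'/\<Phi>\<close> exceeds 1, and \<open>unbounded\<close> replaces the divergence of
  \<open>\<Phi>'\<close>.\<close>

locale gen_weights =
  fixes w :: "nat \<Rightarrow> real"
  assumes w_nonneg: "\<And>i. w i \<ge> 0" and w_0: "w 0 > 0"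
    and ratio: "\<exists>y0 q. 0 < y0 \<and> ereal y0 < conv_radius w \<and> q < 1 \<and>
       (\<forall>y\<ge>y0. ereal y < conv_radius w \<longrightarrow>
          eval_fps (Abs_fps w) y \<le> q * (y * eval_fps (fps_deriv (Abs_fps w)) y))"
    and unbounded: "\<And>K. \<exists>y>0. ereal y < conv_radius w \<and> eval_fps (fps_deriv (Abs_fps w)) y > K"
begin

abbreviation phi :: "real fps" where "phi \<equiv> Abs_fps w"
abbreviation \<Phi> :: "real \<Rightarrow> real" where "\<Phi> \<equiv> eval_fps phi"
abbreviation \<Phi>' :: "real \<Rightarrow> real" where "\<Phi>' \<equiv> eval_fps (fps_deriv phi)"
abbreviation in_disc :: "real \<Rightarrow> bool" where "in_disc y \<equiv> 0 \<le> y \<and> ereal y < conv_radius w"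

lemma radius_phi: "fps_conv_radius phi = conv_radius w"
  by (simp add: fps_conv_radius_def)

lemma nonneg_phi [simp, intro]: "fps_nonneg phi"
  and nonneg_phi' [simp, intro]: "fps_nonneg (fps_deriv phi)"
  using w_nonneg by (auto simp: fps_nonneg_def)

lemma conv_phi: "in_disc y \<Longrightarrow> fps_conv phi y"
  and conv_phi': "in_disc y \<Longrightarrow> fps_conv (fps_deriv phi) y"
  using fps_conv_radius_deriv[of phi] by (auto intro!: fps_conv_radiusI simp: radius_phi)

lemma in_disc_mono: "in_disc y \<Longrightarrow> 0 \<le> x \<Longrightarrow> x \<le> y \<Longrightarrow> in_disc x"
  by (meson ereal_less_eq(3) le_less_trans)

lemma phi_mono: "0 \<le> x \<Longrightarrow> x \<le> y \<Longrightarrow> in_disc y \<Longrightarrow> \<Phi> x \<le> \<Phi> y"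
  and phi'_mono: "0 \<le> x \<Longrightarrow> x \<le> y \<Longrightarrow> in_disc y \<Longrightarrow> \<Phi>' x \<le> \<Phi>' y"
  by (rule fps_conv_mono; use conv_phi conv_phi' in auto)+

lemma phi_pos: "fps_conv phi y \<Longrightarrow> y \<ge> 0 \<Longrightarrow> \<Phi> y > 0"
  unfolding eval_fps_def using w_nonneg w_0
  by (intro suminf_pos2[of _ 0]) (auto simp: fps_conv_def)

text \<open>An affine \<open>\<Phi>\<close> satisfies \<open>y \<Phi>'(y) < \<Phi>(y)\<close>
  because \<open>w 0 > 0\<close>, against the ratio condition. The weight found here is the source
  of strict convexity.\<close>

lemma ex_weight_ge_2: obtains k where "k \<ge> 2" "w k > 0"
proof -
  have "\<exists>k\<ge>2. w k > 0"
  proof (rule ccontr)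
    assume "\<not> (\<exists>k\<ge>2. w k > 0)"
    then have z: "w k = 0" if "k \<ge> 2" for k using w_nonneg[of k] that by (auto simp: not_less intro: antisym)
    have phi: "\<Phi> y = w 0 + w 1 * y" for y
    proof -
      have "\<Phi> y = (\<Sum>n\<in>{0,1}. w n * y ^ n)"
        unfolding eval_fps_def by (subst suminf_finite[of "{0,1}"]) (auto intro!: z)
      then show ?thesis by simp
    qed
    have phi': "\<Phi>' y = w 1" for y
    proof -
      have "\<Phi>' y = (\<Sum>n\<in>{0}. real (Suc n) * w (Suc n) * y ^ n)"
        unfolding eval_fps_def by (subst suminf_finite[of "{0}"]) (auto intro!: z)
      then show ?thesis by simp
    qed
    obtain y0 q where *: "0 < y0" "ereal y0 < conv_radius w" "q < 1" "\<Phi> y0 \<le> q * (y0 * \<Phi>' y0)"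
      using ratio by blast
    have "q * (y0 * w 1) \<le> 1 * (y0 * w 1)" using * w_nonneg[of 1] by (intro mult_right_mono) auto
    moreover have "w 0 + y0 * w 1 \<le> q * (y0 * w 1)"
      using *(4) unfolding phi phi' by (simp only: mult.commute[of y0])
    ultimately show False using w_0 by linarith
  qed
  then show ?thesis using that by blast
qed

lemma phi'_pos: "y > 0 \<Longrightarrow> in_disc y \<Longrightarrow> \<Phi>' y > 0"
proof -
  assume y: "y > 0" "in_disc y"
  obtain k where k: "k \<ge> 2" "w k > 0" by (rule ex_weight_ge_2)
  show ?thesis
    unfolding eval_fps_def
    by (rule suminf_pos2[of _ "k - 1"])
       (use y k w_nonneg conv_phi' in \<open>auto simp: fps_conv_def\<close>)
qed

text \<open>Termwise convexity; strictness comes from a single weight of index at least 2. Only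
  convergence is asked at \<open>y\<close>, which may lie on the boundary of the disc: it will be a
  value of \<open>Y\<close> whose position is not known beforehand.\<close>

lemma phi_tangent:
  assumes "in_disc x" "y \<ge> 0" "fps_conv phi y"
  shows "\<Phi> x + \<Phi>' x * (y - x) \<le> \<Phi> y" and "x \<noteq> y \<Longrightarrow> \<Phi> x + \<Phi>' x * (y - x) < \<Phi> y"
proof -
  let ?d = "\<lambda>k. w k * (y ^ k - (x ^ k + real k * x ^ (k - 1) * (y - x)))"
  have "(\<lambda>k. real (Suc k) * w (Suc k) * x ^ k) sums \<Phi>' x"
    using conv_phi'[OF assms(1)] by (simp add: fps_conv_def eval_fps_def summable_sums)
  then have "(\<lambda>k. real (Suc k) * w (Suc k) * x ^ (Suc k - 1)) sums \<Phi>' x" by simp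
  then have "(\<lambda>k. real k * w k * x ^ (k - 1)) sums \<Phi>' x" by (subst (asm) sums_Suc_iff) simp
  moreover have "(\<lambda>k. w k * x ^ k) sums \<Phi> x" "(\<lambda>k. w k * y ^ k) sums \<Phi> y"
    using conv_phi[OF assms(1)] assms(3) by (auto simp: fps_conv_def eval_fps_def summable_sums)
  ultimately have "(\<lambda>k. w k * y ^ k - (w k * x ^ k + real k * w k * x ^ (k - 1) * (y - x)))
      sums (\<Phi> y - (\<Phi> x + \<Phi>' x * (y - x)))"
    by (intro sums_diff sums_add sums_mult2)
  then have sums: "?d sums (\<Phi> y - (\<Phi> x + \<Phi>' x * (y - x)))"
    by (rule back_subst[of "\<lambda>f. f sums _"]) (auto simp: algebra_simps)
  have nn: "?d k \<ge> 0" for k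
    using power_ge_tangent(1)[of x y k] assms w_nonneg by (intro mult_nonneg_nonneg) auto
  show "\<Phi> x + \<Phi>' x * (y - x) \<le> \<Phi> y"
    using sums_le[OF _ sums_zero sums] nn by auto
  assume "x \<noteq> y"
  obtain k where k: "k \<ge> 2" "w k > 0" by (rule ex_weight_ge_2)
  have "?d k > 0"
    using power_ge_tangent(2)[of x y k] assms k \<open>x \<noteq> y\<close> by (intro mult_pos_pos) auto
  then have "suminf ?d > 0" using sums nn by (intro suminf_pos2[of _ k]) (auto simp: sums_iff)
  then show "\<Phi> x + \<Phi>' x * (y - x) < \<Phi> y" using sums by (simp add: sums_iff)
qed

lemma phi'_strict_mono:
  assumes "0 \<le> x" "x < y" "in_disc y"
  shows "\<Phi>' x < \<Phi>' y"
proof -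
  have "in_disc x" using in_disc_mono[of y x] assms by auto
  then have "\<Phi> x + \<Phi>' x * (y - x) < \<Phi> y" "\<Phi> y + \<Phi>' y * (x - y) < \<Phi> x"
    using phi_tangent(2)[of x y] phi_tangent(2)[of y x] assms conv_phi by auto
  then have "(\<Phi>' x - \<Phi>' y) * (y - x) < 0" by (simp add: algebra_simps)
  then show ?thesis using assms by (auto simp: mult_less_0_iff)
qed

text \<open>Substituting \<open>x = 1 / \<Phi>' y\<close> reduces the characteristic system to one
  real equation. Its left side is positive at \<open>yp\<close>. Far out
  \<open>1 / \<Phi>' y\<close> tends to 0, so the contribution of \<open>G\<close> becomes small
  against \<open>(1 - q) y \<Phi>' y\<close>, the amount by which \<open>y \<Phi>' y\<close> exceeds
  \<open>\<Phi> y\<close>; the sign is then negative.\<close>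

lemma root_exists:
  assumes G: "fps_nonneg G" "fps_nth G 0 = 0" and yp: "yp > 0" "in_disc yp"
    and conv: "fps_conv G (1 / \<Phi>' yp)"
    and pos: "\<Phi>' yp * eval_fps G (1 / \<Phi>' yp) + \<Phi> yp - yp * \<Phi>' yp > 0"
  obtains y where "y > yp" "in_disc y" "\<Phi>' y * eval_fps G (1 / \<Phi>' y) + \<Phi> y - y * \<Phi>' y = 0"
proof -
  define xp where "xp = 1 / \<Phi>' yp"
  have xp: "xp > 0" using phi'_pos[OF yp] by (simp add: xp_def)
  let ?k = "\<lambda>y. \<Phi>' y * eval_fps G (1 / \<Phi>' y) + \<Phi> y - y * \<Phi>' y"
  obtain y0 q where y0: "0 < y0" "ereal y0 < conv_radius w" "q < 1"
    "\<And>y. y \<ge> y0 \<Longrightarrow> ereal y < conv_radius w \<Longrightarrow> \<Phi> y \<le> q * (y * \<Phi>' y)"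
    using ratio by blast
  have contG: "continuous_on {0..xp} (eval_fps G)"
    using continuous_on_eval_fps_conv[OF G(1) conv] by (simp add: xp_def)
  then have "((eval_fps G) \<longlongrightarrow> eval_fps G 0) (at 0 within {0..xp})"
    using xp by (auto simp: continuous_on)
  moreover have "eval_fps G 0 = 0" using G by (simp add: eval_fps_at_0)
  \<comment> \<open>After division by \<open>\<Phi>' y\<close>, negativity follows from
    \<open>G (1 / \<Phi>' y) < (1 - q) y\<close>; the threshold at \<open>y0\<close> suffices
    because the chosen \<open>y\<close> is at least \<open>y0\<close>.\<close>
  moreover have "(1 - q) * y0 > 0" using y0 by simp
  ultimately have "\<forall>\<^sub>F x in at 0 within {0..xp}. eval_fps G x < (1 - q) * y0"
    by (auto intro: order_tendstoD)
  then obtain d where d: "d > 0" "\<And>x. x \<in> {0..xp} \<Longrightarrow> x \<noteq> 0 \<Longrightarrow> dist x 0 < d \<Longrightarrow> eval_fps G x < (1 - q) * y0"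
    by (auto simp: eventually_at)
  obtain y1 where y1: "y1 > 0" "ereal y1 < conv_radius w" "\<Phi>' y1 > max (2 / d) (\<Phi>' yp)"
    using unbounded by blast
  define y where "y = max y0 (max yp y1)"
  have y: "in_disc y" "y \<ge> y0" "y \<ge> yp" "y \<ge> y1" "y > 0"
    using y0 y1 yp by (auto simp: y_def max_def)
  have py: "\<Phi>' y > 2 / d" "\<Phi>' y > \<Phi>' yp" "\<Phi>' y > 0"
    using phi'_mono[of y1 y] y y1 phi'_pos[of y] by auto
  have "1 / \<Phi>' y < d"
  proof -
    have "1 / \<Phi>' y < 1 / (2 / d)" using py d by (intro divide_strict_left_mono) auto
    then show ?thesis using d by simp
  qed
  moreover have "1 / \<Phi>' y \<le> xp"
    unfolding xp_def using py phi'_pos[OF yp] by (intro divide_left_mono) auto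
  ultimately have "eval_fps G (1 / \<Phi>' y) < (1 - q) * y0" using py by (intro d) auto
  also have "\<dots> \<le> (1 - q) * y" using y y0 by (intro mult_left_mono) auto
  finally have "\<Phi>' y * eval_fps G (1 / \<Phi>' y) < \<Phi>' y * ((1 - q) * y)" using py by simp
  moreover have "\<Phi> y \<le> q * (y * \<Phi>' y)" using y0 y by auto
  ultimately have neg: "?k y < 0" by (simp add: algebra_simps)
  have "continuous_on {yp..y} ?k"
  proof -
    have sub: "{yp..y} \<subseteq> {0..y}" using yp by auto
    have c1: "continuous_on {yp..y} \<Phi>" "continuous_on {yp..y} \<Phi>'"
      using continuous_on_eval_fps_conv[of phi y] continuous_on_eval_fps_conv[of "fps_deriv phi" y]
        conv_phi conv_phi' y by (auto intro: continuous_on_subset[OF _ sub])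
    have p: "\<Phi>' z > 0 \<and> \<Phi>' z \<ge> \<Phi>' yp" if "z \<in> {yp..y}" for z
      using that yp y in_disc_mono[of y z] phi'_pos[of z] phi'_mono[of yp z] by auto
    have "continuous_on {yp..y} (\<lambda>z. eval_fps G (1 / \<Phi>' z))"
    proof (rule continuous_on_compose2[OF contG])
      show "continuous_on {yp..y} (\<lambda>z. 1 / \<Phi>' z)"
        by (intro continuous_intros c1) (use p in force)
      show "(\<lambda>z. 1 / \<Phi>' z) ` {yp..y} \<subseteq> {0..xp}"
      proof safe
        fix z assume z: "z \<in> {yp..y}"
        have "1 / \<Phi>' z \<le> 1 / \<Phi>' yp"
          using p[OF z] phi'_pos[OF yp] by (intro divide_left_mono) auto
        then show "1 / \<Phi>' z \<in> {0..xp}" using p[OF z] by (auto simp: xp_def)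
      qed
    qed
    then show ?thesis
      by (intro continuous_on_add continuous_on_diff continuous_on_mult c1 continuous_on_id)
  qed
  then obtain z where z: "z \<ge> yp" "z \<le> y" "?k z = 0"
    using IVT2'[of ?k y 0 yp] neg pos y by auto
  with pos have "z \<noteq> yp" by auto
  then show ?thesis using that[of z] z in_disc_mono[of y z] y yp by auto
qed

text \<open>Partial sums stay below \<open>y\<close> by monotone iteration. At \<open>x\<close> the
  line \<open>v \<mapsto> (v - G x) / x\<close> is tangent to the convex graph of
  \<open>\<Phi>\<close> at \<open>y\<close>, so the fixed-point equation has no other solution
  there, and at a larger \<open>x'\<close> it has none at or above \<open>y\<close>.\<close>

lemma implicit_gf:
  assumes F: "fps_nonneg F" "fps_nth F 0 = 0" and G: "fps_nonneg G" "fps_nth G 0 = 0"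
    and eq: "F = fps_X * (phi oo (F + G))"
    and x: "x > 0" and y: "y > 0" "in_disc y" and conv: "fps_conv G x"
    and char: "y = eval_fps G x + x * \<Phi> y" "x * \<Phi>' y = 1"
  shows "fps_conv F x" "eval_fps (F + G) x = y"
    "x' > x \<Longrightarrow> fps_conv G x' \<Longrightarrow> \<not> fps_conv F x'"
proof -
  let ?Y = "F + G"
  have Y: "fps_nonneg ?Y" "fps_nth ?Y 0 = 0" using F G by auto
  have F_Suc: "fps_nth F (Suc n) = fps_nth (phi oo ?Y) n" for n
    by (subst eq) simp
  have Gx: "eval_fps G x \<ge> 0" using G x conv by (auto intro: eval_fps_conv_nonneg)
  have partial: "(\<Sum>n\<le>N. fps_nth F n * x ^ n) + eval_fps G x \<le> y" for N
  proof (induction N)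
    case 0
    have "x * \<Phi> y \<ge> 0" using x phi_pos[of y] conv_phi y by simp
    then show ?case using F char by simp
  next
    case (Suc N)
    \<comment> \<open>Only \<open>F\<close> is truncated: the coefficients of
      \<open>phi oo ?Y\<close> up to \<open>N\<close> see no more of it, and by the induction
      hypothesis the truncation plus the full \<open>G\<close> has value at most
      \<open>y\<close>.\<close>
    define FN where "FN = Abs_fps (\<lambda>n. if n \<le> N then fps_nth F n else 0)"
    define YN where "YN = FN + G"
    have FN: "fps_nonneg FN" "fps_nth FN 0 = 0" "fps_conv FN x"
      using F by (auto simp: FN_def fps_nonneg_def intro!: fps_conv_finite[of N])
    have "eval_fps FN x = (\<Sum>n\<le>N. fps_nth F n * x ^ n)"
      unfolding eval_fps_def by (subst suminf_finite[of "{..N}"]) (auto simp: FN_def)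
    then have eval: "eval_fps YN x \<le> y"
      using Suc FN conv by (simp add: YN_def eval_fps_conv_add)
    have YN: "fps_nonneg YN" "fps_nth YN 0 = 0" "fps_conv YN x"
      using FN G conv by (auto simp: YN_def intro: fps_conv_add)
    have e0: "eval_fps YN x \<ge> 0" using YN x by (auto intro: eval_fps_conv_nonneg)
    have in_disc: "in_disc (eval_fps YN x)" using in_disc_mono[OF y(2) e0 eval] .
    have agree: "fps_nth (phi oo ?Y) n = fps_nth (phi oo YN) n" if "n \<le> N" for n
    proof -
      have "fps_nth (?Y ^ k) n = fps_nth (YN ^ k) n" for k
        by (rule fps_power_nth_cong) (use that in \<open>auto simp: YN_def FN_def\<close>)
      then show ?thesis by (simp add: fps_compose_nth)
    qed
    have c: "fps_conv (phi oo YN) x"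
      using conv_phi[OF in_disc] YN x by (subst fps_conv_compose_iff) auto
    have "(\<Sum>n\<le>Suc N. fps_nth F n * x ^ n) = x * (\<Sum>n\<le>N. fps_nth (phi oo YN) n * x ^ n)"
      by (subst sum.atMost_Suc_shift) (simp add: F F_Suc agree sum_distrib_left mult_ac)
    also have "(\<Sum>n\<le>N. fps_nth (phi oo YN) n * x ^ n) \<le> eval_fps (phi oo YN) x"
      unfolding eval_fps_def using c x fps_nonneg_compose[OF nonneg_phi YN(1)]
      by (intro sum_le_suminf) (auto simp: fps_conv_def fps_nonneg_def)
    also have "eval_fps (phi oo YN) x = \<Phi> (eval_fps YN x)"
      using YN x conv_phi[OF in_disc] by (intro eval_fps_conv_compose) auto
    also have "\<dots> \<le> \<Phi> y" using phi_mono[OF e0 eval y(2)] .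
    finally show ?case using x char by simp
  qed
  show convF: "fps_conv F x"
    unfolding fps_conv_def
  proof (rule summableI_nonneg_bounded)
    show "(\<Sum>n<N. fps_nth F n * x ^ n) \<le> y" for N
    proof -
      have "(\<Sum>n<N. fps_nth F n * x ^ n) \<le> (\<Sum>n\<le>N. fps_nth F n * x ^ n)"
        using F x by (intro sum_mono2) (auto simp: fps_nonneg_def)
      then show ?thesis using partial[of N] Gx by linarith
    qed
  qed (use F x in \<open>auto simp: fps_nonneg_def\<close>)
  have fixpoint: "fps_conv phi (eval_fps ?Y u) \<and> eval_fps ?Y u = eval_fps G u + u * \<Phi> (eval_fps ?Y u)"
    if u: "u > 0" "fps_conv F u" "fps_conv G u" for u
  proof -
    have cY: "fps_conv ?Y u" using u by (auto intro: fps_conv_add)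
    have "summable (\<lambda>n. fps_nth F (Suc n) * u ^ Suc n)"
      using u by (subst summable_Suc_iff) (simp add: fps_conv_def)
    then have "summable (\<lambda>n. fps_nth F (Suc n) * u ^ Suc n / u)" by (rule summable_divide)
    moreover have "fps_nth F (Suc n) * u ^ Suc n / u = fps_nth (phi oo ?Y) n * u ^ n" for n
      using u by (simp add: F_Suc)
    ultimately have c: "fps_conv (phi oo ?Y) u" by (simp add: fps_conv_def)
    then have c': "fps_conv phi (eval_fps ?Y u)"
      using fps_conv_compose_iff[of phi ?Y u] Y u cY by auto
    have "eval_fps F u = u * eval_fps (phi oo ?Y) u"
      by (subst eq, subst eval_fps_conv_mult) (use Y u c in auto)
    also have "eval_fps (phi oo ?Y) u = \<Phi> (eval_fps ?Y u)"
      using Y u c' cY by (intro eval_fps_conv_compose) auto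
    finally show ?thesis using c' u by (simp add: eval_fps_conv_add)
  qed
  have nnY: "eval_fps ?Y u \<ge> 0" if "u \<ge> 0" "fps_conv F u" "fps_conv G u" for u
    using that Y by (auto intro!: eval_fps_conv_nonneg fps_conv_add)
  show eY: "eval_fps ?Y x = y"
  proof (rule ccontr)
    let ?y = "eval_fps ?Y x"
    assume "?y \<noteq> y"
    note fp = fixpoint[OF x convF conv]
    \<comment> \<open>Because \<open>x * \<Phi>' y = 1\<close>, the tangent multiplied by
      \<open>x\<close> equals \<open>?y - G x\<close>; by the fixed-point equation so does
      \<open>x * \<Phi> ?y\<close>, which excludes the strict inequality.\<close>
    have "\<Phi> y + \<Phi>' y * (?y - y) < \<Phi> ?y"
      using phi_tangent(2)[of y ?y] y fp nnY[of x] x convF conv \<open>?y \<noteq> y\<close> by auto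
    then have "x * (\<Phi> y + \<Phi>' y * (?y - y)) < x * \<Phi> ?y" using x by simp
    also have "x * (\<Phi> y + \<Phi>' y * (?y - y)) = x * \<Phi> y + (x * \<Phi>' y) * (?y - y)"
      by (simp add: algebra_simps)
    finally show False using char fp by simp
  qed
  show "\<not> fps_conv F x'" if x': "x' > x" "fps_conv G x'"
  proof
    assume cF: "fps_conv F x'"
    let ?y = "eval_fps ?Y x'"
    have fp: "fps_conv phi ?y" "?y = eval_fps G x' + x' * \<Phi> ?y"
      using fixpoint[of x'] x x' cF by auto
    \<comment> \<open>The increment of the tangent, scaled by \<open>x'\<close>. It is at least
      \<open>?y - y\<close> because \<open>x' * \<Phi>' y \<ge> 1\<close>; with the strictly larger
      \<open>x' * \<Phi> y\<close> in place of \<open>x * \<Phi> y\<close>, the right side of the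
      fixed-point equation would exceed \<open>?y\<close>.\<close>
    define D where "D = x' * \<Phi>' y * (?y - y)"
    have ge: "?y \<ge> y"
      unfolding eY[symmetric] using Y x x' cF by (intro fps_conv_mono(2)) (auto intro: fps_conv_add)
    have "\<Phi> y + \<Phi>' y * (?y - y) \<le> \<Phi> ?y"
      using phi_tangent(1)[of y ?y] y fp ge by auto
    then have "x' * (\<Phi> y + \<Phi>' y * (?y - y)) \<le> x' * \<Phi> ?y"
      using x x' by (intro mult_left_mono) auto
    then have "x' * \<Phi> y + D \<le> x' * \<Phi> ?y" by (simp add: D_def algebra_simps)
    moreover have "x * \<Phi> y < x' * \<Phi> y"
      using phi_pos[of y] conv_phi y x' by (intro mult_strict_right_mono) auto
    moreover have "?y - y \<le> D"
    proof -
      have "x * \<Phi>' y \<le> x' * \<Phi>' y" using phi'_pos[OF y] x' by (intro mult_right_mono) auto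
      then have "1 * (?y - y) \<le> x' * \<Phi>' y * (?y - y)"
        using char ge by (intro mult_right_mono) auto
      then show ?thesis by (simp add: D_def)
    qed
    moreover have "eval_fps G x \<le> eval_fps G x'"
      using G x x' by (intro fps_conv_mono(2)) auto
    ultimately show False using fp char by linarith
  qed
qed

end

section \<open>Critical points and radii of the series \<open>F m\<close>\<close>

context gen_weights
begin

abbreviation F :: "nat \<Rightarrow> real fps" where "F m \<equiv> moment_gf w m 0"
abbreviation Y :: "nat \<Rightarrow> real fps" where "Y m \<equiv> moment_gf1 w m 0"

definition lower_part :: "nat \<Rightarrow> real fps" where
  "lower_part m = (\<Sum>j<m. fps_const (real (m choose j)) * F j)"

lemma tree_weight_nonneg: "tree_weight w T \<ge> 0"
  unfolding tree_weight_def by (intro prod_nonneg) (simp add: w_nonneg)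

lemma moment_gf_nonneg [simp, intro]: "fps_nonneg (moment_gf w l m)"
  by (auto simp: fps_nonneg_def moment_gf_def gf_def tree_weight_nonneg intro!: sum_nonneg mult_nonneg_nonneg)

lemma moment_gf1_nonneg [simp, intro]: "fps_nonneg (moment_gf1 w a b)"
  unfolding moment_gf1_def by (intro fps_nonneg_sum fps_nonneg_mult fps_nonneg_const) auto

lemma lower_part_nonneg [simp, intro]: "fps_nonneg (lower_part m)"
  unfolding lower_part_def by (intro fps_nonneg_sum fps_nonneg_mult fps_nonneg_const) auto

lemma moment_gf_nth_0 [simp]: "fps_nth (moment_gf w l m) 0 = 0"
  by (simp add: moment_gf_def)

lemma moment_gf1_nth_0 [simp]: "fps_nth (moment_gf1 w a b) 0 = 0"
  by (simp add: moment_gf1_def fps_sum_nth)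

lemma lower_part_nth_0 [simp]: "fps_nth (lower_part m) 0 = 0"
  by (simp add: lower_part_def fps_sum_nth)

lemma Y_decomp: "Y m = F m + lower_part m"
  unfolding moment_gf1_def lower_part_def lessThan_Suc_atMost[symmetric] by (simp add: add.commute)

lemma egf_0: "fps_nth (moment_egf w m) 0 = Y m"
  by (simp add: moment_egf_def)

lemma F_compose_coeff: "F m = fps_X * compose_coeff w (moment_egf w m) 0"
  by (subst moment_gf_rec) simp

lemma F_eq: "F m = fps_X * (phi oo Y m)"
  by (subst F_compose_coeff) (simp add: compose_coeff_0 egf_0)

lemma lower_part_conv: "(\<And>j. j < m \<Longrightarrow> fps_conv (F j) x) \<Longrightarrow> x \<ge> 0 \<Longrightarrow> fps_conv (lower_part m) x"
  unfolding lower_part_def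
  by (intro fps_conv_sum fps_conv_mult fps_nonneg_const) auto

text \<open>The invariant of the induction on \<open>m\<close>: \<open>r\<close> is itself a point
  of convergence, \<open>t\<close> lies strictly inside the disc of \<open>\<Phi>\<close>, and
  divergence beyond \<open>r\<close> identifies \<open>r\<close> as the radius. The earlier
  \<open>F j\<close> are included since they form the lower part of the next step.\<close>

definition char_point :: "nat \<Rightarrow> real \<Rightarrow> real \<Rightarrow> bool" where
  "char_point m r t \<longleftrightarrow> r > 0 \<and> t > 0 \<and> ereal t < conv_radius w \<and> r * \<Phi>' t = 1 \<and>
     (\<forall>j\<le>m. fps_conv (F j) r) \<and> eval_fps (Y m) r = t \<and> (\<forall>x>r. \<not> fps_conv (F m) x)"

text \<open>A larger root in \<open>y\<close> is a smaller point in \<open>x\<close>, because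
  \<open>1 / \<Phi>'\<close> decreases strictly. So the lower part, convergent at
  \<open>1 / \<Phi>' yp\<close>, converges strictly beyond the new critical point.\<close>

lemma char_point_exists:
  assumes yp: "yp > 0" "in_disc yp"
    and conv: "\<And>j. j < m \<Longrightarrow> fps_conv (F j) (1 / \<Phi>' yp)"
    and pos: "\<Phi>' yp * eval_fps (lower_part m) (1 / \<Phi>' yp) + \<Phi> yp - yp * \<Phi>' yp > 0"
  obtains r t where "char_point m r t" "r < 1 / \<Phi>' yp"
proof -
  define xp where "xp = 1 / \<Phi>' yp"
  have xp: "xp > 0" using phi'_pos[OF yp] by (simp add: xp_def)
  have cG: "fps_conv (lower_part m) xp" using conv xp by (intro lower_part_conv) (auto simp: xp_def)
  obtain y where y: "y > yp" "in_disc y" "\<Phi>' y * eval_fps (lower_part m) (1 / \<Phi>' y) + \<Phi> y - y * \<Phi>' y = 0"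
    using root_exists[OF lower_part_nonneg lower_part_nth_0 yp _ pos] cG by (auto simp: xp_def)
  define x where "x = 1 / \<Phi>' y"
  have p: "\<Phi>' y > 0" using phi'_pos y yp by auto
  have x: "x > 0" "x < xp"
    using p phi'_strict_mono[of yp y] y yp phi'_pos[OF yp]
    by (auto simp: x_def xp_def intro!: divide_strict_left_mono)
  have cGx: "fps_conv (lower_part m) x" using fps_conv_mono(1)[OF _ _ _ cG] x by auto
  have char: "y = eval_fps (lower_part m) x + x * \<Phi> y" "x * \<Phi>' y = 1"
    using y p by (auto simp: x_def field_simps)
  have eq: "F m = fps_X * (phi oo (F m + lower_part m))"
    unfolding Y_decomp[symmetric] by (rule F_eq)
  note * = implicit_gf[OF moment_gf_nonneg moment_gf_nth_0 lower_part_nonneg lower_part_nth_0 eq x(1) _ y(2) cGx char]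
  have "char_point m x y"
    unfolding char_point_def
  proof (intro conjI allI impI)
    show "fps_conv (F j) x" if "j \<le> m" for j
    proof (cases "j = m")
      case False
      then show ?thesis using that conv[of j] x fps_conv_mono(1)[of "F j" x xp] by (auto simp: xp_def)
    qed (use *(1) y yp in auto)
    show "\<not> fps_conv (F m) x'" if "x' > x" for x'
    proof
      assume "fps_conv (F m) x'"
      \<comment> \<open>The divergence statement asks for convergence of the lower part, known only
        up to \<open>xp\<close>; a larger \<open>x'\<close> is cut back to \<open>xp\<close>, which
        still exceeds \<open>x\<close>.\<close>
      then have "fps_conv (F m) (min x' xp)"
        by (rule fps_conv_mono(1)[rotated 3]) (use x that in auto)
      moreover have "fps_conv (lower_part m) (min x' xp)"
        by (rule fps_conv_mono(1)[rotated 3, OF cG]) (use x that in auto)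
      ultimately show False using *(3)[of "min x' xp"] x that y yp by auto
    qed
  qed (use x y yp char *(2) in \<open>auto simp: Y_decomp\<close>)
  then show ?thesis using that x by (auto simp: xp_def)
qed

text \<open>With an empty lower part the starting condition is
  \<open>\<Phi> yp > yp \<Phi>' yp\<close>. It holds for small \<open>yp\<close> since
  \<open>\<Phi> 0 = w 0 > 0\<close>; the bound \<open>w 0 / (2 \<Phi>' y1)\<close> keeps the right
  side at most \<open>w 0 / 2\<close>.\<close>

lemma char_point_0: "\<exists>r t. char_point 0 r t"
proof -
  obtain y1 where y1: "y1 > 0" "ereal y1 < conv_radius w" using unbounded by blast
  have p: "\<Phi>' y1 > 0" using phi'_pos y1 by auto
  define yp where "yp = min y1 (w 0 / (2 * \<Phi>' y1))"
  have yp: "yp > 0" "yp \<le> y1" "yp \<le> w 0 / (2 * \<Phi>' y1)" using y1 p w_0 by (auto simp: yp_def)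
  have d: "in_disc yp" using in_disc_mono[of y1 yp] yp y1 by auto
  have "\<Phi> yp \<ge> \<Phi> 0" using phi_mono[of 0 yp] d by auto
  then have "\<Phi> yp \<ge> w 0" by (simp add: eval_fps_at_0)
  moreover have "yp * \<Phi>' yp \<le> (w 0 / (2 * \<Phi>' y1)) * \<Phi>' y1"
    using yp phi'_mono[of yp y1] y1 phi'_pos[of yp] d w_0 p by (intro mult_mono) auto
  then have "yp * \<Phi>' yp \<le> w 0 / 2" using p by simp
  ultimately have "\<Phi> yp - yp * \<Phi>' yp > 0" using w_0 by linarith
  then have "\<Phi>' yp * eval_fps (lower_part 0) (1 / \<Phi>' yp) + \<Phi> yp - yp * \<Phi>' yp > 0"
    by (simp add: lower_part_def)
  from char_point_exists[OF yp(1) d _ this] show ?thesis by blast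
qed

text \<open>The old critical value \<open>t\<close> serves as starting point. Binomials grow with
  the upper index, so the new lower part has value at least \<open>t\<close> at
  \<open>r = 1 / \<Phi>' t\<close>; this cancels \<open>- t \<Phi>' t\<close> and leaves
  \<open>\<Phi> t > 0\<close> to spare.\<close>

lemma char_point_Suc:
  assumes "char_point m r t"
  shows "\<exists>r' t'. char_point (Suc m) r' t' \<and> r' < r"
proof -
  have r: "r > 0" "t > 0" "in_disc t" "r * \<Phi>' t = 1" "\<And>j. j \<le> m \<Longrightarrow> fps_conv (F j) r" "eval_fps (Y m) r = t"
    using assms by (auto simp: char_point_def)
  have r': "1 / \<Phi>' t = r" using r by (metis nonzero_eq_divide_eq mult_zero_right zero_neq_one)
  have "t \<le> eval_fps (lower_part (Suc m)) r"
  proof -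
    have "t = eval_fps (Y m) r" using r by simp
    also have "\<dots> \<le> eval_fps (lower_part (Suc m)) r"
    proof (rule fps_conv_le(2))
      show "fps_nth (Y m) n \<ge> 0" for n using moment_gf1_nonneg by (simp add: fps_nonneg_def)
      show "fps_nth (Y m) n \<le> fps_nth (lower_part (Suc m)) n" for n
        unfolding moment_gf1_def lower_part_def lessThan_Suc_atMost fps_sum_nth fps_mult_left_const_nth
      proof (intro sum_mono mult_right_mono)
        show "fps_nth (F j) n \<ge> 0" for j using moment_gf_nonneg by (simp add: fps_nonneg_def)
        show "real (m choose j) \<le> real (Suc m choose j)" for j by (cases j) auto
      qed
      show "fps_conv (lower_part (Suc m)) r" using r by (intro lower_part_conv) auto
    qed (use r in simp)
    finally show ?thesis .
  qed
  then have "t * \<Phi>' t \<le> eval_fps (lower_part (Suc m)) r * \<Phi>' t"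
    using phi'_pos[of t] r by (intro mult_right_mono) auto
  moreover have "\<Phi> t > 0" using phi_pos conv_phi r by auto
  ultimately have "\<Phi>' t * eval_fps (lower_part (Suc m)) (1 / \<Phi>' t) + \<Phi> t - t * \<Phi>' t > 0"
    unfolding r' by (simp add: mult.commute)
  then show ?thesis
    using char_point_exists[of t "Suc m"] r r' by (metis less_Suc_eq_le)
qed

definition rad :: "nat \<Rightarrow> real" where "rad m = real_of_ereal (rho w m)"
definition crit :: "nat \<Rightarrow> real" where "crit m = eval_fps (Y m) (rad m)"

lemma rho_eq:
  assumes "char_point m r t"
  shows "rho w m = ereal r"
proof -
  have *: "rho w m = conv_radius (fps_nth (F m))"
    by (simp add: rho_def moment_gf_def gf_def)
  have "conv_radius (fps_nth (F m)) \<ge> ereal r"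
    using assms conv_radius_geI[of "fps_nth (F m)" r] by (auto simp: char_point_def fps_conv_def)
  moreover have "conv_radius (fps_nth (F m)) \<le> ereal r"
  proof (rule dense_ge)
    fix x assume x: "ereal r < x"
    show "conv_radius (fps_nth (F m)) \<le> x"
    proof (cases x)
      case (real x')
      then have "\<not> summable (\<lambda>n. fps_nth (F m) n * x' ^ n)" "x' \<ge> 0"
        using assms x by (auto simp: char_point_def fps_conv_def)
      moreover have "(\<lambda>n. norm (fps_nth (F m) n * x' ^ n)) = (\<lambda>n. fps_nth (F m) n * x' ^ n)"
        using \<open>x' \<ge> 0\<close> moment_gf_nonneg[of m 0] by (auto simp: fps_nonneg_def)
      ultimately show ?thesis using conv_radius_leI[of "fps_nth (F m)" x'] real by simp
    qed (use x in auto)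
  qed
  ultimately show ?thesis unfolding * by (rule antisym[rotated])
qed

lemma char_point_rad: "char_point m (rad m) (crit m)"
proof -
  have "\<exists>r t. char_point m r t"
    by (induction m) (use char_point_0 char_point_Suc in blast)+
  then obtain r t where *: "char_point m r t" by blast
  then have "rad m = r" by (simp add: rad_def rho_eq)
  moreover have "t = eval_fps (Y m) r" using * by (simp add: char_point_def)
  ultimately show ?thesis using * by (simp add: crit_def)
qed

lemma rho_rad: "rho w m = ereal (rad m)"
  using rho_eq[OF char_point_rad] .

lemma rad_Suc: "rad (Suc m) < rad m"
proof -
  obtain r' t' where "char_point (Suc m) r' t'" "r' < rad m"
    using char_point_Suc[OF char_point_rad] by blast
  then show ?thesis using rho_eq by (simp add: rad_def)
qed

lemma rad_strict_antimono: "i < j \<Longrightarrow> rad j < rad i"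
  by (rule lift_Suc_mono_less[of "\<lambda>i. - rad i", simplified]) (use rad_Suc in auto)

lemma rad_pos: "rad m > 0" and crit_pos: "crit m > 0" and crit_disc: "in_disc (crit m)"
  and rad_crit: "rad m * \<Phi>' (crit m) = 1" and conv_F_rad: "j \<le> m \<Longrightarrow> fps_conv (F j) (rad m)"
  using char_point_rad[of m] by (auto simp: char_point_def)

lemma conv_F: "0 \<le> x \<Longrightarrow> x \<le> rad m \<Longrightarrow> fps_conv (F m) x"
  using fps_conv_mono(1)[of "F m" x "rad m"] conv_F_rad[of m m] by auto

section \<open>Mixed moments in terms of \<open>F (l + m)\<close>\<close>

definition nonneg_conv :: "real \<Rightarrow> real fps \<Rightarrow> bool" where
  "nonneg_conv x f \<longleftrightarrow> fps_nonneg f \<and> fps_conv f x"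

lemma nonneg_conv_add: "nonneg_conv x f \<Longrightarrow> nonneg_conv x g \<Longrightarrow> nonneg_conv x (f + g)"
  and nonneg_conv_mult: "x \<ge> 0 \<Longrightarrow> nonneg_conv x f \<Longrightarrow> nonneg_conv x g \<Longrightarrow> nonneg_conv x (f * g)"
  and nonneg_conv_const: "c \<ge> 0 \<Longrightarrow> nonneg_conv x (fps_const c)"
  and nonneg_conv_X: "nonneg_conv x fps_X" and nonneg_conv_0: "nonneg_conv x 0"
  by (auto simp: nonneg_conv_def fps_conv_add fps_conv_mult)

lemma nonneg_conv_sum: "(\<And>i. i \<in> A \<Longrightarrow> nonneg_conv x (f i)) \<Longrightarrow> nonneg_conv x (\<Sum>i\<in>A. f i)"
  by (induction A rule: infinite_finite_induct) (auto simp: nonneg_conv_0 nonneg_conv_add)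

text \<open>Induction on the order in the auxiliary variable, for all \<open>f\<close> at once,
  because each step replaces \<open>f\<close> by its derivative, whose radius is not
  smaller.\<close>

lemma nonneg_conv_compose_coeff:
  assumes x: "x \<ge> 0" and P0: "\<And>b. fps_nth (fps_nth P b) 0 = 0"
    and P: "\<And>b. b \<le> c \<Longrightarrow> nonneg_conv x (fps_nth P b)"
    and f: "fps_nonneg (Abs_fps f)" "fps_conv_radius (Abs_fps f) \<ge> conv_radius w"
    and disc: "ereal (eval_fps (fps_nth P 0) x) < conv_radius w"
  shows "nonneg_conv x (compose_coeff f P c)"
  using f P
proof (induction c arbitrary: f rule: less_induct)
  case (less c)
  have g0: "nonneg_conv x (fps_nth P 0)" using less.prems by auto
  show ?case
  proof (cases c)
    case 0
    have e: "eval_fps (fps_nth P 0) x \<ge> 0" using g0 x by (auto simp: nonneg_conv_def intro: eval_fps_conv_nonneg)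
    have "fps_conv (Abs_fps f) (eval_fps (fps_nth P 0) x)"
      using disc less.prems(2) e by (intro fps_conv_radiusI) auto
    then show ?thesis
      using g0 less.prems P0 x unfolding 0 compose_coeff_0 nonneg_conv_def
      by (auto simp: fps_conv_compose_iff)
  next
    case (Suc i)
    let ?f' = "\<lambda>k. real (Suc k) * f (Suc k)"
    have "Abs_fps ?f' = fps_deriv (Abs_fps f)" by (simp add: fps_eq_iff)
    then have f': "fps_nonneg (Abs_fps ?f')" "fps_conv_radius (Abs_fps ?f') \<ge> conv_radius w"
      using less.prems fps_conv_radius_deriv[of "Abs_fps f"] by (auto simp: fps_nonneg_def intro: order_trans)
    have "nonneg_conv x (fps_const (real (Suc i)) * compose_coeff f P (Suc i))"
      unfolding compose_coeff_Suc[OF P0]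
      by (intro nonneg_conv_sum nonneg_conv_mult x nonneg_conv_const less.IH f') (use Suc less.prems in auto)
    then have "nonneg_conv x (fps_const (1 / real (Suc i)) * (fps_const (real (Suc i)) * compose_coeff f P (Suc i)))"
      by (rule nonneg_conv_mult[OF x nonneg_conv_const, rotated]) simp
    moreover have "fps_const (1 / real (Suc i)) * (fps_const (real (Suc i)) * compose_coeff f P (Suc i)) = compose_coeff f P (Suc i)"
      by (simp add: mult.assoc[symmetric] del: of_nat_Suc)
    ultimately show ?thesis by (simp only: Suc)
  qed
qed

text \<open>The solution is \<open>h / (1 - p)\<close>; the geometric series in \<open>p\<close> has
  nonnegative coefficients and converges at \<open>x\<close> because
  \<open>p(x) < 1\<close>.\<close>

lemma solve_linear_fps:
  assumes x: "x \<ge> 0" and p: "nonneg_conv x p" "fps_nth p 0 = 0" "eval_fps p x < 1" and f: "f = h + p * f"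
  obtains K where "nonneg_conv x K" "f = K * h"
proof -
  define g :: "real fps" where "g = Abs_fps (\<lambda>_. 1)"
  have ep: "eval_fps p x \<ge> 0" using p x by (auto simp: nonneg_conv_def intro: eval_fps_conv_nonneg)
  have "fps_conv g (eval_fps p x)"
    using p ep by (auto simp: fps_conv_def g_def intro!: summable_geometric)
  moreover have "fps_nonneg g" by (auto simp: g_def fps_nonneg_def)
  ultimately have nonneg_conv: "nonneg_conv x (g oo p)"
    using p x by (auto simp: nonneg_conv_def fps_conv_compose_iff)
  have "g * (1 - fps_X) = 1"
  proof (rule fps_ext)
    fix n show "fps_nth (g * (1 - fps_X)) n = fps_nth 1 n"
      by (cases n) (auto simp: g_def algebra_simps)
  qed
  then have "(g oo p) * (1 - p) = 1"
    using p by (metis fps_compose_mult_distrib fps_compose_sub_distrib fps_compose_1 fps_X_fps_compose_startby0)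
  moreover have "h = (1 - p) * f" using f by (simp add: algebra_simps)
  ultimately have "f = (g oo p) * h" by (metis mult.assoc mult_1)
  with nonneg_conv show ?thesis using that by blast
qed

text \<open>Below the radius, \<open>Y a\<close> stays under its critical value, so
  \<open>x \<Phi>'(Y a)\<close> is below the value 1 attained at \<open>rad a\<close>. This number
  is the value of the kernel in the linear equation for the mixed moments.\<close>

lemma eval_Y_lt_crit:
  assumes "0 < x" "x < rad a"
  shows "fps_conv (Y a) x" "in_disc (eval_fps (Y a) x)" "x * \<Phi>' (eval_fps (Y a) x) < 1"
proof -
  have "fps_conv (Y a) (rad a)"
    unfolding moment_gf1_def
    by (intro fps_conv_sum fps_conv_mult fps_nonneg_const conv_F_rad) (use rad_pos[of a] in auto)
  from fps_conv_mono[OF moment_gf1_nonneg _ _ this, of x]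
  have c: "fps_conv (Y a) x" and le: "eval_fps (Y a) x \<le> crit a" using assms by (auto simp: crit_def)
  show "fps_conv (Y a) x" by (rule c)
  have ge: "eval_fps (Y a) x \<ge> 0" using c assms by (intro eval_fps_conv_nonneg) auto
  show d: "in_disc (eval_fps (Y a) x)" using in_disc_mono[OF crit_disc ge le] .
  have "x * \<Phi>' (eval_fps (Y a) x) \<le> x * \<Phi>' (crit a)"
    using assms phi'_mono[OF ge le crit_disc] by simp
  also have "\<dots> < rad a * \<Phi>' (crit a)"
    using assms phi'_pos[OF crit_pos crit_disc] by (intro mult_strict_right_mono)
  finally show "x * \<Phi>' (eval_fps (Y a) x) < 1" by (simp add: rad_crit)
qed

text \<open>Induction on the total exponent \<open>M = l + m\<close>. Series of smaller total
  exponent converge beyond \<open>rad M\<close> and count as known coefficients in the recursion;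
  the series of exponent exactly \<open>M\<close> satisfy a linear system that is triangular in the
  power of \<open>S\<close>.\<close>

theorem moment_gf_decomp:
  "\<exists>A B x. rad (l + m) < x \<and> nonneg_conv x A \<and> nonneg_conv x B \<and> moment_gf w l m = A + B * F (l + m)"
proof -
  have "\<exists>A B x. rad M < x \<and> nonneg_conv x A \<and> nonneg_conv x B \<and> moment_gf w (M - m) m = A + B * F M" if "m \<le> M" for m M
    using that
  proof (induction M arbitrary: m rule: less_induct)
    case (less M)
    show ?case
    proof (cases "m = 0")
      case True
      show ?thesis
        by (rule exI[of _ 0], rule exI[of _ 1], rule exI[of _ "rad M + 1"])
           (simp add: True nonneg_conv_def)
    next
      case False
      then obtain M' where M': "M = Suc M'" using less.prems by (cases M) auto
      define x where "x = (rad M + rad M') / 2"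
      have x: "rad M < x" "x < rad M'" "x > 0"
        using rad_Suc[of M'] rad_pos[of M] rad_pos[of M'] by (auto simp: x_def M')
      have x_lt: "x < rad i" if "i < M" for i
        using that x rad_strict_antimono[of i M'] by (cases "i = M'") (auto simp: M')
      have lower: "nonneg_conv x (moment_gf w j i)" if "j + i < M" for j i
      proof -
        from less.IH[of "j + i" i] that obtain A B u where *: "rad (j + i) < u" "nonneg_conv u A" "nonneg_conv u B"
          "moment_gf w j i = A + B * F (j + i)" by auto
        have le: "x < rad (j + i)" by (rule x_lt[OF that])
        have "nonneg_conv x A" "nonneg_conv x B"
          using * le x fps_conv_mono(1)[of A x u] fps_conv_mono(1)[of B x u] by (auto simp: nonneg_conv_def)
        moreover have "nonneg_conv x (F (j + i))" using conv_F[of x "j + i"] le x by (auto simp: nonneg_conv_def)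
        ultimately show ?thesis unfolding *(4) using x by (intro nonneg_conv_add nonneg_conv_mult) auto
      qed
      have lower1: "nonneg_conv x (moment_gf1 w a i)" if "a + i < M" for a i
        unfolding moment_gf1_def using x that by (intro nonneg_conv_sum nonneg_conv_mult nonneg_conv_const lower) auto
      have egf: "nonneg_conv x (fps_nth (moment_egf w a) i)" if "a + i < M" for a i
        unfolding moment_egf_def fps_nth_Abs_fps using x that by (intro nonneg_conv_mult nonneg_conv_const lower1) auto
      have egf0: "fps_nth (fps_nth (moment_egf w a) b) 0 = 0" for a b
        by (simp add: moment_egf_def)
      define D where "D = (\<lambda>a. compose_coeff (\<lambda>k. real (Suc k) * w (Suc k)) (moment_egf w a) 0)"
      have w': "Abs_fps (\<lambda>k. real (Suc k) * w (Suc k)) = fps_deriv phi" by (simp add: fps_eq_iff)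
      have rad': "fps_conv_radius (fps_deriv phi) \<ge> conv_radius w"
        using fps_conv_radius_deriv[of phi] by (simp add: radius_phi)
      have D_eq: "D a = fps_deriv phi oo Y a" for a
        by (simp add: D_def compose_coeff_0 egf_0 w' del: of_nat_Suc)
      have disc: "in_disc (eval_fps (Y a) x)" if "a < M" for a
        using eval_Y_lt_crit x_lt[OF that] x by blast
      have D_good: "nonneg_conv x (D a)" if "a < M" for a
        unfolding D_def using that x disc[OF that] rad'
        by (intro nonneg_conv_compose_coeff egf0 egf) (auto simp: w' egf_0 simp del: of_nat_Suc)
      \<comment> \<open>In the chain-rule expansion of the \<open>i\<close>-th coefficient, only the
        term with the full coefficient \<open>fps_nth (moment_egf w (M - i)) i\<close> contains a
        series of total exponent \<open>M\<close>, and within it only the top power of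
        \<open>R\<close>. Everything else goes into \<open>g\<close>.\<close>
      have summand: "\<exists>g. nonneg_conv x g \<and> fps_const (real (k choose i) * fact i) * (fps_X * compose_coeff w (moment_egf w (M - i)) i)
          = fps_const (real (k choose i)) * (fps_X * (D (M - i) * moment_gf w (M - i) i)) + g"
        if i: "1 \<le> i" "i \<le> k" "k \<le> M" for i k
      proof -
        define a where "a = M - i"
        have a: "a + i = M" "a < M" using i by (auto simp: a_def)
        obtain i' where i': "i = Suc i'" using i by (cases i) auto
        let ?P = "moment_egf w a" and ?w' = "\<lambda>k. real (Suc k) * w (Suc k)"
        define g1 where "g1 = (\<Sum>b<i'. fps_const (real (Suc b)) * fps_nth ?P (Suc b) * compose_coeff ?w' ?P (i' - b))"
        have g1: "nonneg_conv x g1"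
          unfolding g1_def using x a i' disc[OF a(2)] rad'
          by (intro nonneg_conv_sum nonneg_conv_mult nonneg_conv_const nonneg_conv_compose_coeff egf0 egf) (auto simp: w' egf_0 simp del: of_nat_Suc)
        define g2 where "g2 = (\<Sum>j<a. fps_const (real (a choose j)) * moment_gf w j i)"
        have g2: "nonneg_conv x g2"
          unfolding g2_def using x a by (intro nonneg_conv_sum nonneg_conv_mult nonneg_conv_const lower) auto
        have Pi: "fps_const (real i) * fps_nth ?P i = fps_const (real i / fact i) * (moment_gf w a i + g2)"
          unfolding g2_def moment_egf_def moment_gf1_def lessThan_Suc_atMost[symmetric]
          by (simp add: add.commute mult.assoc[symmetric])
        have "fps_const (real i) * compose_coeff w ?P i = g1 + fps_const (real i) * fps_nth ?P i * D a"
          unfolding i' compose_coeff_Suc[OF egf0]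
          by (simp add: lessThan_Suc_atMost[symmetric] g1_def D_def del: of_nat_Suc)
        also have "\<dots> = g1 + fps_const (real i / fact i) * (moment_gf w a i + g2) * D a"
          by (simp only: Pi)
        finally have "fps_const (fact i / real i) * (fps_const (real i) * compose_coeff w ?P i)
           = fps_const (fact i / real i) * (g1 + fps_const (real i / fact i) * (moment_gf w a i + g2) * D a)"
          by simp
        then have eq: "fps_const (fact i) * compose_coeff w ?P i = fps_const (fact i / real i) * g1 + (moment_gf w a i + g2) * D a"
          using i' by (simp add: mult.assoc[symmetric] distrib_left mult.commute[of "fact i'"] del: of_nat_Suc)
        define g where "g = fps_const (real (k choose i)) * fps_X * (fps_const (fact i / real i) * g1 + g2 * D a)"
        have "nonneg_conv x g" unfolding g_def using x
          by (intro nonneg_conv_mult nonneg_conv_add nonneg_conv_const nonneg_conv_X g1 g2 D_good a) auto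
        moreover have "fps_const (real (k choose i) * fact i) * (fps_X * compose_coeff w ?P i)
            = fps_const (real (k choose i)) * (fps_X * (fps_const (fact i) * compose_coeff w ?P i))"
          by (simp add: mult_ac fps_const_mult[symmetric] del: fps_const_mult)
        ultimately show ?thesis unfolding eq a_def[symmetric]
          by (intro exI[of _ g]) (simp add: g_def algebra_simps)
      qed
      have rec: "moment_gf w (M - k) k = F M + (\<Sum>i=1..k. fps_const (real (k choose i) * fact i) *
          (fps_X * compose_coeff w (moment_egf w (M - i)) i))" if "k \<le> M" for k
      proof -
        have "moment_gf w (M - k) k = (\<Sum>i\<le>k. fps_const (real (k choose i) * fact i) *
          (fps_X * compose_coeff w (moment_egf w (M - i)) i))"
          by (subst moment_gf_rec) (use that in simp)
        also have "{..k} = insert 0 {1..k}" by auto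
        finally show ?thesis by (simp add: F_compose_coeff[of M])
      qed
      \<comment> \<open>Inner induction along the diagonal of total exponent \<open>M\<close>:
        smaller powers of \<open>S\<close> are already of the form \<open>A + B * F M\<close>, and
        \<open>i = k\<close> brings the unknown back with factor \<open>c k\<close>.\<close>
      have "\<exists>A B. nonneg_conv x A \<and> nonneg_conv x B \<and> moment_gf w (M - k) k = A + B * F M" if "k \<le> M" for k
        using that
      proof (induction k rule: less_induct)
        case (less k)
        show ?case
        proof (cases "k = 0")
          case True
          show ?thesis
            by (rule exI[of _ 0], rule exI[of _ 1]) (simp add: True nonneg_conv_def)
        next
          case False
          define c where "c = (\<lambda>i. fps_const (real (k choose i)) * (fps_X * D (M - i)))"
          have c_good: "nonneg_conv x (c i)" if "1 \<le> i" "i \<le> k" for i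
            unfolding c_def using x that less.prems by (intro nonneg_conv_mult nonneg_conv_const nonneg_conv_X D_good) auto
          have "\<forall>i\<in>{1..k}. \<exists>g. nonneg_conv x g \<and> fps_const (real (k choose i) * fact i) * (fps_X * compose_coeff w (moment_egf w (M - i)) i)
              = c i * moment_gf w (M - i) i + g"
            using summand[of _ k] less.prems unfolding c_def by (simp add: mult.assoc)
          then obtain g where g: "\<And>i. i \<in> {1..k} \<Longrightarrow> nonneg_conv x (g i)"
            "\<And>i. i \<in> {1..k} \<Longrightarrow> fps_const (real (k choose i) * fact i) * (fps_X * compose_coeff w (moment_egf w (M - i)) i)
              = c i * moment_gf w (M - i) i + g i" by metis
          have "\<forall>i\<in>{1..<k}. \<exists>A B. nonneg_conv x A \<and> nonneg_conv x B \<and> moment_gf w (M - i) i = A + B * F M"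
            using less by auto
          then obtain A B where AB: "\<And>i. i \<in> {1..<k} \<Longrightarrow> nonneg_conv x (A i)" "\<And>i. i \<in> {1..<k} \<Longrightarrow> nonneg_conv x (B i)"
            "\<And>i. i \<in> {1..<k} \<Longrightarrow> moment_gf w (M - i) i = A i + B i * F M" by metis
          define A' where "A' = (\<Sum>i\<in>{1..<k}. c i * A i + g i) + g k"
          define B' where "B' = 1 + (\<Sum>i\<in>{1..<k}. c i * B i)"
          have good': "nonneg_conv x A'" "nonneg_conv x B'"
            unfolding A'_def B'_def fps_const_1_eq_1[symmetric] using x g AB False
            by (intro nonneg_conv_add nonneg_conv_sum nonneg_conv_mult nonneg_conv_const c_good; simp)+
          have "moment_gf w (M - k) k = F M + (\<Sum>i\<in>{1..k}. c i * moment_gf w (M - i) i + g i)"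
            using g less.prems by (subst rec) auto
          also have "{1..k} = insert k {1..<k}" using False by auto
          also have "(\<Sum>i\<in>insert k {1..<k}. c i * moment_gf w (M - i) i + g i)
              = c k * moment_gf w (M - k) k + g k + (\<Sum>i\<in>{1..<k}. c i * (A i + B i * F M) + g i)"
            using AB by simp
          also have "F M + \<dots> = (A' + B' * F M) + c k * moment_gf w (M - k) k"
            by (simp add: A'_def B'_def algebra_simps sum.distrib sum_distrib_left)
          finally have eq: "moment_gf w (M - k) k = (A' + B' * F M) + c k * moment_gf w (M - k) k" .
          have Mk: "M - k < M" using False less.prems by auto
          have "eval_fps (c k) x = x * \<Phi>' (eval_fps (Y (M - k)) x)"
          proof -
            have cD: "fps_conv (D (M - k)) x" "fps_nonneg (D (M - k))" using D_good[OF Mk] by (auto simp: nonneg_conv_def)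
            have "c k = fps_X * D (M - k)" by (simp add: c_def)
            then have "eval_fps (c k) x = x * eval_fps (D (M - k)) x"
              using cD x by (simp add: eval_fps_conv_mult)
            also have "eval_fps (D (M - k)) x = \<Phi>' (eval_fps (Y (M - k)) x)"
              unfolding D_eq using x disc[OF Mk] conv_phi' eval_Y_lt_crit(1)[OF _ x_lt[OF Mk]]
              by (intro eval_fps_conv_compose) auto
            finally show ?thesis .
          qed
          then have "eval_fps (c k) x < 1" using eval_Y_lt_crit(3)[OF _ x_lt[OF Mk]] x by simp
          moreover have "nonneg_conv x (c k)" using c_good False by simp
          moreover have "fps_nth (c k) 0 = 0" by (simp add: c_def)
          ultimately obtain K where K: "nonneg_conv x K" "moment_gf w (M - k) k = K * (A' + B' * F M)"
            using solve_linear_fps[OF _ _ _ _ eq, of x] x by auto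
          show ?thesis
            using K good' x by (intro exI[of _ "K * A'"] exI[of _ "K * B'"])
              (auto simp: algebra_simps intro: nonneg_conv_mult)
        qed
      qed
      from this[OF less.prems] x show ?thesis by blast
    qed
  qed
  from this[of m "l + m"] show ?thesis by simp
qed

end

section \<open>Square root singularities\<close>

text \<open>The inverse function theorem for \<open>H(a, b) = (a, F(a, b))\<close>, whose derivative
  is triangular and invertible because \<open>Fb\<close> is nonzero. On points \<open>(a, 0)\<close>
  the inverse of \<open>H\<close> has the form \<open>(a, g a)\<close>; injectivity of
  \<open>H\<close> on \<open>W\<close> gives uniqueness of the zero.\<close>

lemma holomorphic_implicit_function:
  fixes F Fa Fb :: "complex \<times> complex \<Rightarrow> complex"
  assumes U: "open U" "(a0, b0) \<in> U"
    and der: "\<And>p. p \<in> U \<Longrightarrow> (F has_derivative (\<lambda>h. Fa p * fst h + Fb p * snd h)) (at p)"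
    and cont: "continuous_on U Fa" "continuous_on U Fb"
    and zero: "F (a0, b0) = 0" and nz: "Fb (a0, b0) \<noteq> 0"
  obtains W g r where "open W" "(a0, b0) \<in> W" "W \<subseteq> U" "r > 0" "g a0 = b0"
    "\<And>a. a \<in> ball a0 r \<Longrightarrow> (a, g a) \<in> W \<and> F (a, g a) = 0"
    "\<And>a. a \<in> ball a0 r \<Longrightarrow>
       Fb (a, g a) \<noteq> 0 \<and> (g has_field_derivative - Fa (a, g a) / Fb (a, g a)) (at a)"
    "\<And>a b. (a, b) \<in> W \<Longrightarrow> a \<in> ball a0 r \<Longrightarrow> F (a, b) = 0 \<Longrightarrow> b = g a"
proof -
  define H where "H = (\<lambda>p :: complex \<times> complex. (fst p, F p))"
  define bl1 :: "(complex \<times> complex) \<Rightarrow>\<^sub>L (complex \<times> complex)" where "bl1 = Blinfun (\<lambda>x. (fst x, 0))"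
  define bl2 :: "complex \<Rightarrow>\<^sub>L (complex \<times> complex)" where "bl2 = Blinfun (\<lambda>y. (0, y))"
  have bl1: "blinfun_apply bl1 x = (fst x, 0)" for x
    unfolding bl1_def by (subst bounded_linear_Blinfun_apply) (auto intro!: bounded_linear_intros)
  have bl2: "blinfun_apply bl2 x = (0, x)" for x
    unfolding bl2_def by (subst bounded_linear_Blinfun_apply) (auto intro!: bounded_linear_intros)
  define H' where "H' = (\<lambda>p. bl1 + (bl2 o\<^sub>L ((blinfun_mult_right (Fa p) o\<^sub>L fst_blinfun)
      + (blinfun_mult_right (Fb p) o\<^sub>L snd_blinfun))))"
  have H': "blinfun_apply (H' p) h = (fst h, Fa p * fst h + Fb p * snd h)" for p h
    by (simp add: H'_def bl1 bl2 blinfun.add_left blinfun.add_right)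
  have derH: "(H has_derivative blinfun_apply (H' p)) (at p)" if "p \<in> U" for p
  proof -
    have "(H has_derivative (\<lambda>h. (fst h, Fa p * fst h + Fb p * snd h))) (at p)"
      unfolding H_def by (intro has_derivative_Pair der[OF that] has_derivative_fst has_derivative_ident)
    moreover have "(\<lambda>h. (fst h, Fa p * fst h + Fb p * snd h)) = blinfun_apply (H' p)"
      by (auto simp: H')
    ultimately show ?thesis by simp
  qed
  have contH: "continuous_on U H'"
    unfolding H'_def by (intro continuous_intros cont)
  define al where "al = Fa (a0, b0)"
  define be where "be = Fb (a0, b0)"
  define iv where "iv = bl1 + (bl2 o\<^sub>L ((blinfun_mult_right (- al / be) o\<^sub>L fst_blinfun)
      + (blinfun_mult_right (1 / be) o\<^sub>L snd_blinfun)))"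
  have iv: "iv o\<^sub>L H' (a0, b0) = id_blinfun"
    using nz by (intro blinfun_eqI)
      (auto simp: iv_def H' bl1 bl2 blinfun.add_left blinfun.add_right al_def be_def field_simps)
  obtain U' V g g' where *: "open U'" "U' \<subseteq> U" "(a0, b0) \<in> U'" "open V" "H (a0, b0) \<in> V"
    "homeomorphism U' V H g"
    "\<And>y. y \<in> V \<Longrightarrow> (g has_derivative (g' y)) (at y)"
    "\<And>y. y \<in> V \<Longrightarrow> g' y = inv (blinfun_apply (H' (g y)))"
    "\<And>y. y \<in> V \<Longrightarrow> bij (blinfun_apply (H' (g y)))"
    using inverse_function_theorem[OF U(1) derH contH U(2) iv] by blast
  have "a0 \<in> (\<lambda>a. (a, 0)) -` V" using *(5) zero by (simp add: H_def)
  moreover have "open ((\<lambda>a. (a, 0 :: complex)) -` V)"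
    by (intro open_vimage *(4) continuous_intros)
  ultimately obtain r where r: "r > 0" "ball a0 r \<subseteq> (\<lambda>a. (a, 0)) -` V"
    unfolding open_contains_ball by blast
  define k where "k = (\<lambda>a. snd (g (a, 0)))"
  have gV: "g y \<in> U' \<and> H (g y) = y" if "y \<in> V" for y
    using *(6) that by (auto simp: homeomorphism_def)
  have gk: "g (a, 0) = (a, k a)" and Vk: "(a, 0) \<in> V" if "a \<in> ball a0 r" for a
  proof -
    show "(a, 0) \<in> V" using r that by auto
    from gV[OF this] show "g (a, 0) = (a, k a)"
      by (cases "g (a, 0)") (auto simp: H_def k_def)
  qed
  have k1: "(a, k a) \<in> U' \<and> F (a, k a) = 0" if "a \<in> ball a0 r" for a
    using gV[OF Vk[OF that]] gk[OF that] by (simp add: H_def)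
  have uniq: "b = k a" if "(a, b) \<in> U'" "a \<in> ball a0 r" "F (a, b) = 0" for a b
  proof -
    have "g (H (a, b)) = (a, b)" using *(6) that by (auto simp: homeomorphism_def)
    thus ?thesis using that gk[of a] by (simp add: H_def)
  qed
  have "k a0 = b0" using uniq[of a0 b0] *(3) zero r by simp
  moreover have "Fb (a, k a) \<noteq> 0 \<and> (k has_field_derivative - Fa (a, k a) / Fb (a, k a)) (at a)"
    if a: "a \<in> ball a0 r" for a
  proof
    have bij: "bij (blinfun_apply (H' (a, k a)))"
      using *(9)[OF Vk[OF a]] gk[OF a] by simp
    show nz: "Fb (a, k a) \<noteq> 0"
    proof
      assume "Fb (a, k a) = 0"
      hence "blinfun_apply (H' (a, k a)) (0, 1) = blinfun_apply (H' (a, k a)) (0, 0)" by (simp add: H')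
      with bij show False by (metis bij_pointE prod.inject zero_neq_one)
    qed
    have inv: "blinfun_apply (H' (a, k a)) (g' (a, 0) h) = h" for h
      using *(8)[OF Vk[OF a]] gk[OF a] bij by (simp add: bij_is_surj surj_f_inv_f)
    have "(k has_derivative (\<lambda>h. snd (g' (a, 0) (h, 0)))) (at a)"
      unfolding k_def
      apply (rule has_derivative_snd)
      apply (rule has_derivative_compose[of "\<lambda>a. (a, 0)" "\<lambda>h. (h, 0)", where g = g])
      apply (auto intro!: derivative_eq_intros *(7)[OF Vk[OF a]])
      done
    \<comment> \<open>The inverse function theorem provides only a real derivative. Solving the
      triangular system shows that it is multiplication by a complex number, which is complex
      differentiability.\<close>
    moreover have "(\<lambda>h. snd (g' (a, 0) (h, 0))) = (\<lambda>h. (- Fa (a, k a) / Fb (a, k a)) * h)"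
    proof
      fix h show "snd (g' (a, 0) (h, 0)) = (- Fa (a, k a) / Fb (a, k a)) * h"
        using inv[of "(h, 0)"] nz by (auto simp: H' field_simps eq_neg_iff_add_eq_0)
    qed
    ultimately show "(k has_field_derivative - Fa (a, k a) / Fb (a, k a)) (at a)"
      unfolding has_field_derivative_def by metis
  qed
  ultimately show ?thesis
    using that[of U' r k] * r k1 uniq by blast
qed

text \<open>Both difference quotients at \<open>z0\<close> have removable singularities, and that of
  \<open>t\<close> is nonzero near \<open>z0\<close> because the zero is simple; \<open>g\<close> is
  their quotient. Iteration expands \<open>f\<close> in powers of \<open>t\<close> with a
  holomorphic rest.\<close>

lemma holomorphic_peel:
  assumes f: "f holomorphic_on ball z0 e" and t: "t holomorphic_on ball z0 e"
    and e: "e > 0" and t0: "t z0 = 0" "deriv t z0 \<noteq> 0"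
  obtains e' g where "0 < e'" "e' \<le> e" "g holomorphic_on ball z0 e'"
    "\<And>z. z \<in> ball z0 e' \<Longrightarrow> f z = f z0 + t z * g z"
proof -
  define v where "v = (\<lambda>z. if z = z0 then deriv f z0 else (f z - f z0) / (z - z0))"
  define u where "u = (\<lambda>z. if z = z0 then deriv t z0 else (t z - t z0) / (z - z0))"
  have "z0 \<in> interior (ball z0 e)" using e by simp
  then have hol: "v holomorphic_on ball z0 e" "u holomorphic_on ball z0 e"
    unfolding v_def u_def by (auto intro!: pole_lemma f t simp del: interior_open)
  have "continuous_on (ball z0 e) u" using hol holomorphic_on_imp_continuous_on by blast
  then obtain e1 where e1: "e1 > 0" "\<And>z. z \<in> ball z0 e \<Longrightarrow> dist z z0 < e1 \<Longrightarrow> dist (u z) (u z0) < norm (deriv t z0)"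
    using e t0 unfolding continuous_on_iff by (metis centre_in_ball zero_less_norm_iff)
  define e' where "e' = min e e1"
  have nz: "u z \<noteq> 0" if "z \<in> ball z0 e'" for z
    using e1(2)[of z] that by (auto simp: e'_def u_def dist_commute dist_norm)
  have "(\<lambda>z. v z / u z) holomorphic_on ball z0 e'"
    using hol nz by (intro holomorphic_on_divide) (auto simp: e'_def intro: holomorphic_on_subset)
  moreover have "f z = f z0 + t z * (v z / u z)" if "z \<in> ball z0 e'" for z
  proof (cases "z = z0")
    case False
    have "f z - f z0 = (z - z0) * v z" "t z = (z - z0) * u z"
      using False t0 by (auto simp: v_def u_def)
    then have "t z * (v z / u z) = f z - f z0" using nz[OF that] by simp
    then show ?thesis by simp
  qed (use t0 in simp)
  moreover have "0 < e'" "e' \<le> e" using e e1(1) by (auto simp: e'_def)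
  ultimately show ?thesis using that[of e' "\<lambda>z. v z / u z"] by blast
qed

lemma sums_even_odd:
  fixes f :: "nat \<Rightarrow> complex"
  assumes "f sums s" "summable (\<lambda>n. norm (f n))"
  shows "\<exists>a b. (\<lambda>n. f (2 * n)) sums a \<and> (\<lambda>n. f (2 * n + 1)) sums b \<and> s = a + b"
proof -
  have 1: "summable (\<lambda>n. norm (f (2 * n)))"
  proof -
    have "summable ((\<lambda>n. norm (f n)) \<circ> (\<lambda>n. 2 * n))"
      by (rule summable_reindex[OF assms(2)]) (auto intro: injI)
    then show ?thesis by (simp add: o_def)
  qed
  have 2: "summable (\<lambda>n. norm (f (2 * n + 1)))"
  proof -
    have "summable ((\<lambda>n. norm (f n)) \<circ> (\<lambda>n. 2 * n + 1))"
      by (rule summable_reindex[OF assms(2)]) (auto intro: injI)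
    then show ?thesis by (simp add: o_def)
  qed
  define a where "a = (\<Sum>n. f (2 * n))"
  define b where "b = (\<Sum>n. f (2 * n + 1))"
  have ab: "(\<lambda>n. f (2 * n)) sums a" "(\<lambda>n. f (2 * n + 1)) sums b"
    unfolding a_def b_def by (intro summable_sums summable_norm_cancel[OF 1] summable_norm_cancel[OF 2])+
  have "(\<lambda>n. sum f {n * 2..<n * 2 + 2}) sums s"
    by (rule sums_group[OF assms(1)]) simp
  moreover have "sum f {n * 2..<n * 2 + 2} = f (2 * n) + f (2 * n + 1)" for n
  proof -
    have "{n * 2..<n * 2 + 2} = {2 * n, 2 * n + 1}" by auto
    then show ?thesis by simp
  qed
  ultimately have "(\<lambda>n. f (2 * n) + f (2 * n + 1)) sums s" by simp
  then have "s = a + b" using sums_unique2 sums_add[OF ab] by blast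
  with ab show ?thesis by blast
qed

text \<open>Even and odd powers are collected as functions of \<open>s^2\<close>. With
  \<open>s\<close> a square root of \<open>u\<close> this separates the analytic part of
  \<open>Y\<close> from the part that carries the singularity.\<close>

lemma holomorphic_even_odd_parts:
  assumes "f holomorphic_on ball 0 e" "e > 0"
  obtains E Od where "E holomorphic_on ball 0 (e\<^sup>2)" "Od holomorphic_on ball 0 (e\<^sup>2)"
    "\<And>s. s \<in> ball 0 e \<Longrightarrow> f s = E (s\<^sup>2) + s * Od (s\<^sup>2)" "Od 0 = deriv f 0"
proof -
  define c where "c = (\<lambda>n. (deriv ^^ n) f 0 / fact n)"
  have sums: "(\<lambda>n. c n * s ^ n) sums f s" if "s \<in> ball 0 e" for s
    using holomorphic_power_series[OF assms(1) that] by (simp add: c_def)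
  have abs: "summable (\<lambda>n. norm (c n * s ^ n))" if s: "s \<in> ball 0 e" for s
  proof -
    define s' where "s' = complex_of_real ((norm s + e) / 2)"
    have "norm s' = (norm s + e) / 2" unfolding s'_def norm_of_real using assms(2) by simp
    then have "norm s < norm s'" "s' \<in> ball 0 e" using s by auto
    then show ?thesis
      using powser_insidea[OF sums_summable[OF sums[of s']], of s] by simp
  qed
  define E where "E = (\<lambda>t. \<Sum>n. c (2 * n) * t ^ n)"
  define Od where "Od = (\<lambda>t. \<Sum>n. c (2 * n + 1) * t ^ n)"
  have main: "(\<lambda>n. c (2 * n) * t ^ n) sums E t \<and> (\<lambda>n. c (2 * n + 1) * t ^ n) sums Od t \<and>
      f s = E t + s * Od t" if s: "s \<in> ball 0 e" "t = s\<^sup>2" for s t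
  proof -
    obtain a b where ab: "(\<lambda>n. c (2 * n) * s ^ (2 * n)) sums a"
        "(\<lambda>n. c (2 * n + 1) * s ^ (2 * n + 1)) sums b" "f s = a + b"
      using sums_even_odd[OF sums[OF s(1)] abs[OF s(1)]] by blast
    have 1: "(\<lambda>n. c (2 * n) * t ^ n) sums a" using ab(1) by (simp add: s(2) power_mult)
    then have E: "E t = a" "(\<lambda>n. c (2 * n) * t ^ n) sums E t" by (auto simp: E_def sums_iff)
    show ?thesis
    proof (cases "s = 0")
      case True
      have "(\<lambda>n. c (2 * n + 1) * 0 ^ n) sums c (2 * 0 + 1)"
        using powser_sums_zero[of "\<lambda>n. c (2 * n + 1)"] by simp
      then have "(\<lambda>n. c (2 * n + 1) * t ^ n) sums Od t" by (auto simp: Od_def sums_iff True s(2))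
      moreover have "(\<lambda>n. c (2 * n + 1) * s ^ (2 * n + 1)) = (\<lambda>_. 0)" using True by auto
      then have "b = 0" using ab(2) sums_unique2 sums_zero by metis
      ultimately show ?thesis using E ab True by simp
    next
      case False
      have "(\<lambda>n. c (2 * n + 1) * s ^ (2 * n + 1) / s) sums (b / s)" by (intro sums_divide ab)
      then have "(\<lambda>n. c (2 * n + 1) * t ^ n) sums (b / s)" using False by (simp add: s(2) power_mult)
      then have "Od t = b / s" "(\<lambda>n. c (2 * n + 1) * t ^ n) sums Od t" by (auto simp: Od_def sums_iff)
      then show ?thesis using E ab False by simp
    qed
  qed
  \<comment> \<open>Every point of \<open>ball 0 (e\<^sup>2)\<close> is the square of a point of
    \<open>ball 0 e\<close>, so both series converge there by the expansion of
    \<open>f\<close>.\<close>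
  have csq: "csqrt t \<in> ball 0 e \<and> t = (csqrt t)\<^sup>2" if "t \<in> ball 0 (e\<^sup>2)" for t
  proof -
    have "(norm (csqrt t))\<^sup>2 = norm t" by (simp flip: norm_power)
    then have "(norm (csqrt t))\<^sup>2 < e\<^sup>2" using that by (simp only: mem_ball dist_0_norm)
    then have "norm (csqrt t) < e" by (rule power_less_imp_less_base) (use assms(2) in linarith)
    then show ?thesis by (simp only: mem_ball dist_0_norm power2_csqrt simp_thms)
  qed
  have "E holomorphic_on ball 0 (e\<^sup>2)"
    by (rule power_series_holomorphic[of 0 _ "\<lambda>n. c (2 * n)"]) (use main[OF conjunct1[OF csq] conjunct2[OF csq]] in simp)
  moreover have "Od holomorphic_on ball 0 (e\<^sup>2)"
    by (rule power_series_holomorphic[of 0 _ "\<lambda>n. c (2 * n + 1)"]) (use main[OF conjunct1[OF csq] conjunct2[OF csq]] in simp)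
  moreover have "Od 0 = c (2 * 0 + 1)" unfolding Od_def by (rule powser_zero)
  then have "Od 0 = deriv f 0" by (simp add: c_def)
  moreover have "f s = E (s\<^sup>2) + s * Od (s\<^sup>2)" if "s \<in> ball 0 e" for s
    using main[OF that refl] by simp
  ultimately show ?thesis using that by simp
qed

text \<open>Each derivative lowers the exponent by one and leaves a cofactor that is holomorphic on
  all of \<open>B\<close>, beyond the set \<open>D\<close> on which the power is differentiated. At
  boundary points of \<open>D\<close> inside \<open>B\<close> only the power can become
  unbounded.\<close>

lemma higher_deriv_powr_mult:
  assumes D: "open D" "D \<subseteq> B" and B: "open B" and u: "u holomorphic_on B" and v: "v holomorphic_on B"
    and pos: "\<And>z. z \<in> D \<Longrightarrow> Re (u z) > 0"
  shows "\<exists>vn. vn holomorphic_on B \<and> (\<forall>z\<in>D. (deriv ^^ n) (\<lambda>z. u z powr a * v z) z = u z powr (a - of_nat n) * vn z)"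
proof (induction n)
  case 0
  then show ?case using v by (intro exI[of _ v]) auto
next
  case (Suc n)
  then obtain vn where vn: "vn holomorphic_on B"
    "\<And>z. z \<in> D \<Longrightarrow> (deriv ^^ n) (\<lambda>z. u z powr a * v z) z = u z powr (a - of_nat n) * vn z" by blast
  define b where "b = a - of_nat n"
  define v' where "v' = (\<lambda>z. b * deriv u z * vn z + u z * deriv vn z)"
  have "v' holomorphic_on B" unfolding v'_def using B u vn by (intro holomorphic_intros)
  moreover have "(deriv ^^ Suc n) (\<lambda>z. u z powr a * v z) z = u z powr (a - of_nat (Suc n)) * v' z"
    if z: "z \<in> D" for z
  proof -
    have "(deriv ^^ Suc n) (\<lambda>z. u z powr a * v z) z = deriv ((deriv ^^ n) (\<lambda>z. u z powr a * v z)) z"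
      by simp
    also have "\<dots> = deriv (\<lambda>z. u z powr b * vn z) z"
      by (rule deriv_cong_ev) (use D z vn in \<open>auto simp: eventually_nhds b_def intro!: exI[of _ D]\<close>)
    also have "\<dots> = u z powr (b - 1) * v' z"
    proof (rule DERIV_imp_deriv)
      have zB: "z \<in> B" using z D by auto
      have du: "(u has_field_derivative deriv u z) (at z)" and dv: "(vn has_field_derivative deriv vn z) (at z)"
        using u vn(1) B zB holomorphic_derivI by blast+
      have nonpos: "u z \<notin> \<real>\<^sub>\<le>\<^sub>0" using pos[OF z] by (auto elim!: nonpos_Reals_cases)
      have "((\<lambda>z. u z powr b) has_field_derivative (b * u z powr (b - 1)) * deriv u z) (at z)"
        using DERIV_chain2[OF has_field_derivative_powr[OF nonpos] du] .
      from DERIV_mult[OF this dv]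
      have "((\<lambda>z. u z powr b * vn z) has_field_derivative
           (b * u z powr (b - 1)) * deriv u z * vn z + deriv vn z * u z powr b) (at z)" .
      moreover have "u z powr b = u z powr (b - 1) * u z"
        using powr_add[of "u z" "b - 1" 1] by simp
      ultimately show "((\<lambda>z. u z powr b * vn z) has_field_derivative u z powr (b - 1) * v' z) (at z)"
        by (simp add: v'_def algebra_simps)
    qed
    finally show ?thesis by (simp add: b_def diff_diff_eq add.commute)
  qed
  ultimately show ?case by blast
qed

lemma bounded_on_compact_cover:
  fixes f :: "complex \<Rightarrow> complex"
  assumes K: "compact K" and "S \<subseteq> K"
    and loc: "\<And>z0. z0 \<in> K \<Longrightarrow> \<exists>e>0. \<exists>C. \<forall>z\<in>ball z0 e \<inter> S. norm (f z) \<le> C"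
  shows "\<exists>C\<ge>0. \<forall>z\<in>S. norm (f z) \<le> C"
proof -
  from loc obtain e C where eC: "\<And>z0. z0 \<in> K \<Longrightarrow> e z0 > 0"
    "\<And>z0 z. z0 \<in> K \<Longrightarrow> z \<in> ball z0 (e z0) \<inter> S \<Longrightarrow> norm (f z) \<le> C z0" by metis
  have "K \<subseteq> (\<Union>z0\<in>K. ball z0 (e z0))" using eC(1) by force
  then obtain N where N: "N \<subseteq> K" "finite N" "K \<subseteq> (\<Union>z0\<in>N. ball z0 (e z0))"
    using compactE_image[OF K, of K "\<lambda>z0. ball z0 (e z0)"] by auto
  have "norm (f z) \<le> (\<Sum>z0\<in>N. \<bar>C z0\<bar>)" if z: "z \<in> S" for z
  proof -
    obtain z0 where "z0 \<in> N" "z \<in> ball z0 (e z0)" using z N assms(2) by blast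
    then have "norm (f z) \<le> \<bar>C z0\<bar>" using eC(2)[of z0 z] z N by force
    also have "\<dots> \<le> (\<Sum>z0\<in>N. \<bar>C z0\<bar>)" using N \<open>z0 \<in> N\<close> by (intro member_le_sum) auto
    finally show ?thesis .
  qed
  then show ?thesis by (intro exI[of _ "\<Sum>z0\<in>N. \<bar>C z0\<bar>"]) (auto intro: sum_nonneg)
qed

text \<open>The third derivative has the coefficients \<open>n (n-1) (n-2) c n\<close>, so Cauchy's
  inequality gives the order \<open>n^-3\<close>. It is applied on radii \<open>r < \<rho>\<close>,
  where the derivative is continuous up to the circle; then \<open>r\<close> tends to
  \<open>\<rho>\<close>.\<close>

lemma powser_coeff_bound:
  fixes h :: "complex \<Rightarrow> complex"
  assumes \<rho>: "\<rho> > 0" and sums: "\<And>z. z \<in> ball 0 \<rho> \<Longrightarrow> (\<lambda>n. c n * z ^ n) sums h z"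
    and bnd: "\<And>z. z \<in> ball 0 \<rho> \<Longrightarrow> norm ((deriv ^^ 3) h z) \<le> C" and n: "n \<ge> 3"
  shows "norm (c n) * \<rho> ^ n \<le> C * \<rho> ^ 3 * 5 / real n ^ 3"
proof -
  have hol: "h holomorphic_on ball 0 \<rho>"
    by (rule power_series_holomorphic[of 0 _ c]) (use sums in auto)
  have "h has_fps_expansion Abs_fps c"
    by (rule has_fps_expansionI)
      (use \<rho> sums in \<open>auto simp: eventually_nhds intro!: exI[of _ "ball 0 \<rho>"]\<close>)
  then have c: "c n = (deriv ^^ n) h 0 / fact n" for n
    using fps_nth_fps_expansion by fastforce
  have C: "C \<ge> 0" by (rule order_trans[OF norm_ge_zero bnd[of 0]]) (use \<rho> in simp)
  obtain k where k: "n = k + 3" using n by (metis add.commute le_Suc_ex)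
  have *: "norm (c n) * r ^ n \<le> C * \<rho> ^ 3 * 5 / real n ^ 3" if r: "0 < r" "r < \<rho>" for r
  proof -
    have hol3: "(deriv ^^ 3) h holomorphic_on ball 0 \<rho>"
      using hol by (intro holomorphic_higher_deriv) auto
    have "norm ((deriv ^^ k) ((deriv ^^ 3) h) 0) \<le> fact k * C / r ^ k"
    proof (rule Cauchy_inequality)
      show "(deriv ^^ 3) h holomorphic_on ball 0 r" using hol3 r by (auto intro: holomorphic_on_subset)
      show "continuous_on (cball 0 r) ((deriv ^^ 3) h)"
        using hol3 r by (intro holomorphic_on_imp_continuous_on) (auto intro: holomorphic_on_subset)
    qed (use r bnd in auto)
    also have "(deriv ^^ k) ((deriv ^^ 3) h) = (deriv ^^ n) h"
      unfolding k funpow_add by simp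
    finally have "norm ((deriv ^^ n) h 0) / fact n \<le> fact k * C / r ^ k / fact n"
      by (rule divide_right_mono) simp
    then have "norm (c n) \<le> fact k * C / r ^ k / fact n"
      by (simp only: c norm_divide norm_fact)
    also have "(fact n :: real) = fact k * (real n * (real n - 1) * (real n - 2))"
      unfolding k by (simp add: fact_reduce numeral_3_eq_3 algebra_simps)
    finally have "norm (c n) \<le> C / (r ^ k * (real n * (real n - 1) * (real n - 2)))" by (simp add: mult_ac)
    then have "norm (c n) * r ^ n \<le> C / (r ^ k * (real n * (real n - 1) * (real n - 2))) * r ^ n"
      using r by (intro mult_right_mono) auto
    also have "\<dots> = C * r ^ 3 / (real n * (real n - 1) * (real n - 2))"
      using r by (simp add: k power_add)
    also have "\<dots> \<le> C * \<rho> ^ 3 / (real n * (real n - 1) * (real n - 2))"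
      using r C n by (intro divide_right_mono mult_left_mono power_mono mult_nonneg_nonneg) auto
    also have "\<dots> \<le> C * \<rho> ^ 3 / (real n ^ 3 / 5)"
    proof (intro divide_left_mono)
      \<comment> \<open>The worst case is \<open>n = 3\<close>, where
        \<open>n^3 / (n (n-1) (n-2))\<close> equals 4.5; this is the origin of the constant
        5.\<close>
      have "real n * real n \<le> 5 * ((real n - 1) * (real n - 2))"
      proof -
        have "0 \<le> (4 * real n - 3) * (real n - 3)" using n by simp
        then show ?thesis by (simp add: algebra_simps)
      qed
      then have "real n * (real n * real n) \<le> real n * (5 * ((real n - 1) * (real n - 2)))"
        by (intro mult_left_mono) auto
      then show "real n ^ 3 / 5 \<le> real n * (real n - 1) * (real n - 2)"
        by (simp add: power3_eq_cube)
    qed (use C \<rho> n in auto)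
    finally show ?thesis by simp
  qed
  have "((\<lambda>r. norm (c n) * r ^ n) \<longlongrightarrow> norm (c n) * \<rho> ^ n) (at_left \<rho>)"
    by (intro tendsto_intros)
  moreover have "eventually (\<lambda>r. norm (c n) * r ^ n \<le> C * \<rho> ^ 3 * 5 / real n ^ 3) (at_left \<rho>)"
    using eventually_at_left_real[OF \<rho>] by eventually_elim (use * in auto)
  ultimately show ?thesis by (rule tendsto_upperbound) auto
qed

text \<open>A double zero is the square of a function \<open>q\<close> with a simple zero, and
  \<open>q\<close> is locally invertible with inverse \<open>\<Psi>\<close>. Thus a solution
  \<open>y\<close> near \<open>c\<close> of \<open>T y = v\<close> has the form
  \<open>\<Psi> s\<close> with \<open>s^2 = v\<close>.\<close>

lemma factor_double_zero:
  assumes "T holomorphic_on ball c r" "r > 0" "T c = 0" "deriv T c = 0" "deriv (deriv T) c \<noteq> 0"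
  obtains e \<Psi> r' where "e > 0" "0 < r'" "r' \<le> r" "\<Psi> holomorphic_on ball 0 e" "deriv \<Psi> 0 \<noteq> 0"
    "\<exists>q. continuous_on (ball c r') q \<and> (\<forall>y\<in>ball c r'. (q y)\<^sup>2 = T y \<and> \<Psi> (q y) = y)"
proof -
  obtain g r1 where g: "0 < r1" "g holomorphic_on ball c r1"
    "\<And>w. w \<in> ball c r1 \<Longrightarrow> T w - T c = ((w - c) * g w) ^ 2" "\<And>w. w \<in> ball c r1 \<Longrightarrow> g w \<noteq> 0"
  proof (rule holomorphic_factor_order_of_zero_strong[of T "ball c r" c 2])
    show "(deriv ^^ 2) T c \<noteq> 0" using assms by (simp add: numeral_2_eq_2)
    show "(deriv ^^ i) T c = 0" if "0 < i" "i < 2" for i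
    proof -
      have "i = 1" using that by simp
      then show ?thesis using assms by simp
    qed
  qed (use assms in auto)
  define r2 where "r2 = min r r1"
  define q where "q = (\<lambda>y. (y - c) * g y)"
  have r2: "r2 > 0" using assms g by (simp add: r2_def)
  have holg: "g holomorphic_on ball c r2" by (rule holomorphic_on_subset[OF g(2)]) (auto simp: r2_def)
  have holq: "q holomorphic_on ball c r2" unfolding q_def by (intro holomorphic_intros holg)
  have "(g has_field_derivative deriv g c) (at c)"
    using holg r2 by (intro holomorphic_derivI) auto
  then have "(q has_field_derivative g c) (at c)"
    unfolding q_def by (auto intro!: derivative_eq_intros)
  then have dq: "deriv q c \<noteq> 0" using g(4)[of c] g(1) by (simp add: DERIV_imp_deriv)
  obtain r3 where r3: "r3 > 0" "ball c r3 \<subseteq> ball c r2" "inj_on q (ball c r3)"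
    by (rule has_complex_derivative_locally_injective[OF holq _ _ dq]) (use r2 in auto)
  have holq3: "q holomorphic_on ball c r3" using holq r3(2) by (rule holomorphic_on_subset)
  obtain \<Psi> where \<Psi>: "\<Psi> holomorphic_on (q ` ball c r3)"
    "\<And>z. z \<in> ball c r3 \<Longrightarrow> deriv q z * deriv \<Psi> (q z) = 1" "\<And>z. z \<in> ball c r3 \<Longrightarrow> \<Psi> (q z) = z"
    by (rule holomorphic_has_inverse[OF holq3 _ r3(3)]) auto
  have "open (q ` ball c r3)" by (rule open_mapping_thm3[OF holq3 _ r3(3)]) auto
  moreover have "0 \<in> q ` ball c r3" using r3(1) by (auto simp: q_def intro!: image_eqI[of _ _ c])
  ultimately obtain e where e: "e > 0" "ball 0 e \<subseteq> q ` ball c r3" using open_contains_ball by blast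
  have q2: "(q y)\<^sup>2 = T y" if "y \<in> ball c r3" for y
  proof -
    have "y \<in> ball c r1" using that r3(2) by (auto simp: r2_def)
    from g(3)[OF this] show ?thesis using assms by (simp add: q_def)
  qed
  have hol: "\<Psi> holomorphic_on ball 0 e" using \<Psi>(1) e(2) by (rule holomorphic_on_subset)
  have "q c = 0" by (simp add: q_def)
  then have d\<Psi>: "deriv \<Psi> 0 \<noteq> 0" using \<Psi>(2)[of c] r3(1) by auto
  have "min r3 r \<le> r" "0 < min r3 r" using r3 assms by auto
  moreover have "continuous_on (ball c (min r3 r)) q \<and> (\<forall>y\<in>ball c (min r3 r). (q y)\<^sup>2 = T y \<and> \<Psi> (q y) = y)"
    using q2 \<Psi>(3) holomorphic_on_imp_continuous_on[OF holq3] by (auto intro: continuous_on_subset)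
  ultimately show ?thesis using that[OF e(1) _ _ hol d\<Psi>, of "min r3 r"] by blast
qed

text \<open>Local hypotheses of a square root singularity for \<open>y = G(z) + z Phi(y)\<close>:
  \<open>crit\<close> kills the partial derivative in \<open>y\<close> at the critical point,
  \<open>phi2\<close> makes the degeneration quadratic, and \<open>N\<close> keeps the partial
  derivative in \<open>z\<close> away from 0. \<open>reg\<close> excludes critical points on the
  circle other than the rotations of \<open>\<rho>\<close>, and \<open>supp\<close> reduces these to
  \<open>\<rho>\<close>.\<close>

locale sqrt_schema =
  fixes G Phi Y :: "complex \<Rightarrow> complex" and \<rho> \<tau> rG rP :: real and d :: nat and a :: "nat \<Rightarrow> complex"
  assumes \<rho>: "0 < \<rho>" "\<rho> < rG" and \<tau>: "0 < \<tau>" "\<tau> < rP" and d: "d > 0"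
    and holG: "G holomorphic_on ball 0 rG" and holP: "Phi holomorphic_on ball 0 rP"
    and contY: "continuous_on (cball 0 \<rho>) Y" and Y_le: "\<And>z. z \<in> cball 0 \<rho> \<Longrightarrow> norm (Y z) \<le> \<tau>"
    and Y_eq: "\<And>z. z \<in> cball 0 \<rho> \<Longrightarrow> Y z = G z + z * Phi (Y z)"
    and Y_\<rho>: "Y (of_real \<rho>) = of_real \<tau>"
    and crit: "of_real \<rho> * deriv Phi (of_real \<tau>) = 1"
    and phi2: "deriv (deriv Phi) (of_real \<tau>) \<noteq> 0"
    and N: "deriv G (of_real \<rho>) + Phi (of_real \<tau>) \<noteq> 0"
    and reg: "\<And>z. norm z = \<rho> \<Longrightarrow> z ^ d \<noteq> of_real \<rho> ^ d \<Longrightarrow> z * deriv Phi (Y z) \<noteq> 1"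
    and sums: "\<And>z. z \<in> ball 0 \<rho> \<Longrightarrow> (\<lambda>n. a n * z ^ n) sums Y z"
    and supp: "\<And>n. a n \<noteq> 0 \<Longrightarrow> n mod d = 1 mod d"
begin

abbreviation "r0 \<equiv> complex_of_real \<rho>"
abbreviation "t0 \<equiv> complex_of_real \<tau>"

text \<open>A local coordinate common to all rotations of \<open>\<rho>\<close>: it has a simple
  zero at each of them and positive real part inside the disc, where the principal square root is
  therefore holomorphic.\<close>

definition u :: "complex \<Rightarrow> complex" where "u z = 1 - (z / r0) ^ d"

lemma r0_nz: "r0 \<noteq> 0" using \<rho> by simp

lemma hol_u: "u holomorphic_on A"
  unfolding u_def using r0_nz by (intro holomorphic_intros) auto

lemma u_r0: "u r0 = 0" using r0_nz by (simp add: u_def)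

lemma Re_u_pos: "z \<in> ball 0 \<rho> \<Longrightarrow> Re (u z) > 0"
proof -
  assume z: "z \<in> ball 0 \<rho>"
  have "norm ((z / r0) ^ d) < 1"
    unfolding norm_power using z \<rho> d by (intro power_Suc_less_one[of _ "d - 1", simplified] power_less_one_iff[THEN iffD2]) (auto simp: norm_divide)
  then have "Re ((z / r0) ^ d) < 1" using complex_Re_le_cmod le_less_trans by blast
  then show ?thesis by (simp add: u_def)
qed

lemma hol_Y: "Y holomorphic_on ball 0 \<rho>"
  by (rule power_series_holomorphic[of 0 _ a]) (use sums in auto)

lemma F_has_derivative:
  assumes "fst p \<in> ball 0 rP" "snd p \<in> ball 0 rG"
  shows "((\<lambda>p. G (snd p) + snd p * Phi (fst p) - fst p) has_derivative
     (\<lambda>h. (snd p * deriv Phi (fst p) - 1) * fst h + (deriv G (snd p) + Phi (fst p)) * snd h)) (at p)"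
proof -
  have "(G has_derivative (*) (deriv G (snd p))) (at (snd p))"
    using holG assms holomorphic_derivI[of G "ball 0 rG" "snd p"] by (auto simp: has_field_derivative_def)
  from has_derivative_compose[OF has_derivative_snd[OF has_derivative_ident] this]
  have 1: "((\<lambda>p. G (snd p)) has_derivative (\<lambda>h. deriv G (snd p) * snd h)) (at p)" .
  have "(Phi has_derivative (*) (deriv Phi (fst p))) (at (fst p))"
    using holP assms holomorphic_derivI[of Phi "ball 0 rP" "fst p"] by (auto simp: has_field_derivative_def)
  from has_derivative_compose[OF has_derivative_fst[OF has_derivative_ident] this]
  have 2: "((\<lambda>p. Phi (fst p)) has_derivative (\<lambda>h. deriv Phi (fst p) * fst h)) (at p)" .
  have "((\<lambda>p. G (snd p) + snd p * Phi (fst p) - fst p) has_derivative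
     (\<lambda>h. deriv G (snd p) * snd h + (snd p * (deriv Phi (fst p) * fst h) + snd h * Phi (fst p)) - fst h)) (at p)"
    by (intro has_derivative_diff has_derivative_add has_derivative_mult 1 2
        has_derivative_fst has_derivative_snd has_derivative_ident)
  then show ?thesis
    by (rule has_derivative_eq_rhs) (auto simp: algebra_simps)
qed

lemma continuous_partials:
  "continuous_on (ball 0 rP \<times> ball 0 rG) (\<lambda>p. snd p * deriv Phi (fst p) - 1)"
  "continuous_on (ball 0 rP \<times> ball 0 rG) (\<lambda>p. deriv G (snd p) + Phi (fst p))"
proof -
  have c: "continuous_on (ball 0 rP) Phi" "continuous_on (ball 0 rP) (deriv Phi)" "continuous_on (ball 0 rG) (deriv G)"
    using holP holG by (auto intro!: holomorphic_on_imp_continuous_on holomorphic_deriv)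
  show "continuous_on (ball 0 rP \<times> ball 0 rG) (\<lambda>p. snd p * deriv Phi (fst p) - 1)"
    by (intro continuous_intros continuous_on_compose2[OF c(2)]) auto
  show "continuous_on (ball 0 rP \<times> ball 0 rG) (\<lambda>p. deriv G (snd p) + Phi (fst p))"
    by (intro continuous_intros continuous_on_compose2[OF c(3)] continuous_on_compose2[OF c(1)]) auto
qed

lemma r0_in: "r0 \<in> cball 0 \<rho>" "r0 \<in> ball 0 rG" and t0_in: "t0 \<in> ball 0 rP"
  using \<rho> \<tau> by auto

text \<open>\<open>N\<close> lets the equation be solved for \<open>z = \<zeta> y\<close>, and
  \<open>Y z\<close> becomes \<open>\<Psi>\<close> of a root of \<open>u z\<close>. What remains is
  one choice of the root on the whole region; the sign is constant by connectedness and is absorbed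
  into \<open>\<Psi>\<close>.\<close>

lemma singular_expansion:
  obtains e \<Psi> \<epsilon> where "e > 0" "\<Psi> holomorphic_on ball 0 e" "deriv \<Psi> 0 \<noteq> 0" "\<epsilon> > 0"
    "\<And>z. z \<in> ball 0 \<rho> \<inter> ball r0 \<epsilon> \<Longrightarrow> norm (csqrt (u z)) < e \<and> Y z = \<Psi> (csqrt (u z))"
proof -
  let ?U = "ball 0 rP \<times> ball 0 rG :: (complex \<times> complex) set"
  obtain W \<zeta> r where W: "open W" "(t0, r0) \<in> W" "W \<subseteq> ?U" "r > 0" "\<zeta> t0 = r0"
    "\<And>y. y \<in> ball t0 r \<Longrightarrow> (y, \<zeta> y) \<in> W \<and> G (\<zeta> y) + \<zeta> y * Phi y - y = 0"
    "\<And>y. y \<in> ball t0 r \<Longrightarrow> deriv G (\<zeta> y) + Phi y \<noteq> 0 \<and>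
       (\<zeta> has_field_derivative - (\<zeta> y * deriv Phi y - 1) / (deriv G (\<zeta> y) + Phi y)) (at y)"
    "\<And>y z. (y, z) \<in> W \<Longrightarrow> y \<in> ball t0 r \<Longrightarrow> G z + z * Phi y - y = 0 \<Longrightarrow> z = \<zeta> y"
    by (rule holomorphic_implicit_function[of ?U t0 r0 "\<lambda>p. G (snd p) + snd p * Phi (fst p) - fst p"
          "\<lambda>p. snd p * deriv Phi (fst p) - 1" "\<lambda>p. deriv G (snd p) + Phi (fst p)"])
       (use r0_in t0_in F_has_derivative continuous_partials N Y_eq[OF r0_in(1)] Y_\<rho> in
         \<open>auto intro!: open_Times\<close>)
  have hol\<zeta>: "\<zeta> holomorphic_on ball t0 r"
    unfolding holomorphic_on_open[OF open_ball] using W(7) by blast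
  have in_U: "y \<in> ball 0 rP \<and> \<zeta> y \<in> ball 0 rG" if "y \<in> ball t0 r" for y
    using W(3) W(6)[OF that] by auto
  define T where "T = (\<lambda>y. u (\<zeta> y))"
  define f where "f = (\<lambda>y. \<zeta> y * deriv Phi y - 1)"
  define q where "q = (\<lambda>y. of_nat d / r0 * (\<zeta> y / r0) ^ (d - 1) / (deriv G (\<zeta> y) + Phi y))"
  have hP: "Phi holomorphic_on ball t0 r" "deriv Phi holomorphic_on ball t0 r"
    using holP in_U by (auto intro!: holomorphic_deriv intro: holomorphic_on_subset)
  have hG: "(\<lambda>y. deriv G (\<zeta> y)) holomorphic_on ball t0 r"
  proof -
    have "deriv G holomorphic_on ball 0 rG" using holG by (rule holomorphic_deriv) auto
    moreover have "\<zeta> ` ball t0 r \<subseteq> ball 0 rG" using in_U by blast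
    ultimately show ?thesis using holomorphic_on_compose_gen[OF hol\<zeta>] by (simp add: o_def)
  qed
  have holf: "f holomorphic_on ball t0 r" unfolding f_def by (intro holomorphic_intros hol\<zeta> hP)
  have holq: "q holomorphic_on ball t0 r"
    unfolding q_def using W(7) r0_nz by (intro holomorphic_intros hol\<zeta> hP hG) auto
  have holT: "T holomorphic_on ball t0 r"
    unfolding T_def u_def using r0_nz by (intro holomorphic_intros hol\<zeta>) auto
  \<comment> \<open>By implicit differentiation the derivative of \<open>\<zeta>\<close> is a
    multiple of \<open>f\<close>, hence so is that of \<open>T\<close>. As \<open>f\<close> vanishes
    at \<open>t0\<close> with derivative \<open>r0 * deriv (deriv Phi) t0\<close>, nonzero by
    \<open>phi2\<close>, the zero of \<open>T\<close> is exactly double.\<close>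
  have dT: "deriv T y = f y * q y" if "y \<in> ball t0 r" for y
  proof (rule DERIV_imp_deriv)
    define M where "M = deriv G (\<zeta> y) + Phi y"
    define D where "D = - f y / M"
    define X where "X = (\<zeta> y / r0) ^ (d - 1)"
    have "(\<zeta> has_field_derivative D) (at y)"
      using conjunct2[OF W(7)[OF that]] by (simp only: D_def M_def f_def)
    then have "((\<lambda>y. 1 - (\<zeta> y / r0) ^ d) has_field_derivative - (of_nat d * (D / r0 * X))) (at y)"
      unfolding X_def using \<rho>(1) by (auto intro!: derivative_eq_intros)
    moreover have "q y = of_nat d / r0 * X / M" by (simp only: q_def X_def M_def)
    then have "- (of_nat d * (D / r0 * X)) = f y * q y" by (simp add: D_def mult_ac)
    ultimately show "(T has_field_derivative f y * q y) (at y)"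
      unfolding T_def u_def by simp
  qed
  have t0r: "t0 \<in> ball t0 r" using W(4) by simp
  have f0: "f t0 = 0" using crit W(5) by (simp add: f_def)
  have \<zeta>': "deriv \<zeta> t0 = 0"
    using conjunct2[OF W(7)[OF t0r]] f0 by (simp add: f_def DERIV_imp_deriv)
  have T'0: "deriv T t0 = 0" using dT[OF t0r] f0 by simp
  have T''0: "deriv (deriv T) t0 \<noteq> 0"
  proof -
    have "deriv (deriv T) t0 = deriv (\<lambda>y. f y * q y) t0"
      by (rule complex_derivative_transform_within_open[of _ "ball t0 r"])
         (use holT holf holq dT t0r in \<open>auto intro!: holomorphic_deriv holomorphic_intros\<close>)
    also have "\<dots> = f t0 * deriv q t0 + deriv f t0 * q t0"
      using holf holq t0r by (intro deriv_mult) (auto simp: holomorphic_on_open field_differentiable_def)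
    also have "\<dots> = deriv f t0 * q t0" using f0 by simp
    also have "deriv f t0 = r0 * deriv (deriv Phi) t0"
    proof (rule DERIV_imp_deriv)
      have "(\<zeta> has_field_derivative 0) (at t0)" using \<zeta>' holomorphic_derivI[OF hol\<zeta> _ t0r] by simp
      moreover have "(deriv Phi has_field_derivative deriv (deriv Phi) t0) (at t0)"
        using holomorphic_derivI[OF hP(2) _ t0r] by simp
      ultimately show "(f has_field_derivative r0 * deriv (deriv Phi) t0) (at t0)"
        unfolding f_def using W(5) by (auto intro!: derivative_eq_intros)
    qed
    finally show ?thesis using phi2 r0_nz d N W(5) by (simp add: q_def)
  qed
  have T0: "T t0 = 0" using W(5) u_r0 by (simp add: T_def)
  obtain e \<Psi> r' where \<Psi>: "e > 0" "0 < r'" "r' \<le> r" "\<Psi> holomorphic_on ball 0 e" "deriv \<Psi> 0 \<noteq> 0"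
    "\<exists>q. continuous_on (ball t0 r') q \<and> (\<forall>y\<in>ball t0 r'. (q y)\<^sup>2 = T y \<and> \<Psi> (q y) = y)"
    using factor_double_zero[OF holT W(4) T0 T'0 T''0] by metis
  obtain p where p: "continuous_on (ball t0 r') p" "\<And>y. y \<in> ball t0 r' \<Longrightarrow> (p y)\<^sup>2 = T y \<and> \<Psi> (p y) = y"
    using \<Psi>(6) by blast
  have near: "\<forall>\<^sub>F z in at r0 within cball 0 \<rho>. (Y z, z) \<in> W \<and> Y z \<in> ball t0 r' \<and> norm (u z) < e\<^sup>2"
  proof (intro eventually_conj)
    have "(Y \<longlongrightarrow> Y r0) (at r0 within cball 0 \<rho>)"
      using contY r0_in(1) unfolding continuous_on_def by blast
    then have lim: "(Y \<longlongrightarrow> t0) (at r0 within cball 0 \<rho>)" by (simp only: Y_\<rho>)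
    have "((\<lambda>z. (Y z, z)) \<longlongrightarrow> (t0, r0)) (at r0 within cball 0 \<rho>)"
      by (intro tendsto_intros lim)
    then show "\<forall>\<^sub>F z in at r0 within cball 0 \<rho>. (Y z, z) \<in> W"
      using W(1,2) by (rule topological_tendstoD)
    show "\<forall>\<^sub>F z in at r0 within cball 0 \<rho>. Y z \<in> ball t0 r'"
      by (rule topological_tendstoD[OF lim]) (use \<Psi>(2) in auto)
    have "continuous_on UNIV u" using hol_u by (rule holomorphic_on_imp_continuous_on)
    then have "(u \<longlongrightarrow> u r0) (at r0)" unfolding continuous_on_def by blast
    then have "(u \<longlongrightarrow> 0) (at r0)" by (simp only: u_r0)
    then have "(u \<longlongrightarrow> 0) (at r0 within cball 0 \<rho>)" by (rule tendsto_within_subset) simp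
    then have "((\<lambda>z. norm (u z)) \<longlongrightarrow> 0) (at r0 within cball 0 \<rho>)" by (rule tendsto_norm_zero)
    moreover have "0 < e\<^sup>2" using \<Psi>(1) by simp
    ultimately show "\<forall>\<^sub>F z in at r0 within cball 0 \<rho>. norm (u z) < e\<^sup>2"
      by (rule order_tendstoD(2))
  qed
  obtain \<epsilon> where \<epsilon>: "\<epsilon> > 0" "\<And>z. z \<in> ball 0 \<rho> \<inter> ball r0 \<epsilon> \<Longrightarrow> (Y z, z) \<in> W \<and> Y z \<in> ball t0 r' \<and> norm (u z) < e\<^sup>2"
  proof -
    from near obtain \<epsilon> where "\<epsilon> > 0" and *: "\<And>z. z \<in> cball 0 \<rho> \<Longrightarrow> z \<noteq> r0 \<Longrightarrow> dist z r0 < \<epsilon> \<Longrightarrow>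
        (Y z, z) \<in> W \<and> Y z \<in> ball t0 r' \<and> norm (u z) < e\<^sup>2"
      unfolding eventually_at by blast
    have "(Y z, z) \<in> W \<and> Y z \<in> ball t0 r' \<and> norm (u z) < e\<^sup>2" if "z \<in> ball 0 \<rho> \<inter> ball r0 \<epsilon>" for z
      by (rule *) (use that \<rho> in \<open>auto simp: dist_commute\<close>)
    with \<open>\<epsilon> > 0\<close> show ?thesis by (rule that)
  qed
  let ?D = "ball 0 \<rho> \<inter> ball r0 \<epsilon>"
  have u_eq: "(p (Y z))\<^sup>2 = u z" "\<Psi> (p (Y z)) = Y z" if z: "z \<in> ?D" for z
  proof -
    have "z = \<zeta> (Y z)"
    proof (rule W(8))
      show "(Y z, z) \<in> W" using \<epsilon>(2)[OF z] by blast
      have "Y z \<in> ball t0 r'" using \<epsilon>(2)[OF z] by blast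
      then show "Y z \<in> ball t0 r" using \<Psi>(3) by (simp only: mem_ball less_le_trans)
      have "Y z = G z + z * Phi (Y z)" using Y_eq[of z] z by simp
      then show "G z + z * Phi (Y z) - Y z = 0" by (simp only: right_minus_eq)
    qed
    then have "T (Y z) = u z" by (simp only: T_def)
    then show "(p (Y z))\<^sup>2 = u z" "\<Psi> (p (Y z)) = Y z" using p(2)[of "Y z"] \<epsilon>(2)[OF z] by simp_all
  qed
  have u_nz: "u z \<noteq> 0" if "z \<in> ?D" for z using Re_u_pos[of z] that by auto
  have p_nz: "p (Y z) \<noteq> 0" if "z \<in> ?D" for z using u_eq(1)[OF that] u_nz[OF that] by auto
  \<comment> \<open>Both roots are continuous and nonzero on the convex region, so their quotient is
    continuous with values in \<open>{1, -1}\<close>, hence constant.\<close>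
  define \<sigma> where "\<sigma> = (\<lambda>z. csqrt (u z) / p (Y z))"
  have \<sigma>: "\<sigma> z = 1 \<or> \<sigma> z = -1" if "z \<in> ?D" for z
  proof -
    have "(csqrt (u z))\<^sup>2 = (p (Y z))\<^sup>2" using u_eq[OF that] by simp
    then have "csqrt (u z) = p (Y z) \<or> csqrt (u z) = - p (Y z)" by (simp only: power2_eq_iff)
    then show ?thesis using p_nz[OF that] by (auto simp: \<sigma>_def)
  qed
  have "\<sigma> constant_on ?D"
  proof (rule continuous_finite_range_constant)
    show "connected ?D" by (intro convex_connected convex_Int) auto
    have "continuous_on ?D (\<lambda>z. csqrt (u z))"
    proof (rule continuous_on_compose2[OF continuous_on_csqrt])
      show "u ` ?D \<subseteq> - \<real>\<^sub>\<le>\<^sub>0" using Re_u_pos by (force elim!: nonpos_Reals_cases)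
    qed (use hol_u holomorphic_on_imp_continuous_on in blast)
    moreover have "continuous_on ?D (\<lambda>z. p (Y z))"
    proof (rule continuous_on_compose2[OF p(1)])
      show "continuous_on ?D Y" using contY by (rule continuous_on_subset) auto
    qed (use \<epsilon>(2) in auto)
    ultimately show "continuous_on ?D \<sigma>"
      unfolding \<sigma>_def by (intro continuous_on_divide ballI p_nz)
    have "\<sigma> ` ?D \<subseteq> {1, -1}" using \<sigma> by blast
    then show "finite (\<sigma> ` ?D)" by (rule finite_subset) simp
  qed
  then obtain c where c: "\<And>z. z \<in> ?D \<Longrightarrow> \<sigma> z = c" by (auto simp: constant_on_def)
  \<comment> \<open>The case distinction yields a sign without showing that the region is
    nonempty.\<close>
  obtain s :: complex where s: "s = 1 \<or> s = -1" "\<And>z. z \<in> ?D \<Longrightarrow> \<sigma> z = s"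
  proof (cases "\<exists>z. z \<in> ?D")
    case True
    then have "c = 1 \<or> c = -1" using c \<sigma> by metis
    then show ?thesis using c by (rule that)
  next
    case False
    then show ?thesis using that[of 1] by blast
  qed
  have ss: "s * s = 1" "norm s = 1" "s \<noteq> 0" using s(1) by auto
  define \<Psi>1 where "\<Psi>1 = (\<lambda>x. \<Psi> (s * x))"
  have "\<Psi>1 holomorphic_on ball 0 e"
    unfolding \<Psi>1_def
    by (rule holomorphic_on_compose_gen[OF _ \<Psi>(4), unfolded o_def])
       (auto intro!: holomorphic_intros simp: norm_mult ss)
  moreover have "deriv \<Psi>1 0 \<noteq> 0"
  proof -
    have "(\<Psi> has_field_derivative deriv \<Psi> 0) (at (s * 0))"
      using holomorphic_derivI[OF \<Psi>(4), of 0] \<Psi>(1) by auto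
    moreover have "((\<lambda>x. s * x) has_field_derivative s) (at 0)"
      by (auto intro!: derivative_eq_intros)
    ultimately have "(\<Psi>1 has_field_derivative deriv \<Psi> 0 * s) (at 0)"
      unfolding \<Psi>1_def by (rule DERIV_chain2)
    then show ?thesis using \<Psi>(5) ss by (simp add: DERIV_imp_deriv)
  qed
  moreover have "norm (csqrt (u z)) < e \<and> Y z = \<Psi>1 (csqrt (u z))" if z: "z \<in> ?D" for z
  proof
    have "norm (csqrt (u z)) < sqrt (e\<^sup>2)"
      unfolding norm_csqrt using \<epsilon>(2)[OF z] by (simp only: real_sqrt_less_iff)
    then show "norm (csqrt (u z)) < e" using \<Psi>(1) by simp
    have "csqrt (u z) = s * p (Y z)" using s(2)[OF z] p_nz[OF z] by (simp add: \<sigma>_def field_simps)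
    then have "s * csqrt (u z) = p (Y z)" using ss by (simp add: mult.assoc[symmetric])
    then show "Y z = \<Psi>1 (csqrt (u z))" using u_eq[OF z] by (simp add: \<Psi>1_def)
  qed
  ultimately show ?thesis using \<Psi>(1) \<epsilon>(1) by (intro that[of e \<Psi>1 \<epsilon>])
qed

end

section \<open>Third derivative of the remainder and coefficient expansion\<close>

context sqrt_schema
begin

definition remainder :: "(nat \<Rightarrow> complex) \<Rightarrow> complex \<Rightarrow> complex" where
  "remainder b z = Y z - (\<Sum>j<3. b j * (z * (u z ^ j * csqrt (u z))))"

lemma csqrt_u_hol: "(\<And>z. z \<in> A \<Longrightarrow> Re (u z) > 0) \<Longrightarrow> (\<lambda>z. csqrt (u z)) holomorphic_on A"
  by (intro holomorphic_intros hol_u) (force elim!: nonpos_Reals_cases)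

lemma remainder_hol: "remainder b holomorphic_on ball 0 \<rho>"
  unfolding remainder_def using Re_u_pos by (intro holomorphic_intros hol_Y hol_u csqrt_u_hol) auto

lemma bounded_third_deriv:
  assumes "g holomorphic_on ball z0 e" "e > 0" "z0 \<in> cball 0 \<rho>"
    and eq: "\<And>z. z \<in> ball z0 e \<inter> ball 0 \<rho> \<Longrightarrow> f z = g z" and f: "f holomorphic_on ball 0 \<rho>"
  shows "\<exists>e>0. \<exists>C. \<forall>z\<in>ball z0 e \<inter> ball 0 \<rho>. norm ((deriv ^^ 3) f z) \<le> C"
proof -
  have hol: "(deriv ^^ 3) g holomorphic_on ball z0 e"
    using assms by (intro holomorphic_higher_deriv) auto
  have "compact ((deriv ^^ 3) g ` cball z0 (e / 2))"
  proof (rule compact_continuous_image)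
    have "cball z0 (e / 2) \<subseteq> ball z0 e" using assms(2) by auto
    then show "continuous_on (cball z0 (e / 2)) ((deriv ^^ 3) g)"
      using hol by (meson holomorphic_on_imp_continuous_on holomorphic_on_subset)
  qed auto
  then obtain C where C: "\<And>z. z \<in> cball z0 (e / 2) \<Longrightarrow> norm ((deriv ^^ 3) g z) \<le> C"
    by (meson bounded_iff compact_imp_bounded imageI)
  have "norm ((deriv ^^ 3) f z) \<le> C" if z: "z \<in> ball z0 (e / 2) \<inter> ball 0 \<rho>" for z
  proof -
    have "(deriv ^^ 3) f z = (deriv ^^ 3) g z"
    proof (rule higher_deriv_transform_within_open)
      show "f holomorphic_on ball z0 e \<inter> ball 0 \<rho>" using f by (rule holomorphic_on_subset) auto
      show "g holomorphic_on ball z0 e \<inter> ball 0 \<rho>" using assms(1) by (rule holomorphic_on_subset) auto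
    qed (use z eq assms in auto)
    then show ?thesis using C[of z] z by simp
  qed
  then have "\<forall>z\<in>ball z0 (e / 2) \<inter> ball 0 \<rho>. norm ((deriv ^^ 3) f z) \<le> C" by blast
  moreover have "e / 2 > 0" using assms(2) by simp
  ultimately show ?thesis by blast
qed

lemma csqrt_mult_cube:
  assumes "w \<noteq> 0"
  shows "w ^ 3 * csqrt w = w powr (7 / 2)"
proof -
  have "w powr (7 / 2) = exp (Ln w / 2) * exp (of_nat 3 * Ln w)"
    using assms by (simp add: powr_def exp_add[symmetric] field_simps)
  also have "exp (of_nat 3 * Ln w) = w ^ 3" using assms using exp_of_nat_mult[of 3 "Ln w"] exp_Ln[OF assms] by simp
  finally show ?thesis using assms by (simp add: csqrt_exp_Ln)
qed

lemma u_deriv_r0: "deriv u r0 \<noteq> 0"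
proof -
  have "(u has_field_derivative - (of_nat d * (r0 / r0) ^ (d - 1) / r0)) (at r0)"
    unfolding u_def using r0_nz by (auto intro!: derivative_eq_intros)
  then have "deriv u r0 = - (of_nat d * (r0 / r0) ^ (d - 1) / r0)" by (rule DERIV_imp_deriv)
  then show ?thesis using r0_nz d by simp
qed

text \<open>Three peelings of \<open>Od (u z) / z\<close> along \<open>u\<close> produce the numbers
  \<open>b j\<close> and leave \<open>u^(7/2)\<close> times a holomorphic function; three
  derivatives reduce the exponent to 1/2. The leading coefficient is
  \<open>deriv \<Psi> 0 / r0\<close>, which is nonzero.\<close>

lemma singular_bound:
  "\<exists>b. b 0 \<noteq> 0 \<and> (\<exists>e>0. \<exists>C. \<forall>z\<in>ball r0 e \<inter> ball 0 \<rho>. norm ((deriv ^^ 3) (remainder b) z) \<le> C)"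
proof -
  obtain e \<Psi> \<epsilon> where *: "e > 0" "\<Psi> holomorphic_on ball 0 e" "deriv \<Psi> 0 \<noteq> 0" "\<epsilon> > 0"
    "\<And>z. z \<in> ball 0 \<rho> \<inter> ball r0 \<epsilon> \<Longrightarrow> norm (csqrt (u z)) < e \<and> Y z = \<Psi> (csqrt (u z))"
    by (rule singular_expansion) (rule that)
  obtain E Od where EO: "E holomorphic_on ball 0 (e\<^sup>2)" "Od holomorphic_on ball 0 (e\<^sup>2)"
    "\<And>s. s \<in> ball 0 e \<Longrightarrow> \<Psi> s = E (s\<^sup>2) + s * Od (s\<^sup>2)" "Od 0 = deriv \<Psi> 0"
    using holomorphic_even_odd_parts[OF *(2,1)] by metis
  have contu: "continuous_on UNIV u" using hol_u by (rule holomorphic_on_imp_continuous_on)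
  have "open (u -` ball 0 (e\<^sup>2))" by (intro open_vimage contu) auto
  moreover have "r0 \<in> u -` ball 0 (e\<^sup>2)" using u_r0 *(1) by simp
  ultimately obtain e1' where e1': "e1' > 0" "ball r0 e1' \<subseteq> u -` ball 0 (e\<^sup>2)"
    using open_contains_ball by blast
  \<comment> \<open>Staying within distance \<open>\<rho>\<close> of \<open>r0\<close> keeps the
    origin out, where the division by \<open>z\<close> in \<open>f0\<close> would fail.\<close>
  define e1 where "e1 = min (min e1' \<epsilon>) \<rho>"
  have e1: "e1 > 0" "e1 \<le> \<epsilon>" "e1 \<le> \<rho>" using e1' *(4) \<rho> by (auto simp: e1_def)
  have "ball r0 e1 \<subseteq> ball r0 e1'" by (auto simp: e1_def)
  then have u_im: "u ` ball r0 e1 \<subseteq> ball 0 (e\<^sup>2)"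
    using e1'(2) by blast
  have z_nz: "z \<noteq> 0" if "z \<in> ball r0 e1" for z
    using that e1(3) \<rho> by auto
  have hE: "(\<lambda>z. E (u z)) holomorphic_on ball r0 e1" and hO: "(\<lambda>z. Od (u z)) holomorphic_on ball r0 e1"
    using holomorphic_on_compose_gen[OF hol_u EO(1) u_im] holomorphic_on_compose_gen[OF hol_u EO(2) u_im]
    by (simp_all add: o_def)
  define f0 where "f0 = (\<lambda>z. Od (u z) / z)"
  have f0: "f0 holomorphic_on ball r0 e1"
    unfolding f0_def using z_nz by (intro holomorphic_intros hO) auto
  obtain e2 f1 where f1: "0 < e2" "e2 \<le> e1" "f1 holomorphic_on ball r0 e2"
    "\<And>z. z \<in> ball r0 e2 \<Longrightarrow> f0 z = f0 r0 + u z * f1 z"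
    by (rule holomorphic_peel[OF f0 hol_u e1(1) u_r0 u_deriv_r0]) blast
  obtain e3 f2 where f2: "0 < e3" "e3 \<le> e2" "f2 holomorphic_on ball r0 e3"
    "\<And>z. z \<in> ball r0 e3 \<Longrightarrow> f1 z = f1 r0 + u z * f2 z"
    by (rule holomorphic_peel[OF f1(3) hol_u f1(1) u_r0 u_deriv_r0]) blast
  obtain e4 f3 where f3: "0 < e4" "e4 \<le> e3" "f3 holomorphic_on ball r0 e4"
    "\<And>z. z \<in> ball r0 e4 \<Longrightarrow> f2 z = f2 r0 + u z * f3 z"
    by (rule holomorphic_peel[OF f2(3) hol_u f2(1) u_r0 u_deriv_r0]) blast
  define b where "b = (\<lambda>j::nat. if j = 0 then f0 r0 else if j = 1 then f1 r0 else f2 r0)"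
  have sub: "ball r0 e4 \<subseteq> ball r0 e1" "ball r0 e4 \<subseteq> ball r0 e2" "ball r0 e4 \<subseteq> ball r0 e3"
    using f1 f2 f3 by auto
  define v where "v = (\<lambda>z. z * f3 z)"
  have hv: "v holomorphic_on ball r0 e4" unfolding v_def by (intro holomorphic_intros f3)
  let ?D = "ball r0 e4 \<inter> ball 0 \<rho>"
  have remainder_eq: "remainder b z = E (u z) + u z powr (7 / 2) * v z" if z: "z \<in> ?D" for z
  proof -
    have z1: "z \<in> ball r0 e1" "z \<in> ball r0 e2" "z \<in> ball r0 e3" "z \<in> ball r0 e4" using sub z by auto
    have "Y z = \<Psi> (csqrt (u z))" "csqrt (u z) \<in> ball 0 e" using *(5)[of z] z z1 e1 by auto
    then have "Y z = E (u z) + csqrt (u z) * Od (u z)" using EO(3) by simp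
    moreover have "Od (u z) = z * f0 z" using z_nz[OF z1(1)] by (simp add: f0_def)
    moreover have "f0 z = f0 r0 + u z * (f1 r0 + u z * (f2 r0 + u z * f3 z))"
      using f1(4)[OF z1(2)] f2(4)[OF z1(3)] f3(4)[OF z1(4)] by simp
    ultimately have "Y z = E (u z) + csqrt (u z) * (z * (f0 r0 + u z * (f1 r0 + u z * (f2 r0 + u z * f3 z))))"
      by simp
    then have "remainder b z = E (u z) + (u z ^ 3 * csqrt (u z)) * v z"
      by (simp add: remainder_def b_def v_def numeral_3_eq_3 algebra_simps)
    moreover have "u z \<noteq> 0" using Re_u_pos[of z] z by auto
    ultimately show ?thesis by (simp add: csqrt_mult_cube)
  qed
  have posD: "Re (u z) > 0" if "z \<in> ?D" for z using Re_u_pos that by auto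
  have "\<exists>v3. v3 holomorphic_on ball r0 e4 \<and>
      (\<forall>z\<in>?D. (deriv ^^ 3) (\<lambda>z. u z powr (7 / 2) * v z) z = u z powr (7 / 2 - of_nat 3) * v3 z)"
    by (rule higher_deriv_powr_mult[OF _ _ _ hol_u hv posD]) auto
  then obtain v3 where v3: "v3 holomorphic_on ball r0 e4"
    "\<And>z. z \<in> ?D \<Longrightarrow> (deriv ^^ 3) (\<lambda>z. u z powr (7 / 2) * v z) z = u z powr (7 / 2 - of_nat 3) * v3 z"
    by blast
  have hE4: "(\<lambda>z. E (u z)) holomorphic_on ball r0 e4" using hE sub(1) by (rule holomorphic_on_subset)
  have hE3: "(deriv ^^ 3) (\<lambda>z. E (u z)) holomorphic_on ball r0 e4"
    using hE4 by (intro holomorphic_higher_deriv) auto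
  have bnd: "\<exists>C\<ge>0. \<forall>z\<in>cball r0 (e4 / 2). norm (g z) \<le> C" if "g holomorphic_on ball r0 e4" for g
  proof -
    have "cball r0 (e4 / 2) \<subseteq> ball r0 e4" using f3(1) by auto
    then have "continuous_on (cball r0 (e4 / 2)) g"
      using that by (meson holomorphic_on_imp_continuous_on holomorphic_on_subset)
    then have "compact (g ` cball r0 (e4 / 2))" by (intro compact_continuous_image) auto
    then obtain C where "\<forall>x\<in>cball r0 (e4 / 2). norm (g x) \<le> C"
      by (meson bounded_iff compact_imp_bounded imageI)
    then show ?thesis by (intro exI[of _ "\<bar>C\<bar>"]) force
  qed
  obtain C1 C2 where C: "C1 \<ge> 0" "C2 \<ge> 0" "\<And>z. z \<in> cball r0 (e4 / 2) \<Longrightarrow> norm ((deriv ^^ 3) (\<lambda>z. E (u z)) z) \<le> C1"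
    "\<And>z. z \<in> cball r0 (e4 / 2) \<Longrightarrow> norm (v3 z) \<le> C2"
    using bnd[OF hE3] bnd[OF v3(1)] by blast
  have "norm ((deriv ^^ 3) (remainder b) z) \<le> C1 + 2 * C2" if z: "z \<in> ball r0 (e4 / 2) \<inter> ball 0 \<rho>" for z
  proof -
    have "dist r0 z < e4 / 2" using z by simp
    then have "dist r0 z < e4" using f3(1) by linarith
    then have zD: "z \<in> ?D" and zc: "z \<in> cball r0 (e4 / 2)" using z by auto
    have holP: "(\<lambda>z. u z powr (7 / 2) * v z) holomorphic_on ?D"
      by (intro holomorphic_intros hol_u holomorphic_on_subset[OF hv])
        (use posD in \<open>force elim!: nonpos_Reals_cases\<close>)+
    have "(deriv ^^ 3) (remainder b) z = (deriv ^^ 3) (\<lambda>z. E (u z) + u z powr (7 / 2) * v z) z"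
      by (rule higher_deriv_transform_within_open[of _ ?D])
        (use remainder_eq zD holP hE4 in \<open>auto intro!: holomorphic_intros intro: holomorphic_on_subset[OF remainder_hol] holomorphic_on_subset[OF hE4]\<close>)
    also have "\<dots> = (deriv ^^ 3) (\<lambda>z. E (u z)) z + (deriv ^^ 3) (\<lambda>z. u z powr (7 / 2) * v z) z"
      by (rule higher_deriv_add[of _ ?D]) (use zD holP in \<open>auto intro: holomorphic_on_subset[OF hE4]\<close>)
    also have "(deriv ^^ 3) (\<lambda>z. u z powr (7 / 2) * v z) z = csqrt (u z) * v3 z"
      using v3(2)[OF zD] by (simp add: csqrt_conv_powr)
    finally have eq: "(deriv ^^ 3) (remainder b) z = (deriv ^^ 3) (\<lambda>z. E (u z)) z + csqrt (u z) * v3 z" .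
    have "norm ((deriv ^^ 3) (remainder b) z) \<le> norm ((deriv ^^ 3) (\<lambda>z. E (u z)) z) + norm (csqrt (u z)) * norm (v3 z)"
      unfolding eq norm_mult[symmetric] by (rule norm_triangle_ineq)
    moreover note C(3)[OF zc]
    moreover have "norm (csqrt (u z)) * norm (v3 z) \<le> 2 * C2"
    proof (intro mult_mono C zc)
      have "norm (z / r0) \<le> 1" using z \<rho> by (auto simp: norm_divide)
      then have "norm ((z / r0) ^ d) \<le> 1" unfolding norm_power by (intro power_le_one) auto
      then have "norm (u z) \<le> 1 + 1"
        unfolding u_def using norm_triangle_ineq4[of 1 "(z / r0) ^ d"] by simp
      then have "sqrt (norm (u z)) \<le> sqrt 4" by (intro real_sqrt_le_mono) simp
      then show "norm (csqrt (u z)) \<le> 2" by simp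
    qed auto
    ultimately show ?thesis by linarith
  qed
  then have "\<forall>z\<in>ball r0 (e4 / 2) \<inter> ball 0 \<rho>. norm ((deriv ^^ 3) (remainder b) z) \<le> C1 + 2 * C2" by blast
  moreover have "e4 / 2 > 0" using f3(1) by simp
  moreover have "b 0 \<noteq> 0" using EO(4) *(3) r0_nz u_r0 by (simp add: b_def f0_def)
  ultimately show ?thesis by blast
qed

text \<open>\<open>reg\<close> is the nonvanishing of the partial derivative in \<open>y\<close>, so
  here \<open>y\<close> is a function of \<open>z\<close>, the opposite choice to the critical
  point. Continuity of \<open>Y\<close> up to the circle and local uniqueness identify this function
  with \<open>Y\<close>.\<close>

lemma regular_continuation:
  assumes "norm z0 = \<rho>" "z0 ^ d \<noteq> r0 ^ d"
  obtains e g where "e > 0" "g holomorphic_on ball z0 e" "\<And>z. z \<in> ball z0 e \<inter> ball 0 \<rho> \<Longrightarrow> Y z = g z"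
proof -
  let ?U = "ball 0 rG \<times> ball 0 rP :: (complex \<times> complex) set"
  have swap: "(prod.swap has_derivative prod.swap) (at p)" for p :: "complex \<times> complex"
    unfolding prod.swap_def by (intro has_derivative_Pair has_derivative_fst has_derivative_snd has_derivative_ident)
  have contswap: "continuous_on A prod.swap" for A :: "(complex \<times> complex) set"
    unfolding prod.swap_def by (intro continuous_intros)
  have im: "prod.swap ` ?U \<subseteq> ball 0 rP \<times> ball 0 rG" by auto
  have z0: "z0 \<in> cball 0 \<rho>" "z0 \<in> ball 0 rG" using assms \<rho> by auto
  have Y0: "Y z0 \<in> ball 0 rP" using Y_le[OF z0(1)] \<tau> by auto
  have eq0: "G z0 + z0 * Phi (Y z0) - Y z0 = 0"
    unfolding right_minus_eq by (rule Y_eq[OF z0(1), symmetric])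
  obtain W g r where W: "open W" "(z0, Y z0) \<in> W" "W \<subseteq> ?U" "r > 0" "g z0 = Y z0"
    "\<And>z. z \<in> ball z0 r \<Longrightarrow> (z, g z) \<in> W \<and> G z + z * Phi (g z) - g z = 0"
    "\<And>z. z \<in> ball z0 r \<Longrightarrow> z * deriv Phi (g z) - 1 \<noteq> 0 \<and>
       (g has_field_derivative - (deriv G z + Phi (g z)) / (z * deriv Phi (g z) - 1)) (at z)"
    "\<And>z y. (z, y) \<in> W \<Longrightarrow> z \<in> ball z0 r \<Longrightarrow> G z + z * Phi y - y = 0 \<Longrightarrow> y = g z"
  proof (rule holomorphic_implicit_function[of ?U z0 "Y z0" "\<lambda>p. G (fst p) + fst p * Phi (snd p) - snd p"
          "\<lambda>p. deriv G (fst p) + Phi (snd p)" "\<lambda>p. fst p * deriv Phi (snd p) - 1"])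
    fix p assume p: "p \<in> ?U"
    then have "((\<lambda>p. G (snd p) + snd p * Phi (fst p) - fst p) has_derivative
     (\<lambda>h. (fst p * deriv Phi (snd p) - 1) * fst h + (deriv G (fst p) + Phi (snd p)) * snd h)) (at (prod.swap p))"
      using F_has_derivative[of "prod.swap p"] by (auto simp: prod.swap_def)
    from has_derivative_compose[OF swap this]
    show "((\<lambda>p. G (fst p) + fst p * Phi (snd p) - snd p) has_derivative
     (\<lambda>h. (deriv G (fst p) + Phi (snd p)) * fst h + (fst p * deriv Phi (snd p) - 1) * snd h)) (at p)"
      by (simp add: add.commute)
  next
    show "continuous_on ?U (\<lambda>p. deriv G (fst p) + Phi (snd p))"
      using continuous_on_compose2[OF continuous_partials(2) contswap[of ?U] im] by simp
    show "continuous_on ?U (\<lambda>p. fst p * deriv Phi (snd p) - 1)"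
      using continuous_on_compose2[OF continuous_partials(1) contswap[of ?U] im] by simp
  qed (use z0 Y0 eq0 reg[OF assms] in \<open>auto intro!: open_Times\<close>)
  have "((\<lambda>z. (z, Y z)) \<longlongrightarrow> (z0, Y z0)) (at z0 within cball 0 \<rho>)"
    using contY z0 by (intro tendsto_intros) (auto simp: continuous_on_def)
  then have "\<forall>\<^sub>F z in at z0 within cball 0 \<rho>. (z, Y z) \<in> W"
    using W(1,2) by (rule topological_tendstoD)
  then obtain \<epsilon> where "\<epsilon> > 0" and *: "\<And>z. z \<in> cball 0 \<rho> \<Longrightarrow> z \<noteq> z0 \<Longrightarrow> dist z z0 < \<epsilon> \<Longrightarrow> (z, Y z) \<in> W"
    unfolding eventually_at by blast
  have "g holomorphic_on ball z0 r"
    unfolding holomorphic_on_open[OF open_ball] using W(7) by blast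
  then have "g holomorphic_on ball z0 (min r \<epsilon>)" by (rule holomorphic_on_subset) auto
  moreover have "Y z = g z" if z: "z \<in> ball z0 (min r \<epsilon>) \<inter> ball 0 \<rho>" for z
  proof (rule W(8))
    show "(z, Y z) \<in> W" using *[of z] z W(2) by (cases "z = z0") (auto simp: dist_commute)
    show "G z + z * Phi (Y z) - Y z = 0" using Y_eq[of z] z by simp
  qed (use z in auto)
  ultimately show ?thesis using that[of "min r \<epsilon>" g] W(4) \<open>\<epsilon> > 0\<close> by simp
qed

text \<open>On the circle, away from the rotations of \<open>\<rho>\<close>,
  \<open>(z0 / r0) ^ d\<close> has modulus 1 and differs from 1. So \<open>Re (u z0)\<close> is
  still positive, and \<open>Y\<close> and the square root both extend across the circle.\<close>

lemma regular_bound: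
  assumes "z0 \<in> cball 0 \<rho>" "z0 ^ d \<noteq> r0 ^ d"
  shows "\<exists>e>0. \<exists>C. \<forall>z\<in>ball z0 e \<inter> ball 0 \<rho>. norm ((deriv ^^ 3) (remainder b) z) \<le> C"
proof (cases "norm z0 < \<rho>")
  case True
  then obtain e where "e > 0" "ball z0 e \<subseteq> ball 0 \<rho>"
    using open_contains_ball[of "ball 0 \<rho>"] by force
  then show ?thesis
    by (intro bounded_third_deriv[of "remainder b" z0 e]) (use assms remainder_hol in \<open>auto intro: holomorphic_on_subset\<close>)
next
  case False
  then have n0: "norm z0 = \<rho>" using assms by auto
  obtain e g where g: "e > 0" "g holomorphic_on ball z0 e" "\<And>z. z \<in> ball z0 e \<inter> ball 0 \<rho> \<Longrightarrow> Y z = g z"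
    by (rule regular_continuation[OF n0 assms(2)]) (rule that)
  have Re0: "Re (u z0) > 0"
  proof -
    let ?x = "(z0 / r0) ^ d"
    have n1: "norm ?x = 1" using n0 \<rho> by (simp add: norm_power norm_divide)
    have "?x \<noteq> 1" using assms(2) r0_nz by (simp add: power_divide)
    have "Re ?x \<noteq> 1"
    proof
      assume "Re ?x = 1"
      then have "Im ?x = 0" using n1 by (metis cmod_power2 add_cancel_right_right one_power2 zero_eq_power2)
      with \<open>Re ?x = 1\<close> \<open>?x \<noteq> 1\<close> show False by (simp add: complex_eq_iff)
    qed
    moreover have "Re ?x \<le> 1" using complex_Re_le_cmod[of ?x] n1 by simp
    ultimately show ?thesis by (simp add: u_def)
  qed
  have contu: "continuous_on UNIV (\<lambda>z. Re (u z))"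
    using hol_u[of UNIV] by (intro continuous_intros holomorphic_on_imp_continuous_on)
  have "open ((\<lambda>z. Re (u z)) -` {0<..})" by (intro open_vimage contu) auto
  moreover have "z0 \<in> (\<lambda>z. Re (u z)) -` {0<..}" using Re0 by simp
  ultimately obtain e' where e': "e' > 0" "ball z0 e' \<subseteq> (\<lambda>z. Re (u z)) -` {0<..}"
    using open_contains_ball by blast
  show ?thesis
  proof (rule bounded_third_deriv)
    show "(\<lambda>z. g z - (\<Sum>j<3. b j * (z * (u z ^ j * csqrt (u z))))) holomorphic_on ball z0 (min e e')"
      using e' by (intro holomorphic_intros hol_u csqrt_u_hol holomorphic_on_subset[OF g(2)]) auto
  qed (use assms remainder_hol e' g in \<open>auto simp: remainder_def\<close>)
qed

lemma power_root_of_unity: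
  assumes "\<omega> ^ d = (1 :: complex)" "n mod d = 1 mod d"
  shows "\<omega> ^ n = \<omega>"
proof -
  have mod: "\<omega> ^ k = \<omega> ^ (k mod d)" for k
  proof -
    have "\<omega> ^ k = \<omega> ^ (d * (k div d) + k mod d)" by simp
    also have "\<dots> = \<omega> ^ (k mod d)" unfolding power_add power_mult using assms by simp
    finally show ?thesis .
  qed
  show ?thesis using mod[of n] mod[of 1] assms(2) by simp
qed

lemma remainder_rotate:
  assumes "\<omega> ^ d = 1" "z \<in> ball 0 \<rho>"
  shows "remainder b (\<omega> * z) = \<omega> * remainder b z"
proof -
  have n: "norm \<omega> = 1" using assms d by (metis norm_one norm_power power_eq_1_iff norm_ge_zero not_gr_zero)
  have "u (\<omega> * z) = u z" using assms by (simp add: u_def power_mult_distrib power_divide)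
  moreover have "Y (\<omega> * z) = \<omega> * Y z"
  proof (rule sums_unique2)
    show "(\<lambda>k. a k * (\<omega> * z) ^ k) sums Y (\<omega> * z)" using assms n by (intro sums) (auto simp: norm_mult)
    have "a k * (\<omega> * z) ^ k = \<omega> * (a k * z ^ k)" for k
      using power_root_of_unity[OF assms(1) supp[of k]] by (cases "a k = 0") (auto simp: power_mult_distrib)
    then have "(\<lambda>k. a k * (\<omega> * z) ^ k) = (\<lambda>k. \<omega> * (a k * z ^ k))" by (rule ext)
    moreover have "(\<lambda>k. \<omega> * (a k * z ^ k)) sums (\<omega> * Y z)" by (intro sums_mult sums assms)
    ultimately show "(\<lambda>k. a k * (\<omega> * z) ^ k) sums (\<omega> * Y z)" by (simp only:)
  qed
  ultimately show ?thesis by (simp add: remainder_def algebra_simps sum_distrib_left)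
qed

text \<open>Compactness of the closed disc makes boundedness a local question. The points with
  \<open>z0 ^ d = r0 ^ d\<close> are rotations of \<open>r0\<close> by \<open>d\<close>-th roots of
  unity, and by \<open>remainder_rotate\<close> a rotation changes the third derivative only by a
  factor of norm 1.\<close>

theorem remainder_third_deriv_bounded:
  "\<exists>b C. b 0 \<noteq> 0 \<and> (\<forall>z\<in>ball 0 \<rho>. norm ((deriv ^^ 3) (remainder b) z) \<le> C)"
proof -
  obtain b e C where b: "b 0 \<noteq> 0" "e > 0"
    "\<And>z. z \<in> ball r0 e \<inter> ball 0 \<rho> \<Longrightarrow> norm ((deriv ^^ 3) (remainder b) z) \<le> C"
    using singular_bound by blast
  have "\<exists>C\<ge>0. \<forall>z\<in>ball 0 \<rho>. norm ((deriv ^^ 3) (remainder b) z) \<le> C"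
  proof (rule bounded_on_compact_cover[of "cball 0 \<rho>"])
    fix z0 :: complex assume z0: "z0 \<in> cball 0 \<rho>"
    show "\<exists>e>0. \<exists>C. \<forall>z\<in>ball z0 e \<inter> ball 0 \<rho>. norm ((deriv ^^ 3) (remainder b) z) \<le> C"
    proof (cases "z0 ^ d = r0 ^ d")
      case False
      then show ?thesis using regular_bound[OF z0] by blast
    next
      case True
      define \<omega> where "\<omega> = r0 / z0"
      have z0nz: "z0 \<noteq> 0" using True r0_nz d by (auto simp: power_0_left)
      have \<omega>: "\<omega> ^ d = 1" using True z0nz r0_nz by (simp add: \<omega>_def power_divide)
      have n: "norm \<omega> = 1" using \<omega> d by (metis norm_one norm_power power_eq_1_iff norm_ge_zero not_gr_zero)
      have "norm ((deriv ^^ 3) (remainder b) z) \<le> C" if z: "z \<in> ball z0 e \<inter> ball 0 \<rho>" for z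
      proof -
        have in0: "\<omega> * z \<in> ball 0 \<rho>" using z n by (simp add: norm_mult)
        have "dist r0 (\<omega> * z) = norm (\<omega> * (z0 - z))" using z0nz by (simp add: dist_norm \<omega>_def field_simps)
        then have in1: "\<omega> * z \<in> ball r0 e" using z n by (simp add: norm_mult dist_norm)
        have "(deriv ^^ 3) (\<lambda>x. remainder b (\<omega> * x)) z = \<omega> ^ 3 * (deriv ^^ 3) (remainder b) (\<omega> * z)"
          by (rule higher_deriv_compose_linear[OF remainder_hol, of "ball 0 \<rho>"])
             (use z n in \<open>auto simp: norm_mult\<close>)
        moreover have "(deriv ^^ 3) (\<lambda>x. remainder b (\<omega> * x)) z = (deriv ^^ 3) (\<lambda>x. \<omega> * remainder b x) z"
        proof (rule higher_deriv_transform_within_open[of _ "ball 0 \<rho>"])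
          show "(\<lambda>x. remainder b (\<omega> * x)) holomorphic_on ball 0 \<rho>"
            by (rule holomorphic_on_compose_gen[OF _ remainder_hol, unfolded o_def])
               (use n in \<open>auto intro!: holomorphic_intros simp: norm_mult\<close>)
        qed (use z remainder_hol remainder_rotate[OF \<omega>] in \<open>auto intro!: holomorphic_intros\<close>)
        moreover have "(deriv ^^ 3) (\<lambda>x. \<omega> * remainder b x) z = \<omega> * (deriv ^^ 3) (remainder b) z"
          by (rule higher_deriv_cmult[OF remainder_hol]) (use z in auto)
        ultimately have "norm (\<omega> * (deriv ^^ 3) (remainder b) z) = norm (\<omega> ^ 3 * (deriv ^^ 3) (remainder b) (\<omega> * z))"
          by simp
        then show ?thesis using b(3)[of "\<omega> * z"] in0 in1 n by (simp add: norm_mult norm_power)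
      qed
      then show ?thesis using b(2) by blast
    qed
  qed auto
  then show ?thesis using b(1) by blast
qed

text \<open>The binomial series of \<open>(1 - x)^(j + 1/2)\<close> at
  \<open>x = (z / r0)^d\<close>, shifted by one place through the factor \<open>z\<close>; hence
  only indices \<open>d k + 1\<close> occur.\<close>

definition sing_coeff :: "nat \<Rightarrow> nat \<Rightarrow> complex" where
  "sing_coeff j n = (if n \<in> range (\<lambda>k. d * k + 1)
     then ((of_nat j + 1 / 2) gchoose ((n - 1) div d)) * (-1) ^ ((n - 1) div d) / r0 ^ (n - 1) else 0)"

lemma sing_coeff_sums:
  assumes z: "z \<in> ball 0 \<rho>"
  shows "(\<lambda>n. sing_coeff j n * z ^ n) sums (z * (u z ^ j * csqrt (u z)))"
proof -
  let ?g = "\<lambda>k. d * k + 1"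
  let ?x = "(z / r0) ^ d"
  have "norm ?x < 1"
  proof -
    have "norm (z / r0) < 1" using z \<rho> by (simp add: norm_divide)
    then show ?thesis unfolding norm_power using d by (intro power_less_one_iff[THEN iffD2]) auto
  qed
  then have "(\<lambda>k. ((of_nat j + 1 / 2) gchoose k) * (- ?x) ^ k) sums (1 + (- ?x)) powr (of_nat j + 1 / 2)"
    by (intro gen_binomial_complex) simp
  moreover have unz: "u z \<noteq> 0" using Re_u_pos[OF z] by auto
  moreover have "(1 + (- ?x)) powr (of_nat j + 1 / 2) = u z ^ j * csqrt (u z)"
  proof -
    have "1 + (- ?x) = u z" by (simp add: u_def)
    moreover have "u z powr (of_nat j + 1 / 2) = u z powr of_nat j * u z powr (1 / 2)" by (rule powr_add)
    moreover have "u z powr of_nat j = u z ^ j" using unz by (simp add: powr_def exp_of_nat_mult)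
    ultimately show ?thesis by (simp add: csqrt_conv_powr)
  qed
  ultimately have "(\<lambda>k. ((of_nat j + 1 / 2) gchoose k) * (- ?x) ^ k) sums (u z ^ j * csqrt (u z))"
    by simp
  then have "(\<lambda>k. z * (((of_nat j + 1 / 2) gchoose k) * (- ?x) ^ k)) sums (z * (u z ^ j * csqrt (u z)))"
    by (rule sums_mult)
  moreover have "z * (((of_nat j + 1 / 2) gchoose k) * (- ?x) ^ k) = sing_coeff j (?g k) * z ^ ?g k" for k
  proof -
    have "(- ?x) ^ k = (-1) ^ k * (z ^ (d * k) / r0 ^ (d * k))"
      by (subst power_minus) (simp add: power_mult[symmetric] power_divide)
    moreover have "(?g k - 1) div d = k" "?g k - 1 = d * k" using d by simp_all
    moreover from this have "sing_coeff j (?g k) = ((of_nat j + 1 / 2) gchoose k) * (-1) ^ k / r0 ^ (d * k)"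
      unfolding sing_coeff_def by (simp only: rangeI[of ?g k] if_True)
    ultimately show ?thesis by simp
  qed
  ultimately have "(\<lambda>k. sing_coeff j (?g k) * z ^ ?g k) sums (z * (u z ^ j * csqrt (u z)))" by simp
  then show ?thesis
    by (subst (asm) sums_mono_reindex[of ?g "\<lambda>n. sing_coeff j n * z ^ n"])
       (use d in \<open>auto simp: strict_mono_def sing_coeff_def\<close>)
qed

theorem coeff_asymptotics:
  "\<exists>b C. b 0 \<noteq> 0 \<and> (\<forall>n\<ge>3. norm (a n - (\<Sum>j<3. b j * sing_coeff j n)) * \<rho> ^ n \<le> C / real n ^ 3)"
proof -
  obtain b C where b: "b 0 \<noteq> 0" "\<And>z. z \<in> ball 0 \<rho> \<Longrightarrow> norm ((deriv ^^ 3) (remainder b) z) \<le> C"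
    using remainder_third_deriv_bounded by blast
  have "(\<lambda>n. (a n - (\<Sum>j<3. b j * sing_coeff j n)) * z ^ n) sums remainder b z" if z: "z \<in> ball 0 \<rho>" for z
  proof -
    have "(\<lambda>n. a n * z ^ n - (\<Sum>j<3. b j * (sing_coeff j n * z ^ n))) sums remainder b z"
      unfolding remainder_def by (intro sums_diff sums_sum sums_mult sums z sing_coeff_sums)
    then show ?thesis by (simp add: algebra_simps sum_distrib_left sum_distrib_right)
  qed
  then have "norm (a n - (\<Sum>j<3. b j * sing_coeff j n)) * \<rho> ^ n \<le> C * \<rho> ^ 3 * 5 / real n ^ 3" if "n \<ge> 3" for n
    by (rule powser_coeff_bound[OF \<rho>(1) _ b(2) that])
  then show ?thesis
    by (intro exI[of _ b] exI[of _ "C * \<rho> ^ 3 * 5"] conjI b(1) allI impI)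
qed

end

section \<open>Coefficients of order \<open>n\<^bsup>-3/2\<^esup>\<close>\<close>

text \<open>The coefficients of \<open>- (1 - x)^(1/2)\<close>; with this sign they are positive
  from \<open>k = 1\<close> on.\<close>

definition half_coeff :: "nat \<Rightarrow> real" where
  "half_coeff k = - ((1 / 2 gchoose k) * (-1) ^ k)"

lemma half_coeff_Suc: "half_coeff (Suc k) * (real k + 1) = half_coeff k * (real k - 1 / 2)"
proof -
  have A: "(1 / 2 gchoose Suc k) * (real k + 1) = (1 / 2 gchoose k) * (1 / 2 - real k)"
    using gbinomial_absorb_comp[of "1 / 2 :: real" k] gbinomial_absorption[of k "1 / 2 :: real"]
    by (simp add: algebra_simps)
  have "half_coeff (Suc k) * (real k + 1) = (-1) ^ k * ((1 / 2 gchoose Suc k) * (real k + 1))"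
    by (simp add: half_coeff_def algebra_simps)
  also have "\<dots> = half_coeff k * (real k - 1 / 2)"
    unfolding A by (simp add: half_coeff_def algebra_simps)
  finally show ?thesis .
qed

lemma half_coeff_pos: "k \<ge> 1 \<Longrightarrow> half_coeff k > 0"
proof (induction k rule: nat_induct_at_least)
  case base
  show ?case by (simp add: half_coeff_def)
next
  case (Suc k)
  then have "half_coeff k * (real k - 1 / 2) > 0" by (intro mult_pos_pos) auto
  then have "half_coeff (Suc k) * (real k + 1) > 0" by (simp only: half_coeff_Suc)
  then show ?case by (simp add: zero_less_mult_iff)
qed

text \<open>\<open>Q k = p\<^sub>k\<^sup>2 k\<^sup>3\<close> with \<open>p = half_coeff\<close> decreases, while \<open>Q k (k - 1) / k\<close> increases; this pins
  \<open>Q k\<close> to its limit up to \<open>O(1/k)\<close>.\<close>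

lemma half_coeff_asymp:
  obtains c where "c > 0" "(\<lambda>k. half_coeff k - c * real k powr (-3 / 2)) \<in> O(\<lambda>k. real k powr (-5 / 2))"
proof -
  define Q where "Q = (\<lambda>k. (half_coeff k)\<^sup>2 * real k ^ 3)"
  have Q_pos: "Q k > 0" if "k \<ge> 1" for k using half_coeff_pos[OF that] that by (simp add: Q_def)
  have Q_Suc: "Q (Suc k) = Q k * (1 - 3 / (4 * real k ^ 2) + 1 / (4 * real k ^ 3))" if "k \<ge> 1" for k
  proof -
    have e: "half_coeff (Suc k) = half_coeff k * (real k - 1 / 2) / (real k + 1)"
      using half_coeff_Suc[of k] by (simp add: field_simps)
    have "Q (Suc k) = (half_coeff k)\<^sup>2 * (real k - 1 / 2)\<^sup>2 * (real k + 1)"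
      unfolding Q_def e by (simp add: power_divide power_mult_distrib power2_eq_square power3_eq_cube add.commute)
    also have "\<dots> = Q k * (1 - 3 / (4 * real k ^ 2) + 1 / (4 * real k ^ 3))"
      using that unfolding Q_def by (simp add: field_simps power2_eq_square power3_eq_cube)
    finally show ?thesis .
  qed
  have dec: "Q (Suc k) \<le> Q k" if "k \<ge> 1" for k
  proof -
    have "1 / (4 * real k ^ 3) \<le> 3 / (4 * real k ^ 2)"
      using that by (simp add: field_simps power2_eq_square power3_eq_cube)
    then have "Q k * (1 - 3 / (4 * real k ^ 2) + 1 / (4 * real k ^ 3)) \<le> Q k * 1"
      using Q_pos[OF that] by (intro mult_left_mono) auto
    then show ?thesis unfolding Q_Suc[OF that] by simp
  qed
  define V where "V = (\<lambda>k. Q k * (real k - 1) / real k)"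
  have inc: "V k \<le> V (Suc k)" if "k \<ge> 1" for k
  proof -
    have "(1 - 1 / real k ^ 2) * real k = (real k - 1) * (real k + 1) / real k"
      using that by (simp add: field_simps power2_eq_square)
    then have "(real k - 1) / real k = (1 - 1 / real k ^ 2) * real k / (real k + 1)" by simp
    also have "\<dots> \<le> (1 - 3 / (4 * real k ^ 2) + 1 / (4 * real k ^ 3)) * real k / (real k + 1)"
    proof (intro divide_right_mono mult_right_mono)
      have "3 / (4 * real k ^ 2) \<le> 1 / real k ^ 2" by (simp add: divide_simps)
      moreover have "0 \<le> 1 / (4 * real k ^ 3)" by simp
      ultimately show "1 - 1 / real k ^ 2 \<le> 1 - 3 / (4 * real k ^ 2) + 1 / (4 * real k ^ 3)" by linarith
    qed auto
    finally have "(real k - 1) / real k \<le> (1 - 3 / (4 * real k ^ 2) + 1 / (4 * real k ^ 3)) * real k / (real k + 1)" .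
    then have "Q k * ((real k - 1) / real k) \<le> Q k * ((1 - 3 / (4 * real k ^ 2) + 1 / (4 * real k ^ 3)) * real k / (real k + 1))"
      using Q_pos[OF that] by (intro mult_left_mono) auto
    then show ?thesis unfolding V_def Q_Suc[OF that] by (simp add: add.commute)
  qed
  have decS: "decseq (\<lambda>k. Q (Suc k))" by (rule decseq_SucI) (use dec in auto)
  have incS: "incseq (\<lambda>k. V (Suc k))" by (rule incseq_SucI) (use inc in auto)
  obtain L where L: "(\<lambda>k. Q (Suc k)) \<longlonglongrightarrow> L" "\<And>k. L \<le> Q (Suc k)"
    by (rule decseq_convergent[OF decS, of 0]) (use Q_pos in \<open>auto intro: less_imp_le\<close>)
  have "(\<lambda>k. Q (Suc k) * (real (Suc k) - 1) / real (Suc k)) \<longlonglongrightarrow> L * 1"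
  proof -
    have "(\<lambda>k. (real (Suc k) - 1) / real (Suc k)) \<longlonglongrightarrow> 1" by real_asymp
    from tendsto_mult[OF L(1) this] show ?thesis by simp
  qed
  then have limV: "(\<lambda>k. V (Suc k)) \<longlonglongrightarrow> L" by (simp add: V_def)
  have V_le: "V (Suc k) \<le> L" for k by (rule incseq_le[OF incS limV])
  have "V 2 > 0" using Q_pos[of 2] by (simp add: V_def)
  moreover have "V 2 \<le> L" using V_le[of 1] by (simp add: numeral_2_eq_2)
  ultimately have Lpos: "L > 0" by linarith
  define c where "c = sqrt L"
  have cpos: "c > 0" "c * c = L" using Lpos by (auto simp: c_def)
  have bound: "norm (half_coeff k - c * real k powr (-3 / 2)) \<le> (2 * c) * norm (real k powr (-5 / 2))" if k: "k \<ge> 2" for k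
  proof -
    obtain k' where k': "k = Suc k'" using k by (cases k) auto
    have 1: "L \<le> Q k" using L(2)[of k'] k' by simp
    have 2: "Q k * (real k - 1) / real k \<le> L" using V_le[of k'] k' by (simp add: V_def)
    define q where "q = half_coeff k * real k powr (3 / 2)"
    have kp: "real k > 0" using k by simp
    have "real k powr (3 / 2) * real k powr (3 / 2) = real k ^ 3"
      using kp by (simp flip: powr_add)
    then have qq: "q * q = Q k" by (simp add: q_def Q_def power2_eq_square mult_ac)
    have qpos: "q > 0" using half_coeff_pos[of k] k kp by (simp add: q_def)
    have ge: "q \<ge> c" using 1 cpos qq qpos
      by (metis (no_types) abs_of_pos abs_le_square_iff power2_eq_square)
    \<comment> \<open>\<open>V k \<le> L\<close> means \<open>(Q k - L) (k - 1) \<le> L\<close>, and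
      \<open>k - 1 \<ge> k / 2\<close> for \<open>k \<ge> 2\<close>; the factor 2 in the final
      constant comes from here.\<close>
    have "Q k - L \<le> 2 * L / real k"
    proof -
      have "Q k * (real k - 1) \<le> L * real k" using 2 kp by (simp add: field_simps)
      then have "(Q k - L) * (real k - 1) \<le> L" by (simp add: algebra_simps)
      moreover have "(Q k - L) * (real k / 2) \<le> (Q k - L) * (real k - 1)"
        using 1 k by (intro mult_left_mono) auto
      ultimately have "(Q k - L) * (real k / 2) \<le> L" by linarith
      then show ?thesis using kp by (simp add: field_simps)
    qed
    moreover have "(q - c) * c \<le> Q k - L"
    proof -
      have "Q k - L = (q - c) * (q + c)" using qq cpos by (simp add: algebra_simps)
      moreover have "(q - c) * c \<le> (q - c) * (q + c)" using ge qpos by (intro mult_left_mono) auto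
      ultimately show ?thesis by simp
    qed
    moreover have "2 * L / real k = (2 * c / real k) * c" by (simp flip: cpos(2))
    ultimately have "(q - c) * c \<le> (2 * c / real k) * c" by linarith
    then have "q - c \<le> 2 * c / real k" using cpos(1) by (simp only: mult_le_cancel_right_pos)
    then have *: "\<bar>q - c\<bar> \<le> 2 * c / real k" using ge by simp
    have "half_coeff k - c * real k powr (-3 / 2) = (q - c) * real k powr (-3 / 2)"
      using kp by (simp add: q_def algebra_simps flip: powr_add)
    then have "norm (half_coeff k - c * real k powr (-3 / 2)) = \<bar>q - c\<bar> * real k powr (-3 / 2)"
      by (simp add: abs_mult)
    also have "\<dots> \<le> (2 * c / real k) * real k powr (-3 / 2)" by (intro mult_right_mono *) auto
    also have "\<dots> = (2 * c) * (real k powr (-1) * real k powr (-3 / 2))"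
      using kp by (simp add: powr_minus_divide)
    also have "real k powr (-1) * real k powr (-3 / 2) = real k powr (-1 + -3 / 2)"
      by (rule powr_add[symmetric])
    also have "-1 + -3 / 2 = (-5 / 2 :: real)" by simp
    finally show ?thesis by simp
  qed
  have "(\<lambda>k. half_coeff k - c * real k powr (-3 / 2)) \<in> O(\<lambda>k. real k powr (-5 / 2))"
    by (rule bigoI[of _ "2 * c"]) (use bound in \<open>auto simp: eventually_at_top_linorder\<close>)
  then show ?thesis using that cpos(1) by blast
qed

lemma half_coeff_bigo: "half_coeff \<in> O(\<lambda>k. real k powr (-3 / 2))"
proof -
  obtain c where c: "(\<lambda>k. half_coeff k - c * real k powr (-3 / 2)) \<in> O(\<lambda>k. real k powr (-5 / 2))"
    by (rule half_coeff_asymp)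
  have "(\<lambda>k. real k powr (-5 / 2)) \<in> O(\<lambda>k. real k powr (-3 / 2))" by real_asymp
  with c have "(\<lambda>k. half_coeff k - c * real k powr (-3 / 2)) \<in> O(\<lambda>k. real k powr (-3 / 2))"
    by (rule landau_o.big_trans)
  moreover have "(\<lambda>k. c * real k powr (-3 / 2)) \<in> O(\<lambda>k. real k powr (-3 / 2))" by simp
  ultimately have "(\<lambda>k. (half_coeff k - c * real k powr (-3 / 2)) + c * real k powr (-3 / 2)) \<in> O(\<lambda>k. real k powr (-3 / 2))"
    by (rule sum_in_bigo)
  then show ?thesis by simp
qed

lemma gbinomial_Suc_top: "(a + 1 gchoose k) * (a + 1 - of_nat k) = (a + 1) * (a gchoose k)" for a :: real
  using gbinomial_absorb_comp[of "a + 1" k] by (simp add: mult.commute)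

text \<open>Raising the upper index multiplies the coefficient by
  \<open>(a + 1) / (a + 1 - k)\<close>. The step from 1/2 to 3/2 gains the factor
  \<open>1 / k\<close> that separates the first singular term from the others; for larger
  \<open>j\<close> the multiplier is used only as a bounded factor.\<close>

lemma gbinomial_half_bigo:
  assumes "j \<ge> 1"
  shows "(\<lambda>k. (real j + 1 / 2 gchoose k) * (-1) ^ k) \<in> O(\<lambda>k. real k powr (-5 / 2))"
  using assms
proof (induction j rule: nat_induct_at_least)
  case base
  have "(\<lambda>k. (3 / 2) / (real k - 3 / 2) * half_coeff k) \<in> O(\<lambda>k. 1 / real k * real k powr (-3 / 2))"
    by (intro landau_o.big.mult half_coeff_bigo) real_asymp
  also have "(\<lambda>k. 1 / real k * real k powr (-3 / 2)) \<in> O(\<lambda>k. real k powr (-5 / 2))" by real_asymp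
  finally have *: "(\<lambda>k. (3 / 2) / (real k - 3 / 2) * half_coeff k) \<in> O(\<lambda>k. real k powr (-5 / 2))" .
  have "(real 1 + 1 / 2 gchoose k) * (-1) ^ k = (3 / 2) / (real k - 3 / 2) * half_coeff k" if "k \<ge> 2" for k
  proof -
    have "(3 / 2 gchoose k) * (3 / 2 - real k) = (3 / 2) * (1 / 2 gchoose k)"
      using gbinomial_Suc_top[of "1 / 2" k] by simp
    moreover have "real k - 3 / 2 \<noteq> 0" using that by simp
    ultimately have "(3 / 2 gchoose k) = - (3 / 2) * (1 / 2 gchoose k) / (real k - 3 / 2)"
      by (simp add: field_simps)
    then show ?thesis by (simp add: half_coeff_def)
  qed
  then show ?case
    by (subst landau_o.big.in_cong[OF eventually_mono[OF eventually_ge_at_top[of 2]]]) (use * in auto)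
next
  case (Suc j)
  let ?c = "real j + 3 / 2"
  have "(\<lambda>k. - ?c / (real k - ?c) * ((real j + 1 / 2 gchoose k) * (-1) ^ k)) \<in> O(\<lambda>k. 1 * real k powr (-5 / 2))"
    by (intro landau_o.big.mult Suc.IH) real_asymp
  then have *: "(\<lambda>k. - ?c / (real k - ?c) * ((real j + 1 / 2 gchoose k) * (-1) ^ k)) \<in> O(\<lambda>k. real k powr (-5 / 2))"
    by simp
  have "(real (Suc j) + 1 / 2 gchoose k) * (-1) ^ k = - ?c / (real k - ?c) * ((real j + 1 / 2 gchoose k) * (-1) ^ k)"
    if "k \<ge> j + 2" for k
  proof -
    define A where "A = (?c gchoose k)"
    define B where "B = (real j + 1 / 2 gchoose k)"
    have c: "real j + 1 / 2 + 1 = ?c" "real (Suc j) + 1 / 2 = ?c" by simp_all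
    have "A * (?c - real k) = ?c * B"
      using gbinomial_Suc_top[of "real j + 1 / 2" k] unfolding c A_def B_def by simp
    then have "A * (real k - ?c) = - ?c * B" by (simp only: right_diff_distrib minus_mult_left[symmetric])
    moreover have "real k - ?c \<noteq> 0" using that by simp
    ultimately have "A = - ?c * B / (real k - ?c)" using nonzero_eq_divide_eq by blast
    then show ?thesis unfolding c A_def[symmetric] B_def[symmetric] by simp
  qed
  then show ?case
    by (subst landau_o.big.in_cong[OF eventually_mono[OF eventually_ge_at_top[of "j + 2"]]]) (use * in auto)
qed

text \<open>The residue class is the one that supports the coefficients; written as
  \<open>1 mod d\<close> it covers \<open>d = 1\<close>. The bound holds for every such
  \<open>n \<ge> 1\<close>, not just eventually, so that it applies to \<open>f (n - k)\<close> for
  all \<open>k < n\<close> in a convolution.\<close>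

definition sqrt_asymp :: "nat \<Rightarrow> (nat \<Rightarrow> real) \<Rightarrow> real \<Rightarrow> bool" where
  "sqrt_asymp d f \<kappa> \<longleftrightarrow> (\<exists>C. \<forall>n\<ge>1. n mod d = 1 mod d \<longrightarrow> \<bar>f n * real n powr (3 / 2) - \<kappa>\<bar> \<le> C / real n)"

lemma sqrt_asymp_add_small:
  assumes f: "sqrt_asymp d f \<kappa>" and g: "summable (\<lambda>n. \<bar>g n\<bar> * x ^ n)" "x > 1"
  shows "sqrt_asymp d (\<lambda>n. g n + f n) \<kappa>"
proof -
  obtain C where C: "\<And>n. n \<ge> 1 \<Longrightarrow> n mod d = 1 mod d \<Longrightarrow> \<bar>f n * real n powr (3 / 2) - \<kappa>\<bar> \<le> C / real n"
    using f by (auto simp: sqrt_asymp_def)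
  obtain A where A: "\<And>n. \<bar>g n\<bar> * x ^ n \<le> A"
  proof -
    have "\<bar>g n\<bar> * x ^ n \<le> (\<Sum>n. \<bar>g n\<bar> * x ^ n)" for n
      using sum_le_suminf[OF g(1), of "{n}"] g(2) by auto
    then show ?thesis using that by blast
  qed
  have "(\<lambda>n. real n powr (5 / 2) / x ^ n) \<longlonglongrightarrow> 0" using g(2) by real_asymp
  then have "Bseq (\<lambda>n. real n powr (5 / 2) / x ^ n)" by (rule convergent_imp_Bseq[OF convergentI])
  then obtain B where B: "\<And>n. norm (real n powr (5 / 2) / x ^ n) \<le> B" by (auto simp: Bseq_def)
  have "\<bar>(g n + f n) * real n powr (3 / 2) - \<kappa>\<bar> \<le> (C + A * B) / real n" if n: "n \<ge> 1" "n mod d = 1 mod d" for n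
  proof -
    have xn: "x ^ n > 0" using g by simp
    have "\<bar>g n\<bar> * real n powr (3 / 2) = (\<bar>g n\<bar> * x ^ n) * (real n powr (5 / 2) / x ^ n) / real n"
    proof -
      have "real n powr (5 / 2) = real n powr (3 / 2 + 1)" by simp
      also have "\<dots> = real n powr (3 / 2) * real n" using n by (subst powr_add) simp
      finally show ?thesis using xn n g(2) by simp
    qed
    also have "\<dots> \<le> A * B / real n"
      using A[of n] B[of n] xn by (intro divide_right_mono mult_mono') auto
    finally have 1: "\<bar>g n\<bar> * real n powr (3 / 2) \<le> A * B / real n" .
    have "(g n + f n) * real n powr (3 / 2) - \<kappa> = g n * real n powr (3 / 2) + (f n * real n powr (3 / 2) - \<kappa>)"
      by (simp add: algebra_simps)
    then have "\<bar>(g n + f n) * real n powr (3 / 2) - \<kappa>\<bar> \<le> \<bar>g n * real n powr (3 / 2)\<bar> + \<bar>f n * real n powr (3 / 2) - \<kappa>\<bar>"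
      by (simp only: abs_triangle_ineq)
    also have "\<bar>g n * real n powr (3 / 2)\<bar> = \<bar>g n\<bar> * real n powr (3 / 2)" by (simp add: abs_mult)
    also have "\<bar>g n\<bar> * real n powr (3 / 2) + \<bar>f n * real n powr (3 / 2) - \<kappa>\<bar> \<le> A * B / real n + C / real n"
      using 1 C[OF n] by linarith
    finally show ?thesis by (simp add: add_divide_distrib add.commute)
  qed
  then show ?thesis unfolding sqrt_asymp_def by blast
qed

text \<open>As \<open>n - k \<ge> 1\<close>, the ratio \<open>n / (n - k)\<close> is at most
  \<open>1 + k\<close>. The exponent 3/2 is raised to 2 to obtain polynomial bounds in
  \<open>k\<close>, which exponentially decaying weights absorb.\<close>

lemma powr_ratio_bound:
  assumes "k < n"
  shows "\<bar>real n powr (3 / 2) / real (n - k) powr (3 / 2) - 1\<bar> \<le> 3 * (1 + real k) ^ 3 / real n"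
    and "real n powr (3 / 2) / real (n - k) powr (3 / 2) \<le> (1 + real k) ^ 2"
proof -
  define j where "j = n - k"
  define r where "r = real n / real j"
  have j: "j \<ge> 1" "real n = real j + real k" using assms by (auto simp: j_def)
  have r1: "r \<ge> 1" using j by (simp add: r_def)
  have "real k * 1 \<le> real k * real j" using j by (intro mult_left_mono) auto
  then have rk: "r \<le> 1 + real k" using j by (simp add: r_def field_simps)
  have eq: "real n powr (3 / 2) / real (n - k) powr (3 / 2) = r powr (3 / 2)"
    using j by (simp add: r_def powr_divide flip: j_def)
  have "r powr (3 / 2) \<le> r powr 2" using r1 by (intro powr_mono) auto
  also have "\<dots> = r ^ 2" using r1 by simp
  finally have le2: "r powr (3 / 2) \<le> r ^ 2" .
  also have "\<dots> \<le> (1 + real k) ^ 2" using rk r1 by (intro power_mono) auto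
  finally show "real n powr (3 / 2) / real (n - k) powr (3 / 2) \<le> (1 + real k) ^ 2" unfolding eq .
  have "r - 1 = real k / real j" using j by (simp add: r_def field_simps)
  also have "\<dots> = real k * r / real n" using j by (simp add: r_def)
  also have "\<dots> \<le> (1 + real k) * (1 + real k) / real n"
    using rk r1 by (intro divide_right_mono mult_mono) auto
  finally have rm: "r - 1 \<le> (1 + real k) * (1 + real k) / real n" .
  have "r powr (3 / 2) \<ge> 1" using r1 by (intro ge_one_powr_ge_zero) auto
  then have "\<bar>r powr (3 / 2) - 1\<bar> \<le> r ^ 2 - 1" using le2 by simp
  also have "\<dots> = (r + 1) * (r - 1)" by (simp add: power2_eq_square algebra_simps)
  also have "\<dots> \<le> (3 * (1 + real k)) * ((1 + real k) * (1 + real k) / real n)"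
    using rk r1 rm by (intro mult_mono) auto
  also have "\<dots> = 3 * (1 + real k) ^ 3 / real n"
    by (simp only: power3_eq_cube times_divide_eq_right mult.assoc)
  finally show "\<bar>real n powr (3 / 2) / real (n - k) powr (3 / 2) - 1\<bar> \<le> 3 * (1 + real k) ^ 3 / real n"
    unfolding eq .
qed

lemma summable_poly_geometric:
  assumes "summable (\<lambda>n. b n * x ^ n)" "x > 1" "\<And>n. b n \<ge> (0 :: real)"
  shows "summable (\<lambda>n. b n * (1 + real n) ^ p)"
proof -
  have "(\<lambda>n. (1 + real n) ^ p / x ^ n) \<longlonglongrightarrow> 0" using assms(2) by real_asymp
  then have "Bseq (\<lambda>n. (1 + real n) ^ p / x ^ n)" by (rule convergent_imp_Bseq[OF convergentI])
  then obtain B where B: "\<And>n. norm ((1 + real n) ^ p / x ^ n) \<le> B" by (auto simp: Bseq_def)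
  show ?thesis
  proof (rule summable_comparison_test')
    show "summable (\<lambda>n. B * (b n * x ^ n))" by (intro summable_mult assms)
    fix n :: nat assume "n \<ge> 0"
    have xn: "x ^ n > 0" using assms by simp
    have "norm (b n * (1 + real n) ^ p) = (b n * x ^ n) * ((1 + real n) ^ p / x ^ n)"
      using assms(2) assms(3)[of n] xn by simp
    also have "\<dots> \<le> (b n * x ^ n) * B" using B[of n] assms(3)[of n] xn by (intro mult_left_mono) auto
    finally show "norm (b n * (1 + real n) ^ p) \<le> B * (b n * x ^ n)" by (simp add: mult.commute)
  qed
qed

text \<open>Only shifts \<open>k\<close> divisible by \<open>d\<close> preserve the residue class,
  so the new constant is \<open>\<kappa>\<close> times the sum of \<open>b k\<close> over these
  \<open>k\<close>. Replacing \<open>(n - k)^(-3/2)\<close> by \<open>n^(-3/2)\<close> costs a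
  relative error of order \<open>(1 + k)^3 / n\<close>, and \<open>b\<close> is summable against
  every polynomial.\<close>

lemma sqrt_asymp_convolution:
  assumes f: "sqrt_asymp d f \<kappa>" and supp: "\<And>n. f n \<noteq> 0 \<Longrightarrow> n \<ge> 1 \<and> n mod d = 1 mod d"
    and b: "\<And>n. b n \<ge> (0 :: real)" "summable (\<lambda>n. b n * x ^ n)" "x > 1"
  shows "\<exists>\<kappa>'. sqrt_asymp d (\<lambda>n. \<Sum>k\<le>n. b k * f (n - k)) \<kappa>'"
proof -
  obtain C where C: "\<And>n. n \<ge> 1 \<Longrightarrow> n mod d = 1 mod d \<Longrightarrow> \<bar>f n * real n powr (3 / 2) - \<kappa>\<bar> \<le> C / real n"
    using f by (auto simp: sqrt_asymp_def)
  have C0: "C \<ge> 0" using C[of 1] abs_ge_zero order_trans by fastforce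
  define b' where "b' = (\<lambda>k. if d dvd k then b k else 0)"
  have b'_nn: "b' k \<ge> 0" for k using b by (simp add: b'_def)
  have sb': "summable (\<lambda>k. b' k * (1 + real k) ^ p)" for p
  proof (rule summable_comparison_test'[OF summable_poly_geometric[OF b(2,3,1)]])
    show "norm (b' k * (1 + real k) ^ p) \<le> b k * (1 + real k) ^ p" for k
      using b(1)[of k] by (auto simp: b'_def)
  qed
  define B where "B = (\<Sum>k. b' k * (1 + real k) ^ 3)"
  define S where "S = (\<Sum>k. b' k)"
  have sb0: "summable b'" using sb'[of 0] by simp
  have main: "\<bar>(\<Sum>k\<le>n. b k * f (n - k)) * real n powr (3 / 2) - \<kappa> * S\<bar> \<le> ((C + 3 * \<bar>\<kappa>\<bar>) * B + \<bar>\<kappa>\<bar> * B) / real n"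
    if n: "n \<ge> 1" "n mod d = 1 mod d" for n
  proof -
    have mod: "(n - k) mod d = 1 mod d \<longleftrightarrow> d dvd k" if "k < n" for k
    proof -
      have "(n - k) mod d = 1 mod d \<longleftrightarrow> (n - k) mod d = n mod d" using n by simp
      also have "\<dots> \<longleftrightarrow> d dvd n - (n - k)" by (subst eq_commute, rule mod_eq_dvd_iff_nat) simp
      finally show ?thesis using that by simp
    qed
    have trm: "b k * f (n - k) * real n powr (3 / 2) =
        b' k * (f (n - k) * real n powr (3 / 2))" if "k < n" for k
      using supp[of "n - k"] mod[OF that] by (auto simp: b'_def)
    have f0: "f 0 = 0" using supp[of 0] by auto
    have "(\<Sum>k\<le>n. b k * f (n - k)) = (\<Sum>k<n. b k * f (n - k))"
      by (simp add: f0 flip: lessThan_Suc_atMost)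
    then have "(\<Sum>k\<le>n. b k * f (n - k)) * real n powr (3 / 2) - \<kappa> * (\<Sum>k<n. b' k)
        = (\<Sum>k<n. b' k * (f (n - k) * real n powr (3 / 2) - \<kappa>))"
      by (simp add: sum_distrib_right sum_distrib_left sum_subtractf[symmetric] right_diff_distrib trm mult.commute)
    also have "\<bar>\<dots>\<bar> \<le> (\<Sum>k<n. b' k * ((C + 3 * \<bar>\<kappa>\<bar>) * (1 + real k) ^ 3 / real n))"
    proof (rule order_trans[OF sum_abs], rule sum_mono)
      fix k assume "k \<in> {..<n}"
      then have k: "k < n" by simp
      show "\<bar>b' k * (f (n - k) * real n powr (3 / 2) - \<kappa>)\<bar> \<le> b' k * ((C + 3 * \<bar>\<kappa>\<bar>) * (1 + real k) ^ 3 / real n)"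
      proof (cases "d dvd k")
        case True
        let ?j = "n - k"
        let ?r = "real n powr (3 / 2) / real ?j powr (3 / 2)"
        have j: "?j \<ge> 1" "?j mod d = 1 mod d" using k mod[OF k] True by auto
        have jp: "real ?j powr (3 / 2) > 0" using j by simp
        have "f ?j * real n powr (3 / 2) - \<kappa> = (f ?j * real ?j powr (3 / 2) - \<kappa>) * ?r + \<kappa> * (?r - 1)"
          using jp by (simp add: field_simps)
        then have "\<bar>f ?j * real n powr (3 / 2) - \<kappa>\<bar> \<le> \<bar>f ?j * real ?j powr (3 / 2) - \<kappa>\<bar> * ?r + \<bar>\<kappa>\<bar> * \<bar>?r - 1\<bar>"
          using abs_triangle_ineq[of "(f ?j * real ?j powr (3 / 2) - \<kappa>) * ?r" "\<kappa> * (?r - 1)"]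
          by (simp add: abs_mult)
        also have "\<dots> \<le> (C / real ?j) * (1 + real k) ^ 2 + \<bar>\<kappa>\<bar> * (3 * (1 + real k) ^ 3 / real n)"
          using C[OF j] C0 powr_ratio_bound[OF k] by (intro add_mono mult_mono) auto
        also have "(C / real ?j) * (1 + real k) ^ 2 \<le> C * (1 + real k) ^ 3 / real n"
        proof -
          have "real n \<le> (1 + real k) * real ?j"
          proof -
            have "real k * 1 \<le> real k * real ?j" using j by (intro mult_left_mono) auto
            then show ?thesis using k by (simp add: algebra_simps of_nat_diff)
          qed
          then have "C * (1 + real k) ^ 2 * real n \<le> C * (1 + real k) ^ 2 * ((1 + real k) * real ?j)"
            using C0 by (intro mult_left_mono) auto
          then show ?thesis using j n by (simp add: field_simps power3_eq_cube power2_eq_square)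
        qed
        finally have "\<bar>f ?j * real n powr (3 / 2) - \<kappa>\<bar> \<le> (C + 3 * \<bar>\<kappa>\<bar>) * (1 + real k) ^ 3 / real n"
          by (simp add: algebra_simps add_divide_distrib)
        then have "b' k * \<bar>f ?j * real n powr (3 / 2) - \<kappa>\<bar> \<le> b' k * ((C + 3 * \<bar>\<kappa>\<bar>) * (1 + real k) ^ 3 / real n)"
          using b'_nn[of k] by (rule mult_left_mono)
        then show ?thesis using b'_nn[of k] by (simp only: abs_mult abs_of_nonneg)
      qed (simp add: b'_def)
    qed
    also have "\<dots> = (C + 3 * \<bar>\<kappa>\<bar>) / real n * (\<Sum>k<n. b' k * (1 + real k) ^ 3)"
      by (simp add: sum_distrib_left mult_ac)
    also have "\<dots> \<le> (C + 3 * \<bar>\<kappa>\<bar>) / real n * B"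
      unfolding B_def using C0 b'_nn by (intro mult_left_mono sum_le_suminf sb') auto
    finally have 1: "\<bar>(\<Sum>k\<le>n. b k * f (n - k)) * real n powr (3 / 2) - \<kappa> * (\<Sum>k<n. b' k)\<bar> \<le> (C + 3 * \<bar>\<kappa>\<bar>) / real n * B" .
    have "S - (\<Sum>k<n. b' k) = (\<Sum>k. b' (k + n))"
      unfolding S_def using suminf_split_initial_segment[OF sb0, of n] by simp
    \<comment> \<open>The tail is \<open>O(1/n)\<close> because the inserted factor is at least 1
      for indices from \<open>n\<close> on.\<close>
    moreover have "(\<Sum>k. b' (k + n)) \<le> (\<Sum>k. b' (k + n) * (1 + real (k + n)) ^ 3 / real n)"
    proof (intro suminf_le)
      show "b' (k + n) \<le> b' (k + n) * (1 + real (k + n)) ^ 3 / real n" for k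
      proof -
        have "real n * 1 \<le> (1 + real (k + n)) * (1 + real (k + n)) ^ 2"
          by (intro mult_mono one_le_power) auto
        then have "real n \<le> (1 + real (k + n)) ^ 3" by (simp add: power3_eq_cube power2_eq_square)
        then have "b' (k + n) * real n \<le> b' (k + n) * (1 + real (k + n)) ^ 3"
          using b'_nn by (intro mult_left_mono) auto
        then show ?thesis using n by (simp add: field_simps)
      qed
      show "summable (\<lambda>k. b' (k + n))" by (rule summable_ignore_initial_segment[OF sb0])
      show "summable (\<lambda>k. b' (k + n) * (1 + real (k + n)) ^ 3 / real n)"
        by (intro summable_divide) (rule summable_ignore_initial_segment[OF sb'[of 3]])
    qed
    moreover have "(\<Sum>k. b' (k + n) * (1 + real (k + n)) ^ 3 / real n) \<le> B / real n"
    proof -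
      have "(\<Sum>k. b' (k + n) * (1 + real (k + n)) ^ 3) \<le> B"
        unfolding B_def using suminf_split_initial_segment[OF sb'[of 3], of n] b'_nn
        by (simp add: sum_nonneg)
      then show ?thesis
        using summable_ignore_initial_segment[OF sb'[of 3], of n] by (subst suminf_divide) (auto intro: divide_right_mono)
    qed
    moreover have "(\<Sum>k. b' (k + n)) \<ge> 0"
      using b'_nn by (intro suminf_nonneg summable_ignore_initial_segment[OF sb0]) auto
    ultimately have "\<bar>(\<Sum>k<n. b' k) - S\<bar> \<le> B / real n" by linarith
    then have "\<bar>\<kappa>\<bar> * \<bar>(\<Sum>k<n. b' k) - S\<bar> \<le> \<bar>\<kappa>\<bar> * (B / real n)" by (intro mult_left_mono) auto
    then have 2: "\<bar>\<kappa> * (\<Sum>k<n. b' k) - \<kappa> * S\<bar> \<le> \<bar>\<kappa>\<bar> * B / real n"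
      by (simp add: abs_mult flip: right_diff_distrib)
    have "(K * B + K') / real n = K / real n * B + K' / real n" for K K' by (simp add: add_divide_distrib)
    from this[of "C + 3 * \<bar>\<kappa>\<bar>" "\<bar>\<kappa>\<bar> * B"]
    have "((C + 3 * \<bar>\<kappa>\<bar>) * B + \<bar>\<kappa>\<bar> * B) / real n = (C + 3 * \<bar>\<kappa>\<bar>) / real n * B + \<bar>\<kappa>\<bar> * B / real n" .
    then show ?thesis using 1 2 by linarith
  qed
  then show ?thesis unfolding sqrt_asymp_def by blast
qed

section \<open>Singularities of the moment generating functions\<close>

definition fps_cplx :: "real fps \<Rightarrow> complex fps" where
  "fps_cplx f = Abs_fps (\<lambda>n. of_real (fps_nth f n))"

lemma fps_cplx_nth [simp]: "fps_nth (fps_cplx f) n = of_real (fps_nth f n)"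
  by (simp add: fps_cplx_def)

lemma fps_cplx_add: "fps_cplx (f + g) = fps_cplx f + fps_cplx g"
  and fps_cplx_mult: "fps_cplx (f * g) = fps_cplx f * fps_cplx g"
  and fps_cplx_1: "fps_cplx 1 = 1" and fps_cplx_X: "fps_cplx fps_X = fps_X"
  and fps_cplx_deriv: "fps_cplx (fps_deriv f) = fps_deriv (fps_cplx f)"
  by (auto simp: fps_eq_iff fps_mult_nth fps_X_def)

lemma fps_cplx_power: "fps_cplx (f ^ n) = fps_cplx f ^ n"
  by (induction n) (auto simp: fps_cplx_mult fps_cplx_1)

lemma fps_cplx_compose: "fps_cplx (f oo g) = fps_cplx f oo fps_cplx g"
  by (auto simp: fps_eq_iff fps_compose_nth simp flip: fps_cplx_power)

lemma fps_conv_radius_cplx: "fps_conv_radius (fps_cplx f) = fps_conv_radius f"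
proof -
  have "conv_radius (fps_nth (fps_cplx f)) = conv_radius (\<lambda>n. norm (fps_nth (fps_cplx f) n))"
    by (simp add: conv_radius_def)
  also have "\<dots> = conv_radius (fps_nth f)"
    by (simp add: conv_radius_def)
  finally show ?thesis by (simp add: fps_conv_radius_def)
qed

lemma fps_conv_imp_radius: "x \<ge> 0 \<Longrightarrow> fps_conv f x \<Longrightarrow> fps_conv_radius f \<ge> ereal x"
  unfolding fps_conv_def fps_conv_radius_def using conv_radius_geI[of "fps_nth f" x] by simp

lemma eval_fps_cplx_of_real:
  assumes "fps_conv f x"
  shows "eval_fps (fps_cplx f) (of_real x) = of_real (eval_fps f x)"
proof -
  have "(\<lambda>n. of_real (fps_nth f n * x ^ n) :: complex) sums of_real (eval_fps f x)"
    using assms unfolding fps_conv_def eval_fps_def by (intro sums_of_real summable_sums)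
  then show ?thesis by (simp add: eval_fps_def sums_iff)
qed

lemma fps_cplx_summable:
  assumes "fps_nonneg f" "fps_conv f x" "norm z \<le> x"
  shows "summable (\<lambda>n. norm (of_real (fps_nth f n) * z ^ n :: complex))"
proof (rule summable_comparison_test')
  show "summable (\<lambda>n. fps_nth f n * x ^ n)" using assms by (simp add: fps_conv_def)
  show "norm (norm (of_real (fps_nth f n) * z ^ n)) \<le> fps_nth f n * x ^ n" for n
    using assms by (auto simp: norm_mult norm_power fps_nonneg_def intro!: mult_left_mono power_mono)
qed

lemma norm_eval_fps_cplx_le:
  assumes "fps_nonneg f" "fps_conv f x" "norm z \<le> x"
  shows "norm (eval_fps (fps_cplx f) z) \<le> eval_fps f x"
proof -
  have "norm (eval_fps (fps_cplx f) z) \<le> (\<Sum>n. norm (of_real (fps_nth f n) * z ^ n))"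
    unfolding eval_fps_def using summable_norm[OF fps_cplx_summable[OF assms]] by simp
  also have "\<dots> \<le> eval_fps f x"
    unfolding eval_fps_def
    using fps_cplx_summable[OF assms] assms
    by (intro suminf_le) (auto simp: norm_mult norm_power fps_nonneg_def fps_conv_def intro!: mult_left_mono power_mono)
  finally show ?thesis .
qed

lemma eval_fps_cplx_sums:
  assumes "fps_nonneg f" "fps_conv f x" "norm z \<le> x"
  shows "(\<lambda>n. of_real (fps_nth f n) * z ^ n) sums eval_fps (fps_cplx f) z"
  using summable_norm_cancel[OF fps_cplx_summable[OF assms]] by (simp add: eval_fps_def summable_sums)

lemma continuous_on_fps_cplx:
  assumes "fps_nonneg f" "fps_conv f x"
  shows "continuous_on (cball 0 x) (eval_fps (fps_cplx f))"
  unfolding eval_fps_def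
  by (rule continuous_on_powser_cball) (use assms in \<open>simp add: fps_nonneg_def fps_conv_def\<close>)

text \<open>Real parts give a vanishing sum of the nonnegative terms
  \<open>c n * (1 - Re (v n))\<close>, so \<open>Re (v n) = 1\<close> wherever \<open>c n\<close> is
  nonzero; the norm bound then leaves no imaginary part.\<close>

lemma triangle_equality_case:
  fixes c :: "nat \<Rightarrow> real" and v :: "nat \<Rightarrow> complex"
  assumes c: "\<And>n. c n \<ge> 0" "c sums s" and v: "\<And>n. norm (v n) \<le> 1"
    and eq: "(\<lambda>n. of_real (c n) * v n) sums of_real s" and n: "c n \<noteq> 0"
  shows "v n = 1"
proof -
  have "(\<lambda>n. Re (of_real (c n) * v n)) sums Re (of_real s)" by (rule sums_Re[OF eq])
  then have "(\<lambda>n. c n - c n * Re (v n)) sums (s - s)" by (intro sums_diff c) simp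
  then have z: "(\<lambda>n. c n * (1 - Re (v n))) sums 0" by (simp add: algebra_simps)
  have Re_le: "Re (v n) \<le> 1" for n using complex_Re_le_cmod[of "v n"] v[of n] by linarith
  have "c n * (1 - Re (v n)) = 0"
    using z c Re_le suminf_eq_zero_iff[of "\<lambda>n. c n * (1 - Re (v n))"] by (auto simp: sums_iff)
  then have Re: "Re (v n) = 1" using n by simp
  have "(Re (v n))\<^sup>2 + (Im (v n))\<^sup>2 \<le> 1"
    using v[of n] by (metis cmod_power2 norm_ge_zero power_le_one)
  then have "Im (v n) = 0" using Re by simp
  with Re show ?thesis by (simp add: complex_eq_iff)
qed

section \<open>Period of the weights and the functional equation on the closed disc\<close>

context gen_weights
begin

definition period :: nat where "period = Gcd {k. w k \<noteq> 0}"

lemma period_dvd: "w k \<noteq> 0 \<Longrightarrow> period dvd k"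
  unfolding period_def by (rule Gcd_dvd) simp

lemma period_pos: "period > 0"
proof -
  obtain k where "k \<ge> 2" "w k > 0" by (rule ex_weight_ge_2)
  then have "period dvd k" "k > 0" using period_dvd[of k] by auto
  then show ?thesis using dvd_pos_nat by blast
qed

text \<open>The order of \<open>\<zeta>\<close> divides every index of nonzero weight, hence their
  gcd.\<close>

lemma root_of_unity_period:
  fixes \<zeta> :: complex
  assumes "\<And>k. w k \<noteq> 0 \<Longrightarrow> \<zeta> ^ k = 1"
  shows "\<zeta> ^ period = 1"
proof -
  obtain k0 where "k0 \<ge> 2" "w k0 > 0" by (rule ex_weight_ge_2)
  then have ex: "k0 > 0 \<and> \<zeta> ^ k0 = 1" using assms[of k0] by auto
  define m where "m = (LEAST k. k > 0 \<and> \<zeta> ^ k = 1)"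
  have m: "m > 0" "\<zeta> ^ m = 1" using LeastI[of "\<lambda>k. k > 0 \<and> \<zeta> ^ k = 1", OF ex] by (auto simp: m_def)
  have "m dvd k" if "w k \<noteq> 0" for k
  proof -
    have "\<zeta> ^ k = \<zeta> ^ (m * (k div m) + k mod m)" by simp
    also have "\<dots> = \<zeta> ^ (k mod m)" unfolding power_add power_mult using m by simp
    finally have "\<zeta> ^ (k mod m) = 1" using assms[OF that] by simp
    moreover have "k mod m < m" using m by simp
    ultimately have "k mod m = 0"
      using not_less_Least[of "k mod m" "\<lambda>k. k > 0 \<and> \<zeta> ^ k = 1"] by (auto simp: m_def)
    then show ?thesis by auto
  qed
  then have "m dvd period" unfolding period_def by (intro Gcd_greatest) auto
  then show ?thesis using m by (metis dvdE power_mult power_one)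
qed

lemma weight_size_mod:
  "tree_weight w T \<noteq> 0 \<Longrightarrow> num_nodes T mod period = 1 mod period"
proof (induction T)
  case (Node ts)
  have len: "period dvd length ts" using Node.prems by (intro period_dvd) (auto simp: tree_weight_Node)
  have ch: "tree_weight w t \<noteq> 0" if "t \<in> set ts" for t
    using Node.prems that by (auto simp: tree_weight_Node prod_list_zero_iff)
  have "(\<Sum>t\<leftarrow>us. num_nodes t) mod period = length us mod period" if "set us \<subseteq> set ts" for us
    using that
  proof (induction us)
    case (Cons t us)
    then have "num_nodes t mod period = 1 mod period" using Node.IH ch by simp
    then have "(num_nodes t + (\<Sum>t\<leftarrow>us. num_nodes t)) mod period = (1 + length us) mod period"
      using Cons by (intro mod_add_cong) auto
    then show ?case by simp
  qed simp
  then have "(\<Sum>t\<leftarrow>ts. num_nodes t) mod period = 0 mod period" using len by simp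
  then have "(1 + (\<Sum>t\<leftarrow>ts. num_nodes t)) mod period = (1 + 0) mod period" by (rule mod_add_cong[OF refl])
  then show ?case by (simp add: num_nodes_Node_list)
qed

lemma gf_supp: "fps_nth (gf (\<lambda>T. tree_weight w T * g T)) n \<noteq> 0 \<Longrightarrow> n \<ge> 1 \<and> n mod period = 1 mod period"
proof -
  assume nz: "fps_nth (gf (\<lambda>T. tree_weight w T * g T)) n \<noteq> 0"
  have "\<exists>T\<in>trees_of_size n. tree_weight w T \<noteq> 0"
  proof (rule ccontr)
    assume "\<not> (\<exists>T\<in>trees_of_size n. tree_weight w T \<noteq> 0)"
    then show False using nz by (simp add: gf_def)
  qed
  then obtain T where "T \<in> trees_of_size n" "tree_weight w T \<noteq> 0" by blast
  then show ?thesis using weight_size_mod[of T] num_nodes_pos[of T] by (auto simp: trees_of_size_def)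
qed

lemma moment_gf_supp: "fps_nth (moment_gf w l m) n \<noteq> 0 \<Longrightarrow> n \<ge> 1 \<and> n mod period = 1 mod period"
  unfolding moment_gf_def mult.assoc by (rule gf_supp)

lemma moment_gf1_supp: "fps_nth (moment_gf1 w l m) n \<noteq> 0 \<Longrightarrow> n \<ge> 1 \<and> n mod period = 1 mod period"
  unfolding moment_gf1_altdef mult.assoc by (rule gf_supp)

lemma Y_1_pos: "fps_nth (Y m) 1 > 0"
proof -
  have "fps_nth (Y m) 1 = fps_nth (F m) 1 + fps_nth (lower_part m) 1" by (simp add: Y_decomp)
  moreover have "fps_nth (F m) 1 = w 0" by (subst F_eq) (simp add: fps_compose_nth)
  moreover have "fps_nth (lower_part m) 1 \<ge> 0" using lower_part_nonneg by (simp add: fps_nonneg_def)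
  ultimately show ?thesis using w_0 by simp
qed

lemma conv_Y_rad: "fps_conv (Y m) (rad m)"
  unfolding moment_gf1_def
  by (intro fps_conv_sum fps_conv_mult fps_nonneg_const conv_F_rad) (use rad_pos[of m] in auto)

lemma lower_part_conv_beyond: "\<exists>x>rad m. fps_conv (lower_part m) x"
proof (cases m)
  case 0
  then show ?thesis by (intro exI[of _ "rad m + 1"]) (simp add: lower_part_def)
next
  case (Suc m')
  have "fps_conv (lower_part m) (rad m')"
    using conv_F_rad[of _ m'] rad_pos[of m'] by (intro lower_part_conv) (auto simp: Suc)
  then show ?thesis using rad_Suc[of m'] Suc by auto
qed

lemma deriv_eval_cplx:
  assumes "norm z < R" "ereal R \<le> fps_conv_radius f"
  shows "deriv (eval_fps (fps_cplx f)) z = eval_fps (fps_cplx (fps_deriv f)) z"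
proof -
  have "z \<in> eball 0 (fps_conv_radius (fps_cplx f))"
    using assms by (auto simp: fps_conv_radius_cplx dist_norm intro: less_le_trans[of _ "ereal R"])
  then show ?thesis unfolding fps_cplx_deriv by (intro DERIV_imp_deriv has_field_derivative_eval_fps) auto
qed

lemma hol_eval_cplx:
  assumes "ereal R \<le> fps_conv_radius f"
  shows "eval_fps (fps_cplx f) holomorphic_on ball 0 R"
proof (rule holomorphic_on_eval_fps)
  show "ball 0 R \<subseteq> eball 0 (fps_conv_radius (fps_cplx f))"
    using ball_eball_mono[OF assms] by (simp add: fps_conv_radius_cplx)
qed

text \<open>An identity of formal series holds for the functions near 0, extends over the open disc
  by analytic continuation, since \<open>Y m\<close> maps it into the disc of \<open>\<Phi>\<close>,
  and reaches the boundary circle by continuity.\<close>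

lemma Y_cplx_eq:
  assumes z: "z \<in> cball 0 (rad m)"
  shows "eval_fps (fps_cplx (Y m)) z = eval_fps (fps_cplx (lower_part m)) z
     + z * eval_fps (fps_cplx phi) (eval_fps (fps_cplx (Y m)) z)"
proof -
  let ?r = "rad m"
  let ?Y = "eval_fps (fps_cplx (Y m))" and ?G = "eval_fps (fps_cplx (lower_part m))" and ?P = "eval_fps (fps_cplx phi)"
  have r: "?r > 0" by (rule rad_pos)
  obtain RP where RP: "crit m < RP" "ereal RP < conv_radius w"
    using ereal_dense2[of "ereal (crit m)" "conv_radius w"] crit_disc[of m] by auto
  have RP': "ereal RP \<le> fps_conv_radius phi" using RP by (simp add: radius_phi)
  have Yle: "norm (?Y z) \<le> crit m" if "z \<in> cball 0 ?r" for z
    using norm_eval_fps_cplx_le[OF moment_gf1_nonneg conv_Y_rad, of z m] that by (simp add: crit_def)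
  have contY: "continuous_on (cball 0 ?r) ?Y"
    by (rule continuous_on_fps_cplx[OF moment_gf1_nonneg conv_Y_rad])
  obtain x where x: "x > ?r" "fps_conv (lower_part m) x" using lower_part_conv_beyond by blast
  have radG: "ereal x \<le> fps_conv_radius (lower_part m)"
    using x r by (intro fps_conv_imp_radius) auto
  have contG: "continuous_on (cball 0 ?r) ?G"
    by (rule continuous_on_fps_cplx[OF lower_part_nonneg]) (rule fps_conv_mono(1)[OF lower_part_nonneg _ _ x(2)], use x r in auto)
  have contP: "continuous_on (ball 0 RP) ?P"
    using hol_eval_cplx[OF RP'] holomorphic_on_imp_continuous_on by blast
  have radY: "ereal ?r \<le> fps_conv_radius (Y m)" using conv_Y_rad r by (intro fps_conv_imp_radius) auto
  define D where "D = (\<lambda>z. ?G z + z * ?P (?Y z) - ?Y z)"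
  have YRP: "?Y ` cball 0 ?r \<subseteq> ball 0 RP" using Yle RP by force
  have holP: "(\<lambda>z. ?P (?Y z)) holomorphic_on ball 0 ?r"
    by (rule holomorphic_on_compose_gen[OF hol_eval_cplx[OF radY] hol_eval_cplx[OF RP'], unfolded o_def])
       (use YRP in auto)
  have holD: "D holomorphic_on ball 0 ?r"
    unfolding D_def
    by (intro holomorphic_intros holP hol_eval_cplx[OF radY] hol_eval_cplx order_trans[OF _ radG]) (use x in auto)
  have pos: "fps_conv_radius (fps_cplx (Y m)) > 0" "fps_conv_radius (fps_cplx phi) > 0"
    "fps_conv_radius (fps_cplx (lower_part m)) > 0"
  proof -
    have "fps_conv_radius (Y m) > 0" by (rule less_le_trans[OF _ radY]) (use r in simp)
    moreover have "fps_conv_radius phi > 0" by (rule less_le_trans[OF _ RP']) (use RP crit_pos[of m] in simp)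
    moreover have "fps_conv_radius (lower_part m) > 0" by (rule less_le_trans[OF _ radG]) (use x r in simp)
    ultimately show "fps_conv_radius (fps_cplx (Y m)) > 0" "fps_conv_radius (fps_cplx phi) > 0"
      "fps_conv_radius (fps_cplx (lower_part m)) > 0"
      by (simp_all only: fps_conv_radius_cplx)
  qed
  have "(?P \<circ> ?Y) has_fps_expansion (fps_cplx phi oo fps_cplx (Y m))"
    using pos by (intro has_fps_expansion_compose eval_fps_has_fps_expansion) auto
  then have "D has_fps_expansion (fps_cplx (lower_part m) + fps_X * (fps_cplx phi oo fps_cplx (Y m)) - fps_cplx (Y m))"
    unfolding D_def o_def using pos
    by (intro has_fps_expansion_add has_fps_expansion_diff has_fps_expansion_mult has_fps_expansion_fps_X eval_fps_has_fps_expansion)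
  also have "fps_cplx (lower_part m) + fps_X * (fps_cplx phi oo fps_cplx (Y m)) - fps_cplx (Y m) = 0"
  proof -
    have "Y m = fps_X * (phi oo Y m) + lower_part m" using Y_decomp F_eq by metis
    from arg_cong[OF this, of fps_cplx]
    have "fps_cplx (Y m) = fps_X * (fps_cplx phi oo fps_cplx (Y m)) + fps_cplx (lower_part m)"
      by (simp only: fps_cplx_add fps_cplx_mult fps_cplx_X fps_cplx_compose)
    then show ?thesis unfolding right_minus_eq add.commute[of "fps_cplx (lower_part m)"] by (rule sym)
  qed
  finally have "eventually (\<lambda>z. D z = 0) (nhds 0)" by (simp add: has_fps_expansion_def eval_fps_def)
  then obtain e where e: "e > 0" "\<And>z. dist z 0 < e \<Longrightarrow> D z = 0"
    by (auto simp: eventually_nhds_metric)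
  have zero: "D z = 0" if z: "z \<in> ball 0 ?r" for z
  proof (rule analytic_continuation_open[of "ball 0 (min e ?r)" "ball 0 ?r" D "\<lambda>_. 0"])
    show "D z = 0" if "z \<in> ball 0 (min e (rad m))" for z using e(2)[of z] that by simp
  qed (use z holD e r in auto)
  have contD: "continuous_on (cball 0 ?r) D"
    unfolding D_def
    by (intro continuous_intros contG contY continuous_on_compose2[OF contP contY YRP])
  have "D z = 0"
  proof -
    have "closure (ball 0 ?r) = cball (0 :: complex) ?r" using r by (intro closure_ball)
    then show ?thesis
      using continuous_constant_on_closure[of "ball 0 ?r" D 0 z] contD zero z by simp
  qed
  then show ?thesis by (simp add: D_def)
qed

end

lemma of_real_gbinomial: "(of_real (a gchoose k) :: complex) = (of_real a gchoose k)"
  by (simp add: gbinomial_prod_rev)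

lemma mod_eq_1_iff: "n \<ge> 1 \<Longrightarrow> n mod d = 1 mod d \<longleftrightarrow> (\<exists>k. n = d * k + (1 :: nat))"
proof
  assume "n \<ge> 1" "n mod d = 1 mod d"
  then have "d dvd n - 1" by (subst (asm) mod_eq_dvd_iff_nat) auto
  then obtain k where "n - 1 = d * k" by (elim dvdE)
  then show "\<exists>k. n = d * k + 1" using \<open>n \<ge> 1\<close> by (intro exI[of _ k]) simp
next
  assume "\<exists>k. n = d * k + 1"
  then show "n mod d = 1 mod d" by (metis mod_mult_self4)
qed

text \<open>The finitely many \<open>n\<close> before the asymptotic range are absorbed by the sum
  \<open>S\<close>, and \<open>n \<le> (d + 1) k\<close> converts \<open>1 / k\<close> into
  \<open>1 / n\<close>.\<close>

lemma sqrt_asympI: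
  assumes d: "d > 0" and "(\<lambda>k. f (d * k + 1) * real (d * k + 1) powr (3 / 2) - \<kappa>) \<in> O(\<lambda>k. 1 / real k)"
  shows "sqrt_asymp d f \<kappa>"
proof -
  define E where "E = (\<lambda>n. \<bar>f n * real n powr (3 / 2) - \<kappa>\<bar>)"
  obtain C where C: "C > 0" "\<forall>\<^sub>F k in sequentially. norm (f (d * k + 1) * real (d * k + 1) powr (3 / 2) - \<kappa>) \<le> C * norm (1 / real k)"
    by (rule landau_o.bigE[OF assms(2)])
  then obtain K where K: "\<And>k. k \<ge> K \<Longrightarrow> E (d * k + 1) \<le> C * (1 / real k)"
    by (auto simp: eventually_at_top_linorder E_def)
  define S where "S = (\<Sum>n\<le>d * Suc K + 1. E n * real n)"
  have E0: "E n \<ge> 0" for n by (simp add: E_def)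
  have S0: "S \<ge> 0" unfolding S_def by (intro sum_nonneg mult_nonneg_nonneg E0) auto
  have "E n \<le> (S + C * (real d + 1)) / real n" if n: "n \<ge> 1" "n mod d = 1 mod d" for n
  proof (cases "n \<le> d * Suc K + 1")
    case True
    have "E n * real n \<le> S" unfolding S_def using True by (intro member_le_sum) (auto intro: mult_nonneg_nonneg E0)
    also have "\<dots> \<le> S + C * (real d + 1)" using C by simp
    finally show ?thesis using n by (simp add: field_simps)
  next
    case False
    obtain k where k: "n = d * k + 1" using n mod_eq_1_iff by blast
    with False have "\<not> k \<le> Suc K" using mult_le_mono2[of k "Suc K" d] by linarith
    then have kK: "k \<ge> K" "k \<ge> 1" by auto
    have "real n \<le> (real d + 1) * real k" using kK by (simp add: k algebra_simps)
    then have "C * real n \<le> C * ((real d + 1) * real k)" using C by (intro mult_left_mono) auto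
    also have "\<dots> \<le> (S + C * (real d + 1)) * real k"
      using S0 by (simp add: algebra_simps)
    finally have "C * (1 / real k) \<le> (S + C * (real d + 1)) / real n"
      using kK n by (simp add: field_simps)
    then show ?thesis using K[OF kK(1)] k by simp
  qed
  then show ?thesis unfolding sqrt_asymp_def E_def by blast
qed

text \<open>A reversed order of the constants would show at large \<open>n = d k + 1\<close>, once
  both errors together are below the gap. With \<open>g = 0\<close> this gives nonnegativity;
  comparison with \<open>F\<close> gives positivity for the mixed moments.\<close>

lemma sqrt_asymp_nonneg:
  assumes f: "sqrt_asymp d f \<kappa>" and d: "d > 0" and g: "\<And>n. n \<ge> 1 \<Longrightarrow> n mod d = 1 mod d \<Longrightarrow> g n \<le> f n"
    and g': "sqrt_asymp d g \<mu>"
  shows "\<mu> \<le> \<kappa>"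
proof (rule ccontr)
  assume "\<not> \<mu> \<le> \<kappa>"
  then have pos: "\<mu> - \<kappa> > 0" by simp
  obtain C where C: "\<And>n. n \<ge> 1 \<Longrightarrow> n mod d = 1 mod d \<Longrightarrow> \<bar>f n * real n powr (3 / 2) - \<kappa>\<bar> \<le> C / real n"
    using f by (auto simp: sqrt_asymp_def)
  obtain C' where C': "\<And>n. n \<ge> 1 \<Longrightarrow> n mod d = 1 mod d \<Longrightarrow> \<bar>g n * real n powr (3 / 2) - \<mu>\<bar> \<le> C' / real n"
    using g' by (auto simp: sqrt_asymp_def)
  obtain k where k: "real k > (C + C') / (\<mu> - \<kappa>)" using reals_Archimedean2 by blast
  define n where "n = d * k + 1"
  have n: "n \<ge> 1" "n mod d = 1 mod d" unfolding n_def by (simp, rule mod_mult_self4)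
  have "1 * k \<le> d * k" using d by (intro mult_le_mono1) simp
  then have "k \<le> n" unfolding n_def mult_1 by linarith
  then have "real n > (C + C') / (\<mu> - \<kappa>)" using k by linarith
  then have "(C + C') / real n < \<mu> - \<kappa>" using pos n by (simp add: field_simps)
  moreover have "g n * real n powr (3 / 2) \<le> f n * real n powr (3 / 2)"
    using g[OF n] by (intro mult_right_mono) auto
  ultimately show False using C[OF n] C'[OF n] by (simp add: add_divide_distrib abs_le_iff)
qed

context sqrt_schema
begin

text \<open>The singular expansion only provides a complex \<open>b 0 \<noteq> 0\<close>. Real
  coefficients force its imaginary part to vanish, since a term of exact order
  \<open>k^(-3/2)\<close> is not \<open>O(k^(-5/2))\<close>; nonnegative coefficients then fix the
  sign.\<close>

lemma real_coeff_asymptotics: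
  assumes a: "\<And>n. a n = of_real (y n)" and y: "\<And>n. y n \<ge> 0"
  shows "\<exists>\<kappa>>0. sqrt_asymp d (\<lambda>n. y n * \<rho> ^ n) \<kappa>"
proof -
  obtain b C where b: "b 0 \<noteq> 0"
    "\<And>n. n \<ge> 3 \<Longrightarrow> norm (a n - (\<Sum>j<3. b j * sing_coeff j n)) * \<rho> ^ n \<le> C / real n ^ 3"
    using coeff_asymptotics by blast
  define e where "e = (\<lambda>j k. (real j + 1 / 2 gchoose k) * (-1) ^ k)"
  define n where "n = (\<lambda>k. d * k + 1)"
  define x where "x = (\<lambda>k. y (n k) * \<rho> ^ n k)"
  define T where "T = (\<lambda>k. of_real (x k) - of_real \<rho> * (\<Sum>j<3. b j * of_real (e j k)))"
  have sc: "sing_coeff j (n k) * of_real \<rho> ^ n k = of_real \<rho> * of_real (e j k)" for j k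
  proof -
    have "(n k - 1) div d = k" "n k - 1 = d * k" using d by (simp_all add: n_def)
    moreover have "n k \<in> range (\<lambda>k. d * k + 1)" unfolding n_def by (rule rangeI)
    ultimately have "sing_coeff j (n k) = ((of_nat j + 1 / 2) gchoose k) * (-1) ^ k / r0 ^ (d * k)"
      unfolding sing_coeff_def by simp
    moreover have "(of_nat j + 1 / 2 :: complex) gchoose k = of_real (real j + 1 / 2 gchoose k)"
      by (simp add: of_real_gbinomial)
    ultimately show ?thesis using \<rho> by (simp add: e_def n_def)
  qed
  have T_bound: "norm (T k) \<le> C / real (n k) ^ 3" if "k \<ge> 2" for k
  proof -
    have "n k \<ge> 3" using that d by (cases d) (auto simp: n_def)
    have "T k = (a (n k) - (\<Sum>j<3. b j * sing_coeff j (n k))) * of_real \<rho> ^ n k"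
      by (simp add: T_def x_def a left_diff_distrib sum_distrib_right sum_distrib_left mult.assoc sc mult.left_commute)
    then have "norm (T k) = norm (a (n k) - (\<Sum>j<3. b j * sing_coeff j (n k))) * \<rho> ^ n k"
      using \<rho> by (simp add: norm_mult norm_power)
    then show ?thesis using b(2)[OF \<open>n k \<ge> 3\<close>] by simp
  qed
  have n_bigo: "(\<lambda>k. C / real (n k) ^ 3) \<in> O(\<lambda>k. real k powr (-5 / 2))"
  proof -
    have dp: "real d > 0" using d by simp
    have "(\<lambda>k. C / (real d * real k + 1) ^ 3) \<in> O(\<lambda>k. real k powr (-5 / 2))"
      using dp by real_asymp
    then show ?thesis by (simp add: n_def add.commute)
  qed
  have T_bigo: "(\<lambda>k. h (T k)) \<in> O(\<lambda>k. real k powr (-5 / 2))" if "\<And>z. \<bar>h z\<bar> \<le> norm z" for h :: "complex \<Rightarrow> real"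
  proof (rule landau_o.big_trans[OF _ n_bigo], rule bigoI[of _ 1])
    show "\<forall>\<^sub>F k in sequentially. norm (h (T k)) \<le> 1 * norm (C / real (n k) ^ 3)"
      using eventually_ge_at_top[of 2]
    proof eventually_elim
      case (elim k)
      have "norm (h (T k)) \<le> norm (T k)" using that by simp
      also have "\<dots> \<le> C / real (n k) ^ 3" by (rule T_bound[OF elim])
      also have "\<dots> \<le> norm (C / real (n k) ^ 3)" unfolding real_norm_def by (rule abs_ge_self)
      finally show ?case by simp
    qed
  qed
  obtain c where c: "c > 0" "(\<lambda>k. half_coeff k - c * real k powr (-3 / 2)) \<in> O(\<lambda>k. real k powr (-5 / 2))"
    by (rule half_coeff_asymp)
  have e0: "e 0 k = - half_coeff k" for k by (simp add: e_def half_coeff_def)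
  have e12: "e 1 \<in> O(\<lambda>k. real k powr (-5 / 2))" "e 2 \<in> O(\<lambda>k. real k powr (-5 / 2))"
    unfolding e_def using gbinomial_half_bigo[of 1] gbinomial_half_bigo[of 2] by auto
  have scale: "(\<lambda>k. \<beta> * g k) \<in> O(\<lambda>k. real k powr (-5 / 2))" if "g \<in> O(\<lambda>k. real k powr (-5 / 2))"
    for \<beta> :: real and g by (cases "\<beta> = 0") (use that in simp_all)
  have rest: "(\<lambda>k. \<rho> * (\<beta> * (half_coeff k - c * real k powr (-3 / 2)) - \<gamma> * e 1 k - \<delta> * e 2 k))
      \<in> O(\<lambda>k. real k powr (-5 / 2))" for \<beta> \<gamma> \<delta>
    by (intro scale sum_in_bigo(2) c e12)
  have ReT: "Re (T k) = x k + \<rho> * (Re (b 0) * half_coeff k - Re (b 1) * e 1 k - Re (b 2) * e 2 k)" for k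
    by (simp add: T_def numeral_3_eq_3 numeral_2_eq_2 e0 algebra_simps)
  have ImT: "Im (T k) = \<rho> * (Im (b 0) * half_coeff k - Im (b 1) * e 1 k - Im (b 2) * e 2 k)" for k
    by (simp add: T_def numeral_3_eq_3 numeral_2_eq_2 e0 algebra_simps)
  have "(\<lambda>k. Im (T k) - \<rho> * (Im (b 0) * (half_coeff k - c * real k powr (-3 / 2)) - Im (b 1) * e 1 k - Im (b 2) * e 2 k))
      \<in> O(\<lambda>k. real k powr (-5 / 2))"
    by (intro sum_in_bigo rest T_bigo abs_Im_le_cmod)
  then have "(\<lambda>k. (\<rho> * Im (b 0) * c) * real k powr (-3 / 2)) \<in> O(\<lambda>k. real k powr (-5 / 2))"
    by (simp add: ImT algebra_simps)
  moreover have "(\<lambda>k. real k powr (-5 / 2)) \<in> o(\<lambda>k. real k powr (-3 / 2))" by real_asymp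
  ultimately have "(\<lambda>k. (\<rho> * Im (b 0) * c) * real k powr (-3 / 2)) \<in> o(\<lambda>k. real k powr (-3 / 2))"
    by (rule landau_o.big_small_trans)
  then have Im0: "Im (b 0) = 0"
  proof -
    have "eventually (\<lambda>k. real k powr (-3 / 2) \<noteq> 0) sequentially"
      using eventually_gt_at_top[of 0] by eventually_elim auto
    moreover assume "(\<lambda>k. (\<rho> * Im (b 0) * c) * real k powr (-3 / 2)) \<in> o(\<lambda>k. real k powr (-3 / 2))"
    ultimately have "(\<lambda>k. (\<rho> * Im (b 0) * c) * real k powr (-3 / 2) / real k powr (-3 / 2)) \<longlonglongrightarrow> 0"
      using smalloD_tendsto by blast
    then have "(\<lambda>k. \<rho> * Im (b 0) * c) \<longlonglongrightarrow> 0"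
      by (rule Lim_transform_eventually) (use eventually_gt_at_top[of 0] in eventually_elim, auto)
    then have "\<rho> * Im (b 0) * c = 0" by (simp add: LIMSEQ_const_iff)
    then show ?thesis using \<rho> c by simp
  qed
  define \<beta> where "\<beta> = - (\<rho> * Re (b 0) * c)"
  have \<beta>: "\<beta> \<noteq> 0" using b(1) Im0 \<rho> c by (auto simp: \<beta>_def complex_eq_iff)
  have "(\<lambda>k. Re (T k) - \<rho> * (Re (b 0) * (half_coeff k - c * real k powr (-3 / 2)) - Re (b 1) * e 1 k - Re (b 2) * e 2 k))
      \<in> O(\<lambda>k. real k powr (-5 / 2))"
    by (intro sum_in_bigo rest T_bigo abs_Re_le_cmod)
  then have xb: "(\<lambda>k. x k - \<beta> * real k powr (-3 / 2)) \<in> O(\<lambda>k. real k powr (-5 / 2))"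
    by (simp add: ReT \<beta>_def algebra_simps)
  \<comment> \<open>The expansion so far is in \<open>k\<close>, where \<open>n = d k + 1\<close>;
    passing to powers of \<open>n\<close> multiplies the constant by \<open>d^(3/2)\<close>.\<close>
  define \<kappa> where "\<kappa> = \<beta> * real d powr (3 / 2)"
  have dp: "real d > 0" using d by simp
  have "(\<lambda>k. (x k - \<beta> * real k powr (-3 / 2)) * real (n k) powr (3 / 2)) \<in> O(\<lambda>k. real k powr (-5 / 2) * real k powr (3 / 2))"
  proof (intro landau_o.big.mult xb)
    have "(\<lambda>k. (real d * real k + 1) powr (3 / 2)) \<in> O(\<lambda>k. real k powr (3 / 2))" using dp by real_asymp
    then show "(\<lambda>k. real (n k) powr (3 / 2)) \<in> O(\<lambda>k. real k powr (3 / 2))" by (simp add: n_def add.commute)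
  qed
  also have "(\<lambda>k. real k powr (-5 / 2) * real k powr (3 / 2)) \<in> O(\<lambda>k. 1 / real k)" by real_asymp
  finally have 1: "(\<lambda>k. (x k - \<beta> * real k powr (-3 / 2)) * real (n k) powr (3 / 2)) \<in> O(\<lambda>k. 1 / real k)" .
  have 2: "(\<lambda>k. \<beta> * (real k powr (-3 / 2) * real (n k) powr (3 / 2) - real d powr (3 / 2))) \<in> O(\<lambda>k. 1 / real k)"
  proof -
    have "(\<lambda>k. real k powr (-3 / 2) * (real d * real k + 1) powr (3 / 2) - real d powr (3 / 2)) \<in> O(\<lambda>k. 1 / real k)"
      using dp by real_asymp
    then show ?thesis by (simp add: n_def add.commute)
  qed
  from sum_in_bigo(1)[OF 1 2]
  have "(\<lambda>k. x k * real (n k) powr (3 / 2) - \<kappa>) \<in> O(\<lambda>k. 1 / real k)"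
    by (simp add: \<kappa>_def algebra_simps)
  then have asymp: "sqrt_asymp d (\<lambda>n. y n * \<rho> ^ n) \<kappa>"
    by (intro sqrt_asympI d) (simp add: x_def n_def)
  have "0 \<le> \<kappa>"
    by (rule sqrt_asymp_nonneg[OF asymp d, of "\<lambda>_. 0"]) (use y \<rho> in \<open>auto simp: sqrt_asymp_def intro!: exI[of _ 0]\<close>)
  moreover have "\<kappa> \<noteq> 0" using \<beta> dp by (simp add: \<kappa>_def)
  ultimately show ?thesis using asymp by (intro exI[of _ \<kappa>]) auto
qed

end

section \<open>Asymptotics of the moment coefficients\<close>

context gen_weights
begin

lemma sqrt_schema_moment_gf:
  "\<exists>rG rP. sqrt_schema (eval_fps (fps_cplx (lower_part m))) (eval_fps (fps_cplx phi)) (eval_fps (fps_cplx (Y m)))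
     (rad m) (crit m) rG rP period (\<lambda>n. of_real (fps_nth (Y m) n))"
proof -
  let ?r = "rad m" and ?t = "crit m"
  let ?Y = "eval_fps (fps_cplx (Y m))" and ?G = "eval_fps (fps_cplx (lower_part m))" and ?P = "eval_fps (fps_cplx phi)"
  have r: "?r > 0" and t: "?t > 0" by (rule rad_pos crit_pos)+
  obtain rP where rP: "?t < rP" "ereal rP < conv_radius w"
    using ereal_dense2[of "ereal ?t" "conv_radius w"] crit_disc[of m] by auto
  have rP': "ereal rP \<le> fps_conv_radius phi" using rP by (simp add: radius_phi)
  have rP'': "ereal rP \<le> fps_conv_radius (fps_deriv phi)"
    using rP' fps_conv_radius_deriv[of phi] by (rule order_trans)
  obtain rG where rG: "rG > ?r" "fps_conv (lower_part m) rG" using lower_part_conv_beyond by blast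
  have radG: "ereal rG \<le> fps_conv_radius (lower_part m)"
    using rG r by (intro fps_conv_imp_radius) auto
  have Yle: "norm (?Y z) \<le> ?t" if "norm z \<le> ?r" for z
    using norm_eval_fps_cplx_le[OF moment_gf1_nonneg conv_Y_rad that] by (simp add: crit_def)
  have dP: "deriv ?P z = eval_fps (fps_cplx (fps_deriv phi)) z" if "norm z < rP" for z
    by (rule deriv_eval_cplx[OF that rP'])
  have Yt: "?Y (of_real ?r) = of_real ?t"
    using eval_fps_cplx_of_real[OF conv_Y_rad] by (simp add: crit_def)
  have dPt: "deriv ?P (of_real ?t) = of_real (\<Phi>' ?t)"
    using dP[of "of_real ?t"] t rP eval_fps_cplx_of_real[OF conv_phi'[OF crit_disc]] by simp
  have "sqrt_schema ?G ?P ?Y ?r ?t rG rP period (\<lambda>n. of_real (fps_nth (Y m) n))"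
  proof
    show "0 < ?r" "?r < rG" "0 < ?t" "?t < rP" "period > 0" using r rG t rP period_pos by auto
    show "?G holomorphic_on ball 0 rG" by (rule hol_eval_cplx[OF radG])
    show "?P holomorphic_on ball 0 rP" by (rule hol_eval_cplx[OF rP'])
    show "continuous_on (cball 0 ?r) ?Y" by (rule continuous_on_fps_cplx[OF moment_gf1_nonneg conv_Y_rad])
    show "norm (?Y z) \<le> ?t" if "z \<in> cball 0 ?r" for z using Yle that by simp
    show "?Y z = ?G z + z * ?P (?Y z)" if "z \<in> cball 0 ?r" for z by (rule Y_cplx_eq[OF that])
    show "?Y (of_real ?r) = of_real ?t" by (rule Yt)
    show "of_real ?r * deriv ?P (of_real ?t) = 1"
      unfolding dPt using rad_crit[of m] by (metis of_real_1 of_real_mult)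
    show "deriv (deriv ?P) (of_real ?t) \<noteq> 0"
    proof -
      have "deriv (deriv ?P) (of_real ?t) = deriv (eval_fps (fps_cplx (fps_deriv phi))) (of_real ?t)"
        by (rule deriv_cong_ev) (use dP rP t in \<open>auto simp: eventually_nhds intro!: exI[of _ "ball 0 rP"]\<close>)
      also have "\<dots> = eval_fps (fps_cplx (fps_deriv (fps_deriv phi))) (of_real ?t)"
        using rP t by (intro deriv_eval_cplx[OF _ rP'']) auto
      also have conv: "fps_conv (fps_deriv (fps_deriv phi)) ?t"
        using t rP rP'' fps_conv_radius_deriv[of "fps_deriv phi"]
        by (intro fps_conv_radiusI) (auto intro: less_le_trans[of _ "ereal rP"])
      have "eval_fps (fps_cplx (fps_deriv (fps_deriv phi))) (of_real ?t) = of_real (eval_fps (fps_deriv (fps_deriv phi)) ?t)"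
        by (rule eval_fps_cplx_of_real[OF conv])
      moreover have "eval_fps (fps_deriv (fps_deriv phi)) ?t > 0"
      proof -
        obtain k where k: "k \<ge> 2" "w k > 0" by (rule ex_weight_ge_2)
        then obtain k' where k': "k = k' + 2" by (metis add.commute le_Suc_ex)
        show ?thesis unfolding eval_fps_def
          using conv t w_nonneg k k' by (intro suminf_pos2[of _ k']) (auto simp: fps_conv_def)
      qed
      ultimately show ?thesis by simp
    qed
    show "deriv ?G (of_real ?r) + ?P (of_real ?t) \<noteq> 0"
    proof -
      have "deriv ?G (of_real ?r) = eval_fps (fps_cplx (fps_deriv (lower_part m))) (of_real ?r)"
        using rG r by (intro deriv_eval_cplx[OF _ radG]) auto
      moreover have conv: "fps_conv (fps_deriv (lower_part m)) ?r"
        using r rG radG fps_conv_radius_deriv[of "lower_part m"]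
        by (intro fps_conv_radiusI) (auto intro: less_le_trans[of _ "ereal rG"])
      ultimately have "deriv ?G (of_real ?r) = of_real (eval_fps (fps_deriv (lower_part m)) ?r)"
        using eval_fps_cplx_of_real by simp
      moreover have "?P (of_real ?t) = of_real (\<Phi> ?t)"
        by (rule eval_fps_cplx_of_real[OF conv_phi[OF crit_disc]])
      moreover have "fps_nonneg (fps_deriv (lower_part m))"
        using lower_part_nonneg[of m] by (simp add: fps_nonneg_def)
      then have "eval_fps (fps_deriv (lower_part m)) ?r \<ge> 0"
        using conv r by (intro eval_fps_conv_nonneg) auto
      moreover have "\<Phi> ?t > 0" using phi_pos[OF conv_phi[OF crit_disc]] t by simp
      ultimately have "deriv ?G (of_real ?r) + ?P (of_real ?t) = of_real (eval_fps (fps_deriv (lower_part m)) ?r + \<Phi> ?t)"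
        "eval_fps (fps_deriv (lower_part m)) ?r + \<Phi> ?t > 0" by auto
      then show ?thesis by (metis less_irrefl of_real_eq_0_iff)
    qed
    show "(\<lambda>n. of_real (fps_nth (Y m) n) * z ^ n) sums ?Y z" if "z \<in> ball 0 ?r" for z
      using that by (intro eval_fps_cplx_sums[OF moment_gf1_nonneg conv_Y_rad]) auto
    show "n mod period = 1 mod period" if "complex_of_real (fps_nth (Y m) n) \<noteq> 0" for n
      using that moment_gf1_supp[of m 0 n] by simp
    \<comment> \<open>If the product were 1, equality would hold in
      \<open>|z \<Phi>'(Y z)| \<le> r \<Phi>'(t) = 1\<close>, so every term with nonzero weight
      would have phase 1. This ties the phases of \<open>z\<close> and \<open>Y z\<close> together
      and makes \<open>\<zeta>\<close> a root of unity of order dividing the period.\<close>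
    show "z * deriv ?P (?Y z) \<noteq> 1" if z: "norm z = ?r" "z ^ period \<noteq> of_real ?r ^ period" for z
    proof
      assume eq: "z * deriv ?P (?Y z) = 1"
      define \<zeta> where "\<zeta> = z / of_real ?r"
      define \<eta> where "\<eta> = ?Y z / of_real ?t"
      have zn: "z = of_real ?r * \<zeta>" "?Y z = of_real ?t * \<eta>" using r t by (auto simp: \<zeta>_def \<eta>_def)
      have n\<zeta>: "norm \<zeta> = 1" using z r by (simp add: \<zeta>_def norm_divide)
      have Yz: "norm (?Y z) \<le> ?t" using Yle z by simp
      then have n\<eta>: "norm \<eta> \<le> 1" using t by (simp add: \<eta>_def norm_divide)
      have v1: "\<zeta> * \<eta> ^ k = 1" if k: "fps_nth (fps_deriv phi) k \<noteq> 0" for k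
      proof (rule triangle_equality_case[where c = "\<lambda>k. ?r * (fps_nth (fps_deriv phi) k * ?t ^ k)" and s = 1])
        show "?r * (fps_nth (fps_deriv phi) k * ?t ^ k) \<ge> 0" for k
          using r t w_nonneg by simp
        have "(\<lambda>k. fps_nth (fps_deriv phi) k * ?t ^ k) sums \<Phi>' ?t"
          using conv_phi'[OF crit_disc] unfolding fps_conv_def eval_fps_def by (rule summable_sums)
        from sums_mult[OF this, of ?r] show "(\<lambda>k. ?r * (fps_nth (fps_deriv phi) k * ?t ^ k)) sums 1"
          by (simp only: rad_crit)
        show "norm (\<zeta> * \<eta> ^ k) \<le> 1" for k
          using n\<zeta> n\<eta> by (simp add: norm_mult norm_power power_le_one)
        have "(\<lambda>k. of_real (fps_nth (fps_deriv phi) k) * ?Y z ^ k) sums deriv ?P (?Y z)"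
          using dP[of "?Y z"] Yz rP eval_fps_cplx_sums[OF nonneg_phi' conv_phi'[OF crit_disc] Yz] by simp
        from sums_mult[OF this, of z]
        have "(\<lambda>k. z * (of_real (fps_nth (fps_deriv phi) k) * ?Y z ^ k)) sums 1" by (simp only: eq)
        moreover have "z * (of_real (fps_nth (fps_deriv phi) k) * ?Y z ^ k)
            = of_real (?r * (fps_nth (fps_deriv phi) k * ?t ^ k)) * (\<zeta> * \<eta> ^ k)" for k
          by (subst zn(2), subst (1) zn(1)) (simp only: of_real_mult of_real_power power_mult_distrib mult_ac)
        ultimately show "(\<lambda>k. of_real (?r * (fps_nth (fps_deriv phi) k * ?t ^ k)) * (\<zeta> * \<eta> ^ k)) sums of_real 1"
          by (simp only: of_real_1)
        show "?r * (fps_nth (fps_deriv phi) k * ?t ^ k) \<noteq> 0" using k r t by simp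
      qed
      obtain k0 where k0: "k0 \<ge> 2" "w k0 > 0" by (rule ex_weight_ge_2)
      \<comment> \<open>A weight of index at least 2 gives a positive exponent, which sharpens
        \<open>norm \<eta> \<le> 1\<close> to equality.\<close>
      have "\<zeta> * \<eta> ^ (k0 - 1) = 1" using k0 by (intro v1) auto
      then have "norm \<eta> ^ (k0 - 1) = 1" using n\<zeta> by (metis norm_mult norm_one norm_power mult_1)
      from power_eq_1_iff[OF this] have n\<eta>1: "norm \<eta> = 1" using k0 by auto
      \<comment> \<open>Equality now also holds in \<open>|Y z| \<le> t\<close>, so all terms with
        nonzero coefficient share one phase. The coefficient at \<open>n = 1\<close> is positive
        because \<open>w 0 > 0\<close>, and it identifies \<open>\<eta>\<close> with
        \<open>\<zeta>\<close>.\<close>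
      have "\<zeta> ^ 1 / \<eta> = 1"
      proof (rule triangle_equality_case[where c = "\<lambda>n. fps_nth (Y m) n * ?r ^ n" and s = ?t and v = "\<lambda>n. \<zeta> ^ n / \<eta>"])
        show "fps_nth (Y m) n * ?r ^ n \<ge> 0" for n
          using r moment_gf1_nonneg[of m 0] by (simp add: fps_nonneg_def)
        show "(\<lambda>n. fps_nth (Y m) n * ?r ^ n) sums ?t"
          using conv_Y_rad[of m] unfolding fps_conv_def eval_fps_def crit_def by (rule summable_sums)
        show "norm (\<zeta> ^ n / \<eta>) \<le> 1" for n using n\<zeta> n\<eta>1 by (simp add: norm_divide norm_power)
        have "(\<lambda>n. of_real (fps_nth (Y m) n) * z ^ n) sums ?Y z"
          using z by (intro eval_fps_cplx_sums[OF moment_gf1_nonneg conv_Y_rad]) auto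
        from sums_divide[OF this, of \<eta>]
        have "(\<lambda>n. of_real (fps_nth (Y m) n) * z ^ n / \<eta>) sums (?Y z / \<eta>)" .
        moreover have "?Y z / \<eta> = of_real ?t" using n\<eta>1 by (subst zn(2)) auto
        moreover have "of_real (fps_nth (Y m) n) * z ^ n / \<eta> = of_real (fps_nth (Y m) n * ?r ^ n) * (\<zeta> ^ n / \<eta>)" for n
          by (subst zn(1)) (simp add: power_mult_distrib)
        ultimately show "(\<lambda>n. of_real (fps_nth (Y m) n * ?r ^ n) * (\<zeta> ^ n / \<eta>)) sums of_real ?t" by simp
        show "fps_nth (Y m) 1 * ?r ^ 1 \<noteq> 0" using Y_1_pos[of m] r by simp
      qed
      then have \<eta>\<zeta>: "\<eta> = \<zeta>" using n\<eta>1 by (cases "\<eta> = 0") auto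
      have "\<zeta> ^ k = 1" if "w k \<noteq> 0" for k
      proof (cases k)
        case (Suc k')
        then have "\<zeta> * \<eta> ^ k' = 1" using that by (intro v1) auto
        then show ?thesis by (simp add: \<eta>\<zeta> Suc)
      qed simp
      then have "\<zeta> ^ period = 1" by (rule root_of_unity_period)
      then show False using z(2) by (subst (asm) zn(1)) (simp add: power_mult_distrib)
    qed
  qed
  then show ?thesis by blast
qed

lemma F_asymp: "\<exists>\<kappa>>0. sqrt_asymp period (\<lambda>n. fps_nth (F m) n * rad m ^ n) \<kappa>"
proof -
  obtain rG rP where "sqrt_schema (eval_fps (fps_cplx (lower_part m))) (eval_fps (fps_cplx phi)) (eval_fps (fps_cplx (Y m)))
     (rad m) (crit m) rG rP period (\<lambda>n. of_real (fps_nth (Y m) n))" using sqrt_schema_moment_gf by blast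
  from sqrt_schema.real_coeff_asymptotics[OF this refl]
  obtain \<kappa> where \<kappa>: "\<kappa> > 0" "sqrt_asymp period (\<lambda>n. fps_nth (Y m) n * rad m ^ n) \<kappa>"
    using moment_gf1_nonneg[of m 0] by (auto simp: fps_nonneg_def)
  obtain x where x: "x > rad m" "fps_conv (lower_part m) x" using lower_part_conv_beyond by blast
  have r: "rad m > 0" by (rule rad_pos)
  have "sqrt_asymp period (\<lambda>n. - (fps_nth (lower_part m) n * rad m ^ n) + fps_nth (Y m) n * rad m ^ n) \<kappa>"
  proof (rule sqrt_asymp_add_small[OF \<kappa>(2)])
    show "x / rad m > 1" using x r by simp
    have "\<bar>- (fps_nth (lower_part m) n * rad m ^ n)\<bar> * (x / rad m) ^ n = fps_nth (lower_part m) n * x ^ n" for n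
      using r x lower_part_nonneg[of m] by (simp add: abs_mult fps_nonneg_def power_divide)
    then show "summable (\<lambda>n. \<bar>- (fps_nth (lower_part m) n * rad m ^ n)\<bar> * (x / rad m) ^ n)"
      using x by (simp add: fps_conv_def)
  qed
  moreover have "- (fps_nth (lower_part m) n * rad m ^ n) + fps_nth (Y m) n * rad m ^ n = fps_nth (F m) n * rad m ^ n" for n
    by (simp add: Y_decomp algebra_simps)
  ultimately show ?thesis using \<kappa>(1) by auto
qed

lemma moment_gf_asymp: "\<exists>\<kappa>>0. sqrt_asymp period (\<lambda>n. fps_nth (moment_gf w l m) n * rad (l + m) ^ n) \<kappa>"
proof -
  let ?M = "l + m"
  have r: "rad ?M > 0" by (rule rad_pos)
  obtain A B x where AB: "rad ?M < x" "nonneg_conv x A" "nonneg_conv x B" "moment_gf w l m = A + B * F ?M"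
    using moment_gf_decomp by blast
  obtain \<kappa> where \<kappa>: "\<kappa> > 0" "sqrt_asymp period (\<lambda>n. fps_nth (F ?M) n * rad ?M ^ n) \<kappa>" using F_asymp by blast
  have scale: "fps_nth g n * rad ?M ^ n * (x / rad ?M) ^ n = fps_nth g n * x ^ n" for g :: "real fps" and n
    using r by (simp add: power_divide)
  have x: "x / rad ?M > 1" using AB r by simp
  have "\<exists>\<kappa>'. sqrt_asymp period (\<lambda>n. \<Sum>k\<le>n. (fps_nth B k * rad ?M ^ k) * (fps_nth (F ?M) (n - k) * rad ?M ^ (n - k))) \<kappa>'"
  proof (rule sqrt_asymp_convolution[OF \<kappa>(2) _ _ _ x])
    show "n \<ge> 1 \<and> n mod period = 1 mod period" if "fps_nth (F ?M) n * rad ?M ^ n \<noteq> 0" for n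
      using that moment_gf_supp[of ?M 0 n] by simp
    show "fps_nth B n * rad ?M ^ n \<ge> 0" for n using AB r by (auto simp: nonneg_conv_def fps_nonneg_def)
    show "summable (\<lambda>n. fps_nth B n * rad ?M ^ n * (x / rad ?M) ^ n)"
      unfolding scale using AB by (simp add: nonneg_conv_def fps_conv_def)
  qed
  then obtain \<kappa>' where "sqrt_asymp period (\<lambda>n. \<Sum>k\<le>n. (fps_nth B k * rad ?M ^ k) * (fps_nth (F ?M) (n - k) * rad ?M ^ (n - k))) \<kappa>'"
    by blast
  also have "(\<lambda>n. \<Sum>k\<le>n. (fps_nth B k * rad ?M ^ k) * (fps_nth (F ?M) (n - k) * rad ?M ^ (n - k)))
      = (\<lambda>n. fps_nth (B * F ?M) n * rad ?M ^ n)"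
  proof
    fix n
    show "(\<Sum>k\<le>n. (fps_nth B k * rad ?M ^ k) * (fps_nth (F ?M) (n - k) * rad ?M ^ (n - k))) = fps_nth (B * F ?M) n * rad ?M ^ n"
      unfolding fps_mult_nth sum_distrib_right atLeast0AtMost
      by (intro sum.cong refl) (simp add: power_add[symmetric] mult_ac)
  qed
  finally have "sqrt_asymp period (\<lambda>n. fps_nth A n * rad ?M ^ n + fps_nth (B * F ?M) n * rad ?M ^ n) \<kappa>'"
  proof (rule sqrt_asymp_add_small[OF _ _ x])
    have "\<bar>fps_nth A n * rad ?M ^ n\<bar> * (x / rad ?M) ^ n = fps_nth A n * x ^ n" for n
      using AB r scale[of A n] by (simp add: nonneg_conv_def fps_nonneg_def abs_mult)
    then show "summable (\<lambda>n. \<bar>fps_nth A n * rad ?M ^ n\<bar> * (x / rad ?M) ^ n)"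
      using AB by (simp add: nonneg_conv_def fps_conv_def)
  qed
  then have asymp: "sqrt_asymp period (\<lambda>n. fps_nth (moment_gf w l m) n * rad ?M ^ n) \<kappa>'"
    by (simp add: AB(4) distrib_right)
  have "\<kappa> \<le> \<kappa>'"
  proof (rule sqrt_asymp_nonneg[OF asymp period_pos _ \<kappa>(2)])
    fix n
    have "fps_nth (F ?M) n \<le> fps_nth (moment_gf w l m) n"
      unfolding moment_gf_def gf_def fps_nth_Abs_fps
    proof (intro sum_mono)
      fix T
      let ?R = "real (num_root_subtrees T)" and ?S = "real (num_subtrees T)"
      have "?R ^ ?M \<le> ?R ^ l * ?S ^ m"
        unfolding power_add using num_root_subtrees_le_num_subtrees[of T]
        by (intro mult_left_mono power_mono) auto
      then show "tree_weight w T * ?R ^ ?M * ?S ^ 0 \<le> tree_weight w T * ?R ^ l * ?S ^ m"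
        using tree_weight_nonneg[of T] by (simp add: mult.assoc mult_left_mono)
    qed
    then show "fps_nth (F ?M) n * rad ?M ^ n \<le> fps_nth (moment_gf w l m) n * rad ?M ^ n"
      using r by (intro mult_right_mono) auto
  qed
  then show ?thesis using asymp \<kappa>(1) by (intro exI[of _ \<kappa>']) auto
qed

end

section \<open>Admissible weights and offspring distributions\<close>

lemma generator_eq: "generator w = eval_fps (Abs_fps w)"
  by (simp add: fun_eq_iff generator_def eval_fps_def)

lemma generator_has_derivative:
  assumes "ereal \<bar>y\<bar> < conv_radius w"
  shows "(generator w has_field_derivative eval_fps (fps_deriv (Abs_fps w)) y) (at y)"
  unfolding generator_eq
  by (rule has_field_derivative_eval_fps) (use assms in \<open>simp add: fps_conv_radius_def dist_norm\<close>)

lemma deriv_generator: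
  "ereal \<bar>y\<bar> < conv_radius w \<Longrightarrow> deriv (generator w) y = eval_fps (fps_deriv (Abs_fps w)) y"
  by (rule DERIV_imp_deriv[OF generator_has_derivative])

lemma generator_pos:
  assumes "\<And>i. w i \<ge> 0" "w 0 > 0" "y \<ge> 0" "ereal y < conv_radius w"
  shows "eval_fps (Abs_fps w) y > 0"
proof -
  have "summable (\<lambda>i. w i * y ^ i)" using assms by (intro summable_in_conv_radius) auto
  then show ?thesis unfolding eval_fps_def
    using assms by (intro suminf_pos2[of _ 0]) auto
qed

lemma admissible_weights_imp_gen_weights:
  assumes "admissible_weights w"
  shows "gen_weights w"
proof
  let ?R = "conv_radius w"
  note adm = assms[unfolded admissible_weights_def]
  show nn: "w i \<ge> 0" for i using adm by blast
  show w0: "w 0 > 0" using adm by blast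
  have R: "?R > 0" using adm by blast
  have ev: "eventually P (at_left ?R) \<longleftrightarrow> (\<exists>b<?R. \<forall>y>b. y < ?R \<longrightarrow> P y)" for P
    by (rule eventually_at_left[OF R])
  have between: "\<exists>y>0. b < ereal y \<and> ereal y < ?R" if "b < ?R" for b
  proof -
    have "max b 0 < ?R" using that R by simp
    then obtain y where y: "max b 0 < ereal y" "ereal y < ?R"
      using ereal_dense2 by blast
    from y(1) have "b < ereal y" "0 < y" by simp_all
    with y(2) show ?thesis by blast
  qed
  obtain L where L: "L > (1 :: ereal)" "(((\<lambda>z. ereal (z * deriv (generator w) z / generator w z)) \<circ> real_of_ereal) \<longlongrightarrow> L) (at_left ?R)"
    using adm by blast
  \<comment> \<open>A real number strictly between 1 and the possibly infinite limit;
    \<open>q = 1 / c\<close> becomes the factor in the ratio condition.\<close>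
  obtain c where c: "1 < c" "ereal c < L"
  proof -
    obtain c where "1 < ereal c" "ereal c < L" using ereal_dense2[OF L(1)] by blast
    then show ?thesis by (intro that[of c]) (simp_all add: one_ereal_def)
  qed
  from order_tendstoD(1)[OF L(2) c(2)] obtain b where b: "b < ?R"
    "\<And>y. b < y \<Longrightarrow> y < ?R \<Longrightarrow> ereal c < ((\<lambda>z. ereal (z * deriv (generator w) z / generator w z)) \<circ> real_of_ereal) y"
    unfolding ev by blast
  obtain y0 where y0: "y0 > 0" "b < ereal y0" "ereal y0 < ?R" using between[OF b(1)] by blast
  have "eval_fps (Abs_fps w) y \<le> (1 / c) * (y * eval_fps (fps_deriv (Abs_fps w)) y)"
    if y: "y \<ge> y0" "ereal y < ?R" for y
  proof -
    have "b < ereal y" using y0(2) y(1) by (meson ereal_less_eq(3) less_le_trans)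
    from b(2)[OF this y(2)] have "c < y * deriv (generator w) y / generator w y" by simp
    moreover have "deriv (generator w) y = eval_fps (fps_deriv (Abs_fps w)) y"
      using y y0 by (intro deriv_generator) simp
    moreover have "generator w y > 0"
      unfolding generator_eq using nn w0 y y0 by (intro generator_pos) auto
    ultimately show ?thesis using c by (simp add: generator_eq field_simps)
  qed
  then show "\<exists>y0 q. 0 < y0 \<and> ereal y0 < ?R \<and> q < 1 \<and>
       (\<forall>y\<ge>y0. ereal y < ?R \<longrightarrow> eval_fps (Abs_fps w) y \<le> q * (y * eval_fps (fps_deriv (Abs_fps w)) y))"
    using y0 c by (intro exI[of _ y0] exI[of _ "1 / c"]) auto
  show "\<exists>y>0. ereal y < ?R \<and> eval_fps (fps_deriv (Abs_fps w)) y > K" for K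
  proof -
    have "filterlim (deriv (generator w) \<circ> real_of_ereal) at_top (at_left ?R)" using adm by blast
    then have "eventually (\<lambda>y. K < (deriv (generator w) \<circ> real_of_ereal) y) (at_left ?R)"
      by (simp add: filterlim_at_top_dense)
    then obtain b where b: "b < ?R" "\<And>y. b < y \<Longrightarrow> y < ?R \<Longrightarrow> K < (deriv (generator w) \<circ> real_of_ereal) y"
      unfolding ev by blast
    obtain y where y: "y > 0" "b < ereal y" "ereal y < ?R" using between[OF b(1)] by blast
    have "K < deriv (generator w) y" using b(2)[OF y(2,3)] by simp
    also have "deriv (generator w) y = eval_fps (fps_deriv (Abs_fps w)) y"
      using y by (intro deriv_generator) simp
    finally show ?thesis using y by blast
  qed
qed

section \<open>Critical offspring distributions\<close>

lemma
  fixes f :: "nat \<Rightarrow> real"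
  shows integrable_pmf_nat_iff: "integrable (measure_pmf p) f \<longleftrightarrow> summable (\<lambda>i. \<bar>pmf p i * f i\<bar>)"
    and expectation_pmf_nat: "integrable (measure_pmf p) f \<Longrightarrow> measure_pmf.expectation p f = (\<Sum>i. pmf p i * f i)"
proof -
  have 1: "integrable (measure_pmf p) f \<longleftrightarrow> integrable (count_space UNIV) (\<lambda>i. pmf p i * f i)"
    unfolding measure_pmf_eq_density by (subst integrable_density) auto
  also have "\<dots> \<longleftrightarrow> summable (\<lambda>i. \<bar>pmf p i * f i\<bar>)" by (simp add: integrable_count_space_nat_iff)
  finally show "integrable (measure_pmf p) f \<longleftrightarrow> summable (\<lambda>i. \<bar>pmf p i * f i\<bar>)" .
  assume "integrable (measure_pmf p) f"
  with 1 have i: "integrable (count_space UNIV) (\<lambda>i. pmf p i * f i)" by simp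
  have "measure_pmf.expectation p f = (\<integral>i. pmf p i * f i \<partial>count_space UNIV)"
    unfolding measure_pmf_eq_density by (subst integral_density) auto
  with integral_count_space_nat[OF i] show "measure_pmf.expectation p f = (\<Sum>i. pmf p i * f i)" by simp
qed

text \<open>In the extended reals the supremum always exists, so monotonicity of the logarithmic
  derivative alone provides the first limit of the admissibility condition.\<close>

lemma mono_at_left_limit:
  fixes f :: "ereal \<Rightarrow> ereal"
  assumes "a < R" and mono: "\<And>x y. a < x \<Longrightarrow> x \<le> y \<Longrightarrow> y < R \<Longrightarrow> f x \<le> f y"
  shows "(f \<longlongrightarrow> (SUP x\<in>{a<..<R}. f x)) (at_left R)"
proof (rule order_tendstoI)
  fix c assume "c < (SUP x\<in>{a<..<R}. f x)"
  then obtain x where x: "x \<in> {a<..<R}" "c < f x" by (auto simp: less_SUP_iff)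
  have "c < f y" if "x < y" "y < R" for y
  proof -
    have "f x \<le> f y" using mono[of x y] x(1) that by simp
    with x(2) show ?thesis by (rule less_le_trans)
  qed
  then show "eventually (\<lambda>y. c < f y) (at_left R)"
    unfolding eventually_at_left[OF assms(1)] using x(1) by (intro bexI[of _ x] exI[of _ x]) auto
next
  fix c assume c: "(SUP x\<in>{a<..<R}. f x) < c"
  have "f y < c" if "a < y" "y < R" for y
    by (rule le_less_trans[OF SUP_upper c]) (use that in simp)
  then show "eventually (\<lambda>y. f y < c) (at_left R)"
    unfolding eventually_at_left[OF assms(1)] using assms(1) by (intro exI[of _ a]) simp
qed

text \<open>The logarithmic derivative \<open>z \<Phi>'(z) / \<Phi>(z)\<close> is the mean of the tilted weights
  \<open>w\<^sub>k z\<^sup>k / \<Phi>(z)\<close>; \<open>z\<close> times its derivative is their variance.\<close>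

lemma log_derivative_strict_mono:
  assumes nn: "\<And>i. w i \<ge> (0 :: real)" and w0: "w 0 > 0" and k: "k \<ge> 1" "w k > 0"
    and xy: "0 < x" "x < y" "ereal y < conv_radius w"
  defines "r \<equiv> \<lambda>z. z * deriv (generator w) z / generator w z"
  shows "r x < r y"
proof (rule DERIV_pos_imp_increasing[OF xy(2)])
  fix z assume z: "x \<le> z" "z \<le> y"
  define A where "A = Abs_fps w"
  define B where "B = fps_X * fps_deriv A"
  define C where "C = fps_X * fps_deriv B"
  have zR: "ereal z < conv_radius w" using z xy by (meson ereal_less_eq(3) le_less_trans)
  have zpos: "z > 0" using z xy by simp
  have radA: "fps_conv_radius A = conv_radius w" by (simp add: A_def fps_conv_radius_def)
  have radA': "fps_conv_radius (fps_deriv A) \<ge> conv_radius w"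
    using fps_conv_radius_deriv[of A] by (simp add: radA)
  have radB: "fps_conv_radius B \<ge> conv_radius w"
    unfolding B_def using fps_conv_radius_mult[of fps_X "fps_deriv A"] radA' by (auto intro: order_trans)
  have radB': "fps_conv_radius (fps_deriv B) \<ge> conv_radius w"
    using fps_conv_radius_deriv[of B] radB by (rule order_trans[rotated])
  have radC: "fps_conv_radius C \<ge> conv_radius w"
    unfolding C_def using fps_conv_radius_mult[of fps_X "fps_deriv B"] radB' by (auto intro: order_trans)
  have in_disc: "ereal (norm z) < fps_conv_radius f" if "fps_conv_radius f \<ge> conv_radius w" for f :: "real fps"
    using zR zpos that by (auto intro: less_le_trans)
  have eB: "eval_fps B z = z * eval_fps (fps_deriv A) z"
    unfolding B_def using in_disc[OF radA'] by (subst eval_fps_mult) auto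
  have eC: "eval_fps C z = z * eval_fps (fps_deriv B) z"
    unfolding C_def using in_disc[OF radB'] by (subst eval_fps_mult) auto
  have Apos: "eval_fps A z > 0" unfolding A_def using nn w0 zpos zR by (intro generator_pos) auto
  define \<mu> where "\<mu> = eval_fps B z / eval_fps A z"
  have sums: "(\<lambda>n. fps_nth f n * z ^ n) sums eval_fps f z" if "fps_conv_radius f \<ge> conv_radius w" for f
    unfolding eval_fps_def using in_disc[OF that] by (intro summable_sums summable_fps) auto
  have nthB: "fps_nth B n = real n * w n" for n by (cases n) (simp_all add: B_def A_def)
  have nthC: "fps_nth C n = real n * (real n * w n)" for n by (cases n) (simp_all add: C_def nthB)
  have "(\<lambda>n. fps_nth C n * z ^ n - 2 * \<mu> * (fps_nth B n * z ^ n) + \<mu>\<^sup>2 * (fps_nth A n * z ^ n))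
      sums (eval_fps C z - 2 * \<mu> * eval_fps B z + \<mu>\<^sup>2 * eval_fps A z)"
    by (intro sums_add sums_diff sums_mult sums radB radC) (simp add: radA)
  moreover have "fps_nth C n * z ^ n - 2 * \<mu> * (fps_nth B n * z ^ n) + \<mu>\<^sup>2 * (fps_nth A n * z ^ n)
      = w n * z ^ n * (real n - \<mu>)\<^sup>2" for n
    by (simp add: nthB nthC A_def power2_eq_square algebra_simps)
  ultimately have var: "(\<lambda>n. w n * z ^ n * (real n - \<mu>)\<^sup>2) sums (eval_fps C z - 2 * \<mu> * eval_fps B z + \<mu>\<^sup>2 * eval_fps A z)"
    by simp
  have term_nn: "w n * z ^ n * (real n - \<mu>)\<^sup>2 \<ge> 0" for n using nn[of n] zpos by simp
  \<comment> \<open>The exponents 0 and \<open>k\<close> are distinct and both carry weight, so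
    \<open>\<mu>\<close> misses at least one of them.\<close>
  have "\<exists>j. w j * z ^ j * (real j - \<mu>)\<^sup>2 > 0"
  proof (cases "\<mu> = 0")
    case True
    then show ?thesis using k zpos by (intro exI[of _ k]) simp
  next
    case False
    then show ?thesis using w0 by (intro exI[of _ 0]) simp
  qed
  then obtain j where j: "w j * z ^ j * (real j - \<mu>)\<^sup>2 > 0" by blast
  have "suminf (\<lambda>n. w n * z ^ n * (real n - \<mu>)\<^sup>2) > 0"
    using var term_nn j by (intro suminf_pos2[of _ j]) (auto simp: sums_iff)
  then have "eval_fps C z - 2 * \<mu> * eval_fps B z + \<mu>\<^sup>2 * eval_fps A z > 0" using var by (simp add: sums_iff)
  moreover have "\<mu>\<^sup>2 * eval_fps A z = \<mu> * eval_fps B z" "\<mu> * eval_fps A z = eval_fps B z"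
    using Apos by (simp_all add: \<mu>_def power2_eq_square)
  ultimately have "eval_fps C z - \<mu> * eval_fps B z > 0" by simp
  then have "z * eval_fps (fps_deriv B) z - \<mu> * (z * eval_fps (fps_deriv A) z) > 0"
    by (simp only: eB eC)
  then have "z * (eval_fps (fps_deriv B) z - \<mu> * eval_fps (fps_deriv A) z) > 0" by (simp add: algebra_simps)
  then have num: "eval_fps (fps_deriv B) z - \<mu> * eval_fps (fps_deriv A) z > 0"
    using zpos by (simp add: zero_less_mult_iff)
  define D where "D = (eval_fps (fps_deriv B) z * eval_fps A z - eval_fps B z * eval_fps (fps_deriv A) z) / (eval_fps A z * eval_fps A z)"
  have "((\<lambda>z. eval_fps B z / eval_fps A z) has_field_derivative D) (at z)"
    unfolding D_def
    by (rule DERIV_divide[OF has_field_derivative_eval_fps[OF in_disc[OF radB]]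
          has_field_derivative_eval_fps[OF in_disc[OF eq_refl[OF radA[symmetric]]]]]) (use Apos in simp)
  moreover have "eventually (\<lambda>z. eval_fps B z / eval_fps A z = r z) (nhds z)"
  proof -
    obtain y' where y'': "ereal z < ereal y'" "ereal y' < conv_radius w" using ereal_dense2[OF zR] by blast
    then have y': "z < y'" "ereal y' < conv_radius w" by simp_all
    have "open {0<..<y'}" "z \<in> {0<..<y'}" using y' zpos by auto
    moreover have "eval_fps B u / eval_fps A u = r u" if u: "u \<in> {0<..<y'}" for u
    proof -
      have uR: "ereal \<bar>u\<bar> < conv_radius w" using u y' by (auto intro: less_trans[of _ "ereal y'"])
      then have "ereal (norm u) < fps_conv_radius (fps_deriv A)" using radA' by (auto intro: less_le_trans)
      then have "eval_fps B u = u * eval_fps (fps_deriv A) u"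
        unfolding B_def by (subst eval_fps_mult) auto
      then show ?thesis using uR by (simp add: r_def generator_eq deriv_generator[unfolded generator_eq] A_def)
    qed
    ultimately show ?thesis unfolding eventually_nhds by blast
  qed
  ultimately have "(r has_field_derivative D) (at z)"
    using DERIV_cong_ev[OF refl, of "\<lambda>z. eval_fps B z / eval_fps A z" r z D D] by auto
  moreover have "D > 0"
  proof -
    have "D = (eval_fps (fps_deriv B) z - \<mu> * eval_fps (fps_deriv A) z) / eval_fps A z"
      using Apos by (simp add: D_def \<mu>_def field_simps)
    then show ?thesis using num Apos by simp
  qed
  ultimately show "\<exists>D. (r has_real_derivative D) (at z) \<and> D > 0" by blast
qed

text \<open>At \<open>z = 1\<close> the quotient \<open>z \<Phi>'(z) / \<Phi>(z)\<close> is the mean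
  of \<open>\<xi>\<close>, that is 1, and the exponential moment puts 1 strictly inside the disc.
  Strict monotonicity then carries the quotient, and with it the limit, above 1.\<close>

lemma admissible_offspring_imp_admissible_weights:
  assumes "admissible_offspring \<xi>"
  shows "admissible_weights (pmf \<xi>)"
proof -
  let ?w = "pmf \<xi>"
  let ?R = "conv_radius ?w"
  note adm = assms[unfolded admissible_offspring_def]
  have int1: "integrable \<xi> real" and E1: "measure_pmf.expectation \<xi> real = 1" using adm by blast+
  have sum_p: "(\<lambda>i. ?w i) sums 1"
  proof -
    have "integrable \<xi> (\<lambda>_. 1 :: real)" by simp
    then show ?thesis using expectation_pmf_nat[of \<xi> "\<lambda>_. 1"] integrable_pmf_nat_iff[of \<xi> "\<lambda>_. 1"]
      by (simp add: sums_iff)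
  qed
  have sum_ip: "(\<lambda>i. ?w i * real i) sums 1"
    using expectation_pmf_nat[OF int1] integrable_pmf_nat_iff[of \<xi> real] int1 E1 by (simp add: sums_iff)
  \<comment> \<open>If all mass sat at 1, the variance would vanish.\<close>
  have ex_k: "\<exists>i. i \<noteq> 1 \<and> ?w i > 0"
  proof (rule ccontr)
    assume "\<not> (\<exists>i. i \<noteq> 1 \<and> ?w i > 0)"
    then have z: "?w i = 0" if "i \<noteq> 1" for i using that by (metis pmf_nonneg less_eq_real_def)
    have zero: "?w i * (real i - 1)\<^sup>2 = 0" for i using z[of i] by (cases "i = 1") auto
    then have "(\<lambda>i. \<bar>?w i * (real i - 1)\<^sup>2\<bar>) = (\<lambda>_. 0)" by (simp only: abs_zero)
    then have "integrable \<xi> (\<lambda>i. (real i - 1)\<^sup>2)" unfolding integrable_pmf_nat_iff by simp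
    then have "measure_pmf.expectation \<xi> (\<lambda>i. (real i - 1)\<^sup>2) = (\<Sum>i. ?w i * (real i - 1)\<^sup>2)"
      by (rule expectation_pmf_nat)
    then have "measure_pmf.variance \<xi> real = 0" by (simp only: E1 zero suminf_zero)
    moreover have "measure_pmf.variance \<xi> real > 0" using adm by blast
    ultimately show False by (simp only: less_irrefl)
  qed
  have w0: "?w 0 > 0"
  proof (rule ccontr)
    assume "\<not> ?w 0 > 0"
    then have z: "?w 0 = 0" by (metis pmf_nonneg less_eq_real_def)
    \<comment> \<open>Without mass at 0 the terms of \<open>E (\<xi> - 1) = 0\<close> are all
      nonnegative, so each of them is 0 and all mass sits at 1.\<close>
    have "(\<lambda>i. ?w i * real i - ?w i) sums (1 - 1)" by (intro sums_diff sum_p sum_ip)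
    moreover have "?w i * real i - ?w i \<ge> 0" for i
    proof (cases "i = 0")
      case False
      then have "?w i * 1 \<le> ?w i * real i" by (intro mult_left_mono) auto
      then show ?thesis by simp
    qed (simp add: z)
    ultimately have "?w i * real i - ?w i = 0" for i
      using suminf_eq_zero_iff[of "\<lambda>i. ?w i * real i - ?w i"] by (auto simp: sums_iff)
    then have "?w i * (real i - 1) = 0" for i by (simp add: algebra_simps)
    then have "?w i = 0" if "i \<noteq> 1" for i using that by (metis mult_eq_0_iff of_nat_1 of_nat_eq_iff right_minus_eq)
    then show False using ex_k by auto
  qed
  obtain k where k: "k \<ge> 1" "?w k > 0"
  proof -
    have "\<exists>k\<ge>1. ?w k > 0"
    proof (rule ccontr)
      assume "\<not> (\<exists>k\<ge>1. ?w k > 0)"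
      then have "?w k = 0" if "k \<ge> 1" for k using that by (metis pmf_nonneg less_eq_real_def)
      then have "?w i * real i = 0" for i by (cases "i = 0") auto
      then have "(\<lambda>i. ?w i * real i) = (\<lambda>_. 0)" by (rule ext)
      with sum_ip have "(\<lambda>_ :: nat. 0 :: real) sums 1" by (simp only:)
      then show False by (simp add: sums_iff)
    qed
    then show ?thesis using that by blast
  qed
  have R1: "?R > 1"
  proof -
    obtain t where t: "t > 0" "integrable \<xi> (\<lambda>i. exp (t * real i))" using adm by blast
    have "summable (\<lambda>i. \<bar>?w i * exp (t * real i)\<bar>)" using t(2) by (simp only: integrable_pmf_nat_iff)
    then have "summable (\<lambda>i. ?w i * exp t ^ i)"
      by (simp add: exp_of_nat_mult[symmetric] mult.commute)
    then have "?R \<ge> ereal (norm (exp t))" by (rule conv_radius_geI)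
    then have "ereal (exp t) \<le> ?R" by simp
    moreover have "1 < ereal (exp t)" using t by (simp add: one_ereal_def)
    ultimately show ?thesis by (rule less_le_trans[rotated])
  qed
  define r where "r = (\<lambda>z. z * deriv (generator ?w) z / generator ?w z)"
  have mono: "r x < r y" if "0 < x" "x < y" "ereal y < ?R" for x y
    unfolding r_def using log_derivative_strict_mono[OF pmf_nonneg w0 k that] .
  have r1: "r 1 = 1"
  proof -
    have "deriv (generator ?w) 1 = eval_fps (fps_deriv (Abs_fps ?w)) 1"
      using R1 by (intro deriv_generator) (simp add: one_ereal_def)
    also have "\<dots> = (\<Sum>n. real (Suc n) * ?w (Suc n))" by (simp add: eval_fps_def)
    also have "\<dots> = 1"
    proof -
      have "(\<lambda>n. ?w (Suc n) * real (Suc n)) sums 1"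
        using sum_ip by (subst sums_Suc_iff) simp
      then show ?thesis by (simp add: sums_iff mult.commute)
    qed
    finally show ?thesis using sum_p by (simp add: r_def generator_def sums_iff)
  qed
  define f where "f = (\<lambda>z. ereal (r z)) \<circ> real_of_ereal"
  have R0: "(0 :: ereal) < ?R" using R1 by (rule less_trans[rotated]) simp
  have "f x \<le> f y" if xy: "0 < x" "x \<le> y" "y < ?R" for x y
  proof -
    have fin: "\<bar>x\<bar> \<noteq> \<infinity>" "\<bar>y\<bar> \<noteq> \<infinity>" using xy by auto
    then obtain x' y' where x': "x = ereal x'" "y = ereal y'" by (cases x; cases y) auto
    then have "0 < x'" "x' \<le> y'" "ereal y' < ?R" using xy by auto
    then show ?thesis using mono[of x' y'] by (cases "x' = y'") (auto simp: f_def x' less_imp_le)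
  qed
  from mono_at_left_limit[OF R0 this]
  have lim: "(f \<longlongrightarrow> (SUP x\<in>{0<..<?R}. f x)) (at_left ?R)" .
  moreover have "(SUP x\<in>{0<..<?R}. f x) > 1"
  proof -
    obtain y where y: "1 < ereal y" "ereal y < ?R" using ereal_dense2[OF R1] by blast
    then have "r 1 < r y" by (intro mono) (auto simp: one_ereal_def)
    then have "1 < f (ereal y)" by (simp add: f_def r1 one_ereal_def)
    also have "f (ereal y) \<le> (SUP x\<in>{0<..<?R}. f x)"
      by (rule SUP_upper) (use y in \<open>auto simp: one_ereal_def zero_ereal_def\<close>)
    finally show ?thesis .
  qed
  ultimately show ?thesis
    unfolding admissible_weights_def using adm w0 R0 unfolding f_def r_def by (auto simp: o_def)
qed

section \<open>Expectations\<close>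

context gen_weights
begin

lemma partition_function_eq: "partition_function w n = fps_nth (moment_gf w 0 0) n"
  by (simp add: partition_function_def moment_gf_def gf_def)

lemma expectation_simply_generated_tree:
  assumes "partition_function w n > 0"
  shows "measure_pmf.expectation (simply_generated_tree w n)
           (\<lambda>T. real (num_root_subtrees T) ^ l * real (num_subtrees T) ^ m)
         = fps_nth (moment_gf w l m) n / fps_nth (moment_gf w 0 0) n"
proof -
  note pmf = pmf_simply_generated_tree[OF w_nonneg assms]
  let ?X = "\<lambda>T. real (num_root_subtrees T) ^ l * real (num_subtrees T) ^ m"
  have "measure_pmf.expectation (simply_generated_tree w n) ?X
      = (\<Sum>T\<in>trees_of_size n. ?X T * pmf (simply_generated_tree w n) T)"
    by (rule integral_measure_pmf_real[OF finite_trees_of_size]) (auto simp: set_pmf_iff pmf split: if_splits)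
  also have "\<dots> = (\<Sum>T\<in>trees_of_size n. tree_weight w T * real (num_root_subtrees T) ^ l * real (num_subtrees T) ^ m
      / partition_function w n)"
    by (intro sum.cong refl) (simp add: pmf mult_ac)
  also have "\<dots> = fps_nth (moment_gf w l m) n / partition_function w n"
    by (simp add: moment_gf_def gf_def sum_divide_distrib)
  finally show ?thesis by (simp add: partition_function_eq)
qed

lemma ratio_error:
  fixes a b :: real
  assumes "\<bar>a - 1\<bar> \<le> A" "\<bar>b - 1\<bar> \<le> B" "B \<le> 1 / 2"
  shows "\<bar>a / b - 1\<bar> \<le> 2 * (A + B)"
proof -
  have b: "b \<ge> 1 / 2" using assms by linarith
  have "\<bar>a / b - 1\<bar> = \<bar>a - b\<bar> / b" using b by (simp add: field_simps abs_if)
  also have "\<dots> \<le> (A + B) / (1 / 2)"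
    using b assms by (intro frac_le) auto
  finally show ?thesis by simp
qed

text \<open>Numerator and denominator share the factor \<open>n^(-3/2)\<close>, which cancels. The
  constant is the quotient of the two leading constants, and the rate is
  \<open>rad 0 / rad (l + m)\<close>.\<close>

lemma moment_expectation_asymptotics:
  "\<exists>\<gamma>>0. expectation_asymptotics w
     (\<lambda>T. real (num_root_subtrees T) ^ l * real (num_subtrees T) ^ m) \<gamma> (tau w (l + m))"
proof -
  let ?X = "\<lambda>T. real (num_root_subtrees T) ^ l * real (num_subtrees T) ^ m"
  let ?M = "l + m"
  let ?c = "fps_nth (moment_gf w l m)" and ?p = "fps_nth (moment_gf w 0 0)"
  obtain \<kappa> where \<kappa>: "\<kappa> > 0" "sqrt_asymp period (\<lambda>n. ?c n * rad ?M ^ n) \<kappa>" using moment_gf_asymp by blast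
  obtain \<kappa>0 where \<kappa>0: "\<kappa>0 > 0" "sqrt_asymp period (\<lambda>n. ?p n * rad 0 ^ n) \<kappa>0"
    using moment_gf_asymp[of 0 0] by auto
  obtain C where C: "\<And>n. n \<ge> 1 \<Longrightarrow> n mod period = 1 mod period \<Longrightarrow>
      \<bar>?c n * rad ?M ^ n * real n powr (3 / 2) - \<kappa>\<bar> \<le> C / real n"
    using \<kappa>(2) by (auto simp: sqrt_asymp_def)
  obtain C0 where C0: "\<And>n. n \<ge> 1 \<Longrightarrow> n mod period = 1 mod period \<Longrightarrow>
      \<bar>?p n * rad 0 ^ n * real n powr (3 / 2) - \<kappa>0\<bar> \<le> C0 / real n"
    using \<kappa>0(2) by (auto simp: sqrt_asymp_def)
  have r: "rad ?M > 0" "rad 0 > 0" by (rule rad_pos)+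
  define \<gamma> where "\<gamma> = \<kappa> / \<kappa>0"
  define t where "t = tau w ?M"
  have t: "t = rad 0 / rad ?M" using r by (simp add: t_def tau_def rho_rad)
  have pos: "\<gamma> > 0" "t > 0" using \<kappa> \<kappa>0 r by (auto simp: \<gamma>_def t)
  define \<epsilon> where "\<epsilon> = (\<lambda>n. measure_pmf.expectation (simply_generated_tree w n) ?X / (\<gamma> * t ^ n) - 1)"
  define K where "K = 2 * (C / \<kappa> + C0 / \<kappa>0)"
  have bound: "\<bar>\<epsilon> n\<bar> \<le> K * (1 / real n)"
    if n: "n \<ge> 1" "real n \<ge> 2 * (C0 / \<kappa>0)" "partition_function w n > 0" for n
  proof -
    have p: "?p n > 0" using n by (simp add: partition_function_eq)
    \<comment> \<open>A positive partition function places \<open>n\<close> in the residue class in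
      which both expansions are available.\<close>
    then have nd: "n mod period = 1 mod period" using moment_gf_supp[of 0 0 n] by simp
    define N where "N = real n powr (3 / 2)"
    have N: "N > 0" using n by (simp add: N_def)
    define a where "a = ?c n * rad ?M ^ n * N / \<kappa>"
    define b where "b = ?p n * rad 0 ^ n * N / \<kappa>0"
    have "a - 1 = (?c n * rad ?M ^ n * N - \<kappa>) / \<kappa>" using \<kappa> by (simp add: a_def field_simps)
    then have "\<bar>a - 1\<bar> = \<bar>?c n * rad ?M ^ n * N - \<kappa>\<bar> / \<kappa>" using \<kappa> by simp
    also have "\<dots> \<le> (C / real n) / \<kappa>" using C[OF n(1) nd] \<kappa> by (intro divide_right_mono) (auto simp: N_def)
    finally have a: "\<bar>a - 1\<bar> \<le> C / \<kappa> / real n" by (simp add: mult.commute)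
    have "b - 1 = (?p n * rad 0 ^ n * N - \<kappa>0) / \<kappa>0" using \<kappa>0 by (simp add: b_def field_simps)
    then have "\<bar>b - 1\<bar> = \<bar>?p n * rad 0 ^ n * N - \<kappa>0\<bar> / \<kappa>0" using \<kappa>0 by simp
    also have "\<dots> \<le> (C0 / real n) / \<kappa>0" using C0[OF n(1) nd] \<kappa>0 by (intro divide_right_mono) (auto simp: N_def)
    finally have b: "\<bar>b - 1\<bar> \<le> C0 / \<kappa>0 / real n" by (simp add: mult.commute)
    \<comment> \<open>The threshold on \<open>n\<close> keeps the normalized denominator at least
      1/2, as the quotient estimate requires.\<close>
    have "C0 / \<kappa>0 \<le> real n / 2" using n(2) by linarith
    then have "C0 / \<kappa>0 / real n \<le> (real n / 2) / real n" by (intro divide_right_mono) auto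
    then have "C0 / \<kappa>0 / real n \<le> 1 / 2" using n(1) by simp
    from ratio_error[OF a b this] have "\<bar>a / b - 1\<bar> \<le> K * (1 / real n)"
      by (simp add: K_def add_divide_distrib)
    moreover have "a / b - 1 = \<epsilon> n"
      unfolding \<epsilon>_def expectation_simply_generated_tree[OF n(3)] a_def b_def \<gamma>_def t
      using N r \<kappa> \<kappa>0 p by (simp add: power_divide field_simps)
    ultimately show ?thesis by simp
  qed
  have "\<epsilon> \<in> O[admissible_sizes w](\<lambda>n. 1 / real n)"
  proof (rule bigoI)
    obtain n0 where n0: "real n0 \<ge> 2 * (C0 / \<kappa>0)" using real_arch_simple by blast
    have "\<forall>\<^sub>F n in sequentially. n \<in> {n. partition_function w n > 0} \<longrightarrow> norm (\<epsilon> n) \<le> K * norm (1 / real n)"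
      using eventually_ge_at_top[of "max 1 n0"]
    proof eventually_elim
      case (elim n)
      have "real n \<ge> real n0" using elim by simp
      then have "real n \<ge> 2 * (C0 / \<kappa>0)" using n0 by linarith
      then show ?case using bound[of n] elim by auto
    qed
    then show "\<forall>\<^sub>F n in admissible_sizes w. norm (\<epsilon> n) \<le> K * norm (1 / real n)"
      unfolding admissible_sizes_def eventually_inf_principal .
  qed
  moreover have "measure_pmf.expectation (simply_generated_tree w n) ?X = (1 + \<epsilon> n) * \<gamma> * t ^ n" for n
    using pos by (simp add: \<epsilon>_def field_simps)
  ultimately have "expectation_asymptotics w ?X \<gamma> t"
    unfolding expectation_asymptotics_def by (intro bexI[of _ \<epsilon>] always_eventually allI)
  then show ?thesis using pos(1) by (auto simp: t_def)
qed

end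

theorem theorem2p4:
  fixes w :: "nat \<Rightarrow> real" and \<xi> :: "nat pmf"
  shows "(admissible_weights w \<longrightarrow>
           (\<forall>m::nat. m \<ge> 1 \<longrightarrow> (\<exists>\<gamma>>0.
              expectation_asymptotics w (\<lambda>T. real (num_subtrees T) ^ m) \<gamma> (tau w m))) \<and>
           (\<forall>m l::nat. \<exists>\<gamma>>0.
              expectation_asymptotics w
                (\<lambda>T. real (num_root_subtrees T) ^ l * real (num_subtrees T) ^ m) \<gamma> (tau w (l + m)))) \<and>
         (admissible_offspring \<xi> \<longrightarrow> admissible_weights (pmf \<xi>))"
proof (intro conjI impI allI)
  assume "admissible_weights w"
  then interpret gen_weights w by (rule admissible_weights_imp_gen_weights)
  show "\<exists>\<gamma>>0. expectation_asymptotics w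
      (\<lambda>T. real (num_root_subtrees T) ^ l * real (num_subtrees T) ^ m) \<gamma> (tau w (l + m))" for m l
    by (rule moment_expectation_asymptotics)
  show "\<exists>\<gamma>>0. expectation_asymptotics w (\<lambda>T. real (num_subtrees T) ^ m) \<gamma> (tau w m)" for m
    using moment_expectation_asymptotics[of 0 m] by simp
next
  assume "admissible_offspring \<xi>"
  then show "admissible_weights (pmf \<xi>)" by (rule admissible_offspring_imp_admissible_weights)
qed

end
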